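(* Let $G$ be a finite group, let $N$ be a normal subgroup of $G$, and let $\theta$ be an irreducible complex character of $N$ such that the dual character $\overline\theta$ is $G$-conjugate to $\theta$. Then the number of real-valued irreducible characters of $G$ lying over $\theta$ equals the number of $\theta$-good conjugacy classes of $G_\theta/N$ of $\sigma_+$ type minus the number of $\theta$-good conjugacy classes of $G_\theta/N$ of $\sigma_-$ type.
   Context: All characters are complex characters of finite groups. For a character $\psi$ of a subgroup $H\le G$ and $g\in G$, $\psi^g$ is the conjugate character of $H^g=g^{-1}Hg$, given by $\psi^g(h^g)=\psi(h)$, where $h^g=g^{-1}hg$; $\overline\psi$ is the complex conjugate (dual) character. An irreducible character $\chi$ of $G$ lies over $\theta$ if $\chi$ is a constituent of the induced character $\theta{\uparrow^G}$. The inertia group of $\theta$ in $G$ is $G_\theta=\{g\in G\mid \theta^g=\theta\}$, and the extended inertia group is $G_\theta^*=\{g\in G\mid \theta^g=\theta\text{ or }\theta^g=\overline\theta\}$. Write $\overline G=G/N$, and write $\overline x=xN$ for $x\in G$, and $\overline{G}_\theta=G_\theta/N$. For $x\in G_\theta$, the character $\theta$ extends to an irreducible character $\theta_x$ of $N\langle x\rangle$; fix such an extension. Good elements: an element $\overline x\in \overline G_\theta$ is good for $\theta$ if $\theta_x^c=\theta_x$ for all $c\in G_\theta$ with $\overline x^{\,c}=\overline x$ (i.e. for all $c\in G_\theta$ whose image in $G/N$ centralizes $\overline x$). This does not depend on the choice of the extension $\theta_x$, and it is invariant under conjugation in $\overline G_\theta$, so one speaks of the $\theta$-good conjugacy classes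 of $\overline G_\theta=G_\theta/N$. Types: let $\overline x\in\overline G_\theta$ be good for $\theta$. If there is $e\in G_\theta^*$ with $\overline x^{\,e}=\overline x^{-1}$ and $\theta^e=\overline\theta$, set $\sigma(\overline x)=+1$ if $\theta_x^e=\overline{\theta_x}$ and $\sigma(\overline x)=-1$ if $\theta_x^e\neq\overline{\theta_x}$. If no such $e$ exists, set $\sigma(\overline x)=0$. The value $\sigma(\overline x)$ does not depend on the choice of $e$ or of $\theta_x$, and is constant on conjugacy classes of $\overline G_\theta$. A $\theta$-good conjugacy class of $G_\theta/N$ is of $\sigma_+$, $\sigma_-$ or $\sigma_0$ type according to whether $\sigma=+1$, $-1$ or $0$ on it. *)

theory Defs
  imports "HOL-Algebra.Algebra" "Jordan_Normal_Form.VS_Connect"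
begin

section \<open>Complex characters of groups\<close>

definition GL :: "nat \<Rightarrow> complex mat monoid" where
  "GL n = units_of (ring_mat TYPE(complex) n ())"

definition representation :: "('a, 'b) monoid_scheme \<Rightarrow> nat \<Rightarrow> ('a \<Rightarrow> complex mat) \<Rightarrow> bool" where
  "representation G n \<rho> \<longleftrightarrow> \<rho> \<in> hom G (GL n)"

definition invariant_subspace ::
  "('a, 'b) monoid_scheme \<Rightarrow> nat \<Rightarrow> ('a \<Rightarrow> complex mat) \<Rightarrow> complex vec set \<Rightarrow> bool" where
  "invariant_subspace G n \<rho> W \<longleftrightarrow>
     subspace class_ring W (module_vec TYPE(complex) n) \<and>
     (\<forall>g\<in>carrier G. \<forall>w\<in>W. \<rho> g *\<^sub>v w \<in> W)"

definition irreducible_representation ::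
  "('a, 'b) monoid_scheme \<Rightarrow> nat \<Rightarrow> ('a \<Rightarrow> complex mat) \<Rightarrow> bool" where
  "irreducible_representation G n \<rho> \<longleftrightarrow>
     representation G n \<rho> \<and> n \<noteq> 0 \<and>
     (\<forall>W. invariant_subspace G n \<rho> W \<longrightarrow> W = {0\<^sub>v n} \<or> W = carrier_vec n)"

text \<open>
  Characters of a group are total functions that vanish outside its carrier, so that two
  characters of the same subgroup are equal as functions iff they agree on the subgroup.
  The characters of a subgroup \<open>H\<close> of \<open>G\<close> are those of \<open>G\<lparr>carrier := H\<rparr>\<close>.
\<close>

definition afforded_character ::
  "('a, 'b) monoid_scheme \<Rightarrow> nat \<Rightarrow> ('a \<Rightarrow> complex mat) \<Rightarrow> 'a \<Rightarrow> complex" where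
  "afforded_character G n \<rho> = (\<lambda>g. if g \<in> carrier G then \<Sum>i<n. \<rho> g $$ (i, i) else 0)"

definition Irr :: "('a, 'b) monoid_scheme \<Rightarrow> ('a \<Rightarrow> complex) set" where
  "Irr G = {afforded_character G n \<rho> | n \<rho>. irreducible_representation G n \<rho>}"

definition dual_character :: "('a \<Rightarrow> complex) \<Rightarrow> 'a \<Rightarrow> complex" where
  "dual_character \<psi> = (\<lambda>x. cnj (\<psi> x))"

text \<open>
  The conjugate \<open>\<psi>\<^sup>g\<close> takes the value \<open>\<psi> h\<close> at \<open>g\<inverse> h g\<close>. If \<open>\<psi>\<close> vanishes outside the subgroup
  \<open>H\<close>, then \<open>\<psi>\<^sup>g\<close> vanishes outside \<open>g\<inverse> H g\<close>.
\<close>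

definition conj_character ::
  "('a, 'b) monoid_scheme \<Rightarrow> ('a \<Rightarrow> complex) \<Rightarrow> 'a \<Rightarrow> 'a \<Rightarrow> complex" where
  "conj_character G \<psi> g =
     (\<lambda>x. if x \<in> carrier G then \<psi> (g \<otimes>\<^bsub>G\<^esub> x \<otimes>\<^bsub>G\<^esub> inv\<^bsub>G\<^esub> g) else 0)"

text \<open>The zero extension of \<open>\<psi>\<close> from \<open>H\<close> to \<open>G\<close> in the induction formula is \<open>\<psi>\<close> itself.\<close>

definition induced_character ::
  "('a, 'b) monoid_scheme \<Rightarrow> 'a set \<Rightarrow> ('a \<Rightarrow> complex) \<Rightarrow> 'a \<Rightarrow> complex" where
  "induced_character G H \<psi> =
     (\<lambda>g. if g \<in> carrier G
          then (\<Sum>x\<in>carrier G. \<psi> (x \<otimes>\<^bsub>G\<^esub> g \<otimes>\<^bsub>G\<^esub> inv\<^bsub>G\<^esub> x)) / of_nat (card H)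
          else 0)"

text \<open>
  \<open>\<chi>\<close> occurs with positive multiplicity in the decomposition of \<open>\<psi>\<close> into irreducible characters.
  The sum ranges over a finite set when \<open>G\<close> is finite.
\<close>

definition constituent ::
  "('a, 'b) monoid_scheme \<Rightarrow> ('a \<Rightarrow> complex) \<Rightarrow> ('a \<Rightarrow> complex) \<Rightarrow> bool" where
  "constituent G \<chi> \<psi> \<longleftrightarrow>
     \<chi> \<in> Irr G \<and>
     (\<exists>m :: ('a \<Rightarrow> complex) \<Rightarrow> nat.
        \<psi> = (\<lambda>g. \<Sum>\<xi>\<in>Irr G. of_nat (m \<xi>) * \<xi> g) \<and> 0 < m \<chi>)"

definition lies_over ::
  "('a, 'b) monoid_scheme \<Rightarrow> 'a set \<Rightarrow> ('a \<Rightarrow> complex) \<Rightarrow> ('a \<Rightarrow> complex) \<Rightarrow> bool" where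
  "lies_over G N \<theta> \<chi> \<longleftrightarrow> constituent G \<chi> (induced_character G N \<theta>)"

section \<open>Conjugation in a group\<close>

definition conj_elem :: "('a, 'b) monoid_scheme \<Rightarrow> 'a \<Rightarrow> 'a \<Rightarrow> 'a" where
  "conj_elem G x g = inv\<^bsub>G\<^esub> g \<otimes>\<^bsub>G\<^esub> x \<otimes>\<^bsub>G\<^esub> g"

definition conj_classes :: "('a, 'b) monoid_scheme \<Rightarrow> 'a set set" where
  "conj_classes G = {{conj_elem G x g | g. g \<in> carrier G} | x. x \<in> carrier G}"

section \<open>Inertia groups, good elements and types\<close>

definition inertia :: "('a, 'b) monoid_scheme \<Rightarrow> ('a \<Rightarrow> complex) \<Rightarrow> 'a set" where
  "inertia G \<theta> = {g \<in> carrier G. conj_character G \<theta> g = \<theta>}"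

definition extended_inertia :: "('a, 'b) monoid_scheme \<Rightarrow> ('a \<Rightarrow> complex) \<Rightarrow> 'a set" where
  "extended_inertia G \<theta> =
     {g \<in> carrier G. conj_character G \<theta> g = \<theta> \<or> conj_character G \<theta> g = dual_character \<theta>}"

abbreviation inertia_quotient ::
  "('a, 'b) monoid_scheme \<Rightarrow> 'a set \<Rightarrow> ('a \<Rightarrow> complex) \<Rightarrow> 'a set monoid" where
  "inertia_quotient G N \<theta> \<equiv> G\<lparr>carrier := inertia G \<theta>\<rparr> Mod N"

text \<open>
  A fixed extension of \<open>\<theta>\<close> to an irreducible character of \<open>N\<langle>x\<rangle>\<close>; it depends only on the coset \<open>N x\<close>.
\<close>

definition chosen_extension ::
  "('a, 'b) monoid_scheme \<Rightarrow> 'a set \<Rightarrow> ('a \<Rightarrow> complex) \<Rightarrow> 'a \<Rightarrow> 'a \<Rightarrow> complex" where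
  "chosen_extension G N \<theta> x =
     (SOME \<psi>. \<psi> \<in> Irr (G\<lparr>carrier := N <#>\<^bsub>G\<^esub> generate G {x}\<rparr>) \<and> (\<forall>n\<in>N. \<psi> n = \<theta> n))"

definition good ::
  "('a, 'b) monoid_scheme \<Rightarrow> 'a set \<Rightarrow> ('a \<Rightarrow> complex) \<Rightarrow> 'a \<Rightarrow> bool" where
  "good G N \<theta> x \<longleftrightarrow>
     (\<forall>c\<in>inertia G \<theta>.
        conj_elem (G Mod N) (N #>\<^bsub>G\<^esub> x) (N #>\<^bsub>G\<^esub> c) = N #>\<^bsub>G\<^esub> x \<longrightarrow>
        conj_character G (chosen_extension G N \<theta> x) c = chosen_extension G N \<theta> x)"

definition inverts ::
  "('a, 'b) monoid_scheme \<Rightarrow> 'a set \<Rightarrow> ('a \<Rightarrow> complex) \<Rightarrow> 'a \<Rightarrow> 'a \<Rightarrow> bool" where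
  "inverts G N \<theta> x e \<longleftrightarrow>
     e \<in> extended_inertia G \<theta> \<and>
     conj_elem (G Mod N) (N #>\<^bsub>G\<^esub> x) (N #>\<^bsub>G\<^esub> e) = inv\<^bsub>G Mod N\<^esub> (N #>\<^bsub>G\<^esub> x) \<and>
     conj_character G \<theta> e = dual_character \<theta>"

definition sigma ::
  "('a, 'b) monoid_scheme \<Rightarrow> 'a set \<Rightarrow> ('a \<Rightarrow> complex) \<Rightarrow> 'a \<Rightarrow> int" where
  "sigma G N \<theta> x =
     (if \<exists>e. inverts G N \<theta> x e
      then let e = (SOME e. inverts G N \<theta> x e) in
        if conj_character G (chosen_extension G N \<theta> x) e
             = dual_character (chosen_extension G N \<theta> x)
        then 1 else - 1
      else 0)"

text \<open>
  The elements of the quotient are cosets of \<open>N\<close>, so \<open>\<Union>C\<close> consists of all \<open>x\<close> in the inertia group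
  whose coset belongs to the class \<open>C\<close>.
\<close>

definition good_classes_of_type ::
  "('a, 'b) monoid_scheme \<Rightarrow> 'a set \<Rightarrow> ('a \<Rightarrow> complex) \<Rightarrow> int \<Rightarrow> 'a set set set" where
  "good_classes_of_type G N \<theta> s =
     {C \<in> conj_classes (inertia_quotient G N \<theta>). \<forall>x\<in>\<Union>C. good G N \<theta> x \<and> sigma G N \<theta> x = s}"

end

theory Submission
  imports Defs "Jordan_Normal_Form.Spectral_Radius"
begin

text \<open>
  For an irreducible character \<open>\<chi>\<close>, the sum of \<open>\<chi>(g)\<^sup>2\<close> over \<open>G\<close> is \<open>|G|\<close> or \<open>0\<close> according to
  whether \<open>\<chi>\<close> is real. Schur's lemma writes \<open>\<chi>(g)\<^sup>2\<close> as an average of \<open>\<chi>(1) \<chi>(c g c\<inverse> g)\<close> over \<open>c\<close>, and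
  by Clifford's degree formula the sum of \<open>\<chi>(1) \<chi>\<close> over the characters above \<open>\<theta>\<close> is a multiple of the
  induced character of \<open>\<theta>\<close>. So the number of real characters above \<open>\<theta>\<close> is
  \<open>\<theta>(1) / (|T| |N|)\<close> times the sum of \<open>\<theta>(c g c\<inverse> g)\<close> over all \<open>g\<close> and \<open>c\<close> in \<open>G\<close>, where \<open>T\<close> is the
  inertia group. Averaging \<open>c\<close> over \<open>N\<close> kills the terms with \<open>g\<close> outside \<open>T\<close> and turns the others
  into products \<open>\<psi>(c g c\<inverse>) \<psi>(g)\<close> for the extension \<open>\<psi>\<close> of \<open>\<theta>\<close> to \<open>N\<langle>g\<rangle>\<close>; averaging \<open>g\<close> over its coset
  leaves only those \<open>c\<close> that invert \<open>g\<close> modulo \<open>N\<close> and send \<open>\<theta>\<close> to its dual. These \<open>c\<close> form a coset of the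
  centraliser of \<open>N g\<close> in \<open>T\<close>, which acts on \<open>\<psi>\<close> through a linear character. That character is trivial
  exactly when \<open>g\<close> is good, and then each \<open>c\<close> contributes the sign \<open>\<sigma>\<close>. Orbit counting turns the sum
  over \<open>T\<close> into a sum over classes.
\<close>

section \<open>Traces and sums of matrices\<close>

text \<open>The obstacle is that \<open>good\<close> and \<open>sigma\<close> are read off from an
  extension chosen separately for each element and from one chosen inverting element, whereas the
  theorem counts classes. Their constancy on classes is not shown by comparing these choices.
  Instead \<open>csum_coset\<close> writes the sum of \<open>csum\<close> over N g, which involves
  no choice, as a nonzero constant times the order of \<open>cen g\<close> times
  \<open>weight g\<close>. Conjugation in the inertia group preserves the sum and the order, hence
  also the weight. Cyclic overgroups are large enough for this and small enough to control: an
  extension to N<g> exists because one root of one scalar can be extracted, and two extensions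
  differ on N g^i by the factor c^i for a single number c. So every comparison of
  \<open>\<psi>\<close> with a conjugate or a dual of a conjugate is recorded by one complex number
  (\<open>lam\<close> or \<open>\<mu>\<close> in \<open>twisted_sum\<close>), and each such number
  can be read off at any point of N g where \<open>\<psi>\<close> does not vanish.\<close>

definition mtrace :: "'a :: comm_monoid_add mat \<Rightarrow> 'a" where
  "mtrace A = (\<Sum>i<dim_row A. A $$ (i, i))"

lemma index_mult_mat_sum:
  assumes "A \<in> carrier_mat m n" "B \<in> carrier_mat n k" "i < m" "j < k"
  shows "(A * B) $$ (i, j) = (\<Sum>l<n. A $$ (i, l) * B $$ (l, j))"
  using assms by (auto simp: scalar_prod_def atLeast0LessThan)

lemma mtrace_mult_comm:
  fixes A :: "'a :: comm_semiring_0 mat"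
  assumes A: "A \<in> carrier_mat m n" and B: "B \<in> carrier_mat n m"
  shows "mtrace (A * B) = mtrace (B * A)"
proof -
  have "mtrace (A * B) = (\<Sum>i<m. \<Sum>l<n. A $$ (i, l) * B $$ (l, i))"
    using A B by (auto simp: mtrace_def index_mult_mat_sum simp del: index_mult_mat(1))
  also have "\<dots> = (\<Sum>l<n. \<Sum>i<m. A $$ (i, l) * B $$ (l, i))"
    by (rule sum.swap)
  also have "\<dots> = mtrace (B * A)"
    using A B by (auto simp: mtrace_def index_mult_mat_sum mult.commute simp del: index_mult_mat(1))
  finally show ?thesis .
qed

lemma mtrace_smult:
  fixes A :: "'a :: comm_semiring_0 mat"
  shows "A \<in> carrier_mat n n \<Longrightarrow> mtrace (c \<cdot>\<^sub>m A) = c * mtrace A"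
  by (auto simp: mtrace_def sum_distrib_left)

lemma mtrace_one: "mtrace (1\<^sub>m n :: 'a :: comm_semiring_1 mat) = of_nat n"
  by (simp add: mtrace_def)

lemma mtrace_zero: "mtrace (0\<^sub>m n n) = 0"
  by (simp add: mtrace_def)

lemma mtrace_conjugate:
  fixes A :: "'a :: comm_semiring_1 mat"
  assumes P: "P \<in> carrier_mat n n" and A: "A \<in> carrier_mat n n" and Q: "Q \<in> carrier_mat n n"
    and QP: "Q * P = 1\<^sub>m n"
  shows "mtrace (P * A * Q) = mtrace A"
proof -
  have "mtrace (P * A * Q) = mtrace (Q * (P * A))"
    using P A Q by (intro mtrace_mult_comm[where m = n and n = n]) auto
  also have "Q * (P * A) = (Q * P) * A"
    using P A Q by (intro assoc_mult_mat[symmetric])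
  finally show ?thesis using A by (simp add: QP)
qed

text \<open>Matrices of all sizes share one type, so an empty sum has no size of its own; hence the
  explicit dimensions.\<close>

definition msum :: "nat \<Rightarrow> nat \<Rightarrow> ('i \<Rightarrow> 'a :: comm_monoid_add mat) \<Rightarrow> 'i set \<Rightarrow> 'a mat" where
  "msum m n f A = mat m n (\<lambda>ij. \<Sum>a\<in>A. f a $$ ij)"

lemma msum_carrier [simp]: "msum m n f A \<in> carrier_mat m n"
  by (simp add: msum_def)

lemma msum_dim [simp]: "dim_row (msum m n f A) = m" "dim_col (msum m n f A) = n"
  by (simp_all add: msum_def)

lemma msum_index: "i < m \<Longrightarrow> j < n \<Longrightarrow> msum m n f A $$ (i, j) = (\<Sum>a\<in>A. f a $$ (i, j))"
  by (simp add: msum_def)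

lemma msum_cong: "(\<And>a. a \<in> A \<Longrightarrow> f a = g a) \<Longrightarrow> msum m n f A = msum m n g A"
  by (simp add: msum_def)

lemma msum_reindex: "bij_betw h A B \<Longrightarrow> msum m n f B = msum m n (\<lambda>a. f (h a)) A"
  by (auto simp: msum_def sum.reindex_bij_betw[symmetric])

lemma msum_mult_left:
  fixes f :: "'i \<Rightarrow> 'a :: comm_semiring_0 mat"
  assumes B: "B \<in> carrier_mat k m" and f: "\<And>a. a \<in> A \<Longrightarrow> f a \<in> carrier_mat m n"
  shows "B * msum m n f A = msum k n (\<lambda>a. B * f a) A"
proof (rule eq_matI)
  fix i j assume "i < dim_row (msum k n (\<lambda>a. B * f a) A)" "j < dim_col (msum k n (\<lambda>a. B * f a) A)"
  hence ij: "i < k" "j < n" by auto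
  have "(B * msum m n f A) $$ (i, j) = (\<Sum>l<m. B $$ (i, l) * msum m n f A $$ (l, j))"
    using ij B by (intro index_mult_mat_sum) auto
  also have "\<dots> = (\<Sum>l<m. \<Sum>a\<in>A. B $$ (i, l) * f a $$ (l, j))"
    using ij by (simp add: msum_index sum_distrib_left)
  also have "\<dots> = (\<Sum>a\<in>A. \<Sum>l<m. B $$ (i, l) * f a $$ (l, j))"
    by (rule sum.swap)
  also have "\<dots> = (\<Sum>a\<in>A. (B * f a) $$ (i, j))"
    using ij B f by (intro sum.cong refl) (simp add: index_mult_mat_sum[of _ k m _ n] del: index_mult_mat(1))
  finally show "(B * msum m n f A) $$ (i, j) = msum k n (\<lambda>a. B * f a) A $$ (i, j)"
    using ij by (simp add: msum_index)
qed (use B in auto)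

lemma msum_mult_right:
  fixes f :: "'i \<Rightarrow> 'a :: comm_semiring_0 mat"
  assumes B: "B \<in> carrier_mat n k" and f: "\<And>a. a \<in> A \<Longrightarrow> f a \<in> carrier_mat m n"
  shows "msum m n f A * B = msum m k (\<lambda>a. f a * B) A"
proof (rule eq_matI)
  fix i j assume "i < dim_row (msum m k (\<lambda>a. f a * B) A)" "j < dim_col (msum m k (\<lambda>a. f a * B) A)"
  hence ij: "i < m" "j < k" by auto
  have "(msum m n f A * B) $$ (i, j) = (\<Sum>l<n. msum m n f A $$ (i, l) * B $$ (l, j))"
    using ij B by (intro index_mult_mat_sum) auto
  also have "\<dots> = (\<Sum>l<n. \<Sum>a\<in>A. f a $$ (i, l) * B $$ (l, j))"
    using ij by (simp add: msum_index sum_distrib_right)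
  also have "\<dots> = (\<Sum>a\<in>A. \<Sum>l<n. f a $$ (i, l) * B $$ (l, j))"
    by (rule sum.swap)
  also have "\<dots> = (\<Sum>a\<in>A. (f a * B) $$ (i, j))"
    using ij B f by (intro sum.cong refl) (simp add: index_mult_mat_sum[of _ m n _ k] del: index_mult_mat(1))
  finally show "(msum m n f A * B) $$ (i, j) = msum m k (\<lambda>a. f a * B) A $$ (i, j)"
    using ij by (simp add: msum_index)
qed (use B in auto)

lemma mtrace_msum:
  assumes "\<And>a. a \<in> A \<Longrightarrow> f a \<in> carrier_mat n n"
  shows "mtrace (msum n n f A) = (\<Sum>a\<in>A. mtrace (f a))"
proof -
  have "mtrace (msum n n f A) = (\<Sum>i<n. \<Sum>a\<in>A. f a $$ (i, i))"
    by (simp add: mtrace_def msum_index)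
  also have "\<dots> = (\<Sum>a\<in>A. \<Sum>i<n. f a $$ (i, i))" by (rule sum.swap)
  also have "\<dots> = (\<Sum>a\<in>A. mtrace (f a))"
    using assms by (intro sum.cong refl) (auto simp: mtrace_def)
  finally show ?thesis .
qed

lemma mult_mat_vec_unit:
  fixes A :: "'a :: comm_semiring_1 mat"
  assumes "A \<in> carrier_mat m n" "j < n"
  shows "A *\<^sub>v unit_vec n j = col A j"
  using assms by (intro eq_vecI) auto

lemma mat_eq_zero_iff:
  fixes A :: "'a :: comm_semiring_1 mat"
  assumes A: "A \<in> carrier_mat m n" and "\<And>v. v \<in> carrier_vec n \<Longrightarrow> A *\<^sub>v v = 0\<^sub>v m"
  shows "A = 0\<^sub>m m n"
proof (rule eq_matI)
  fix i j assume ij: "i < dim_row (0\<^sub>m m n :: 'a mat)" "j < dim_col (0\<^sub>m m n :: 'a mat)"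
  have "col A j = 0\<^sub>v m"
    using ij A assms(2)[of "unit_vec n j"] by (simp add: mult_mat_vec_unit)
  hence "col A j $ i = 0" using ij by simp
  thus "A $$ (i, j) = 0\<^sub>m m n $$ (i, j)" using ij A by simp
qed (use A in auto)

section \<open>Representations and Schur's lemma\<close>

locale fin_group = group + assumes finite_carrier: "finite (carrier G)"

lemma GL_carrier: "A \<in> carrier (GL n) \<longleftrightarrow>
    A \<in> carrier_mat n n \<and> (\<exists>B\<in>carrier_mat n n. B * A = 1\<^sub>m n \<and> A * B = 1\<^sub>m n)"
  unfolding GL_def units_of_def Units_def by (auto simp: ring_mat_def)

lemma GL_mult: "A \<otimes>\<^bsub>GL n\<^esub> B = A * B"
  by (simp add: GL_def units_of_def ring_mat_def)

context fin_group
begin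

lemma representation_iff:
  "representation G n \<rho> \<longleftrightarrow>
     (\<forall>g\<in>carrier G. \<rho> g \<in> carrier_mat n n) \<and>
     (\<forall>g\<in>carrier G. \<forall>h\<in>carrier G. \<rho> (g \<otimes> h) = \<rho> g * \<rho> h) \<and> \<rho> \<one> = 1\<^sub>m n"
  (is "?L \<longleftrightarrow> ?R")
proof
  assume ?L
  hence *: "\<rho> g \<in> carrier (GL n)" if "g \<in> carrier G" for g
    using that by (auto simp: representation_def hom_def)
  have mult: "\<rho> (g \<otimes> h) = \<rho> g * \<rho> h" if "g \<in> carrier G" "h \<in> carrier G" for g h
    using that \<open>?L\<close> by (auto simp: representation_def hom_def GL_mult)
  obtain B where B: "B \<in> carrier_mat n n" "B * \<rho> \<one> = 1\<^sub>m n" and c: "\<rho> \<one> \<in> carrier_mat n n"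
    using *[of \<one>] by (auto simp: GL_carrier)
  \<comment> \<open>\<open>\<rho> \<one>\<close> is an invertible idempotent; cancelling its inverse
    \<open>B\<close> leaves the identity.\<close>
  have "B * (\<rho> \<one> * \<rho> \<one>) = (B * \<rho> \<one>) * \<rho> \<one>"
    using B c by (intro assoc_mult_mat[symmetric])
  hence "B * \<rho> \<one> = \<rho> \<one>" using mult[of \<one> \<one>] B c by simp
  with * mult B show ?R by (auto simp: GL_carrier)
next
  assume R: ?R
  have "\<rho> g \<in> carrier (GL n)" if "g \<in> carrier G" for g
  proof -
    have "\<rho> (inv g) * \<rho> g = 1\<^sub>m n" "\<rho> g * \<rho> (inv g) = 1\<^sub>m n"
      using R that by (metis inv_closed l_inv, metis inv_closed r_inv)
    thus ?thesis using R that by (auto simp: GL_carrier)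
  qed
  with R show ?L by (auto simp: representation_def hom_def GL_mult)
qed

lemma rep_carrier: "representation G n \<rho> \<Longrightarrow> g \<in> carrier G \<Longrightarrow> \<rho> g \<in> carrier_mat n n"
  by (simp add: representation_iff)

lemma rep_mult:
  "representation G n \<rho> \<Longrightarrow> g \<in> carrier G \<Longrightarrow> h \<in> carrier G \<Longrightarrow> \<rho> (g \<otimes> h) = \<rho> g * \<rho> h"
  by (simp add: representation_iff)

lemma rep_one: "representation G n \<rho> \<Longrightarrow> \<rho> \<one> = 1\<^sub>m n"
  by (simp add: representation_iff)

lemma rep_inv: "representation G n \<rho> \<Longrightarrow> g \<in> carrier G \<Longrightarrow> \<rho> g * \<rho> (inv g) = 1\<^sub>m n"
  "representation G n \<rho> \<Longrightarrow> g \<in> carrier G \<Longrightarrow> \<rho> (inv g) * \<rho> g = 1\<^sub>m n"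
  by (metis inv_closed r_inv rep_mult rep_one, metis inv_closed l_inv rep_mult rep_one)

lemma afforded_eq_mtrace:
  "representation G n \<rho> \<Longrightarrow> g \<in> carrier G \<Longrightarrow> afforded_character G n \<rho> g = mtrace (\<rho> g)"
  using rep_carrier[of n \<rho> g] by (auto simp: afforded_character_def mtrace_def)

end

lemma module_vec_module: "vectorspace class_ring (module_vec TYPE('a :: field) n)"
  using vec_vs[of n] by simp

lemma subspace_iff:
  fixes W :: "complex vec set"
  shows "subspace class_ring W (module_vec TYPE(complex) n) \<longleftrightarrow>
     W \<subseteq> carrier_vec n \<and> 0\<^sub>v n \<in> W \<and> (\<forall>v\<in>W. \<forall>w\<in>W. v + w \<in> W) \<and> (\<forall>c. \<forall>v\<in>W. c \<cdot>\<^sub>v v \<in> W)"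
  using module_vec_module[of n, where 'a = complex]
  by (auto simp: subspace_def submodule_def vectorspace_def module_vec_simps)

lemma invariant_subspaceI:
  assumes "W \<subseteq> carrier_vec n" "0\<^sub>v n \<in> W" "\<And>v w. v \<in> W \<Longrightarrow> w \<in> W \<Longrightarrow> v + w \<in> W"
    "\<And>c v. v \<in> W \<Longrightarrow> c \<cdot>\<^sub>v v \<in> W" "\<And>g v. g \<in> carrier G \<Longrightarrow> v \<in> W \<Longrightarrow> \<rho> g *\<^sub>v v \<in> W"
  shows "invariant_subspace G n \<rho> W"
  using assms by (auto simp: invariant_subspace_def subspace_iff)

lemma irreducibleD:
  assumes "irreducible_representation G n \<rho>" "invariant_subspace G n \<rho> W"
  shows "W = {0\<^sub>v n} \<or> W = carrier_vec n"
  using assms by (auto simp: irreducible_representation_def)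

context fin_group
begin

lemma intertwiner_kernel_invariant:
  assumes \<rho>: "representation G n \<rho>" and \<sigma>: "representation G m \<sigma>"
    and T: "T \<in> carrier_mat m n" and TI: "\<And>g. g \<in> carrier G \<Longrightarrow> T * \<rho> g = \<sigma> g * T"
  shows "invariant_subspace G n \<rho> {v \<in> carrier_vec n. T *\<^sub>v v = 0\<^sub>v m}"
proof (rule invariant_subspaceI, goal_cases)
  case (5 g v)
  have "T *\<^sub>v (\<rho> g *\<^sub>v v) = (T * \<rho> g) *\<^sub>v v"
    using 5 by (intro assoc_mult_mat_vec[OF T rep_carrier[OF \<rho>], symmetric]) auto
  also have "\<dots> = \<sigma> g *\<^sub>v (T *\<^sub>v v)"
    using 5 by (simp add: TI assoc_mult_mat_vec[OF rep_carrier[OF \<sigma>] T])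
  also have "\<dots> = 0\<^sub>v m" using 5 rep_carrier[OF \<sigma>, of g] by auto
  finally show ?case using 5 rep_carrier[OF \<rho>, of g] by auto
qed (use T in \<open>auto simp: mult_add_distrib_mat_vec mult_mat_vec\<close>)

text \<open>By irreducibility the kernel of \<open>T\<close> is zero and its image is everything.
  Preimages of the unit vectors form a right inverse \<open>S\<close>; injectivity then turns
  \<open>T * (S * T - 1) = 0\<close> into \<open>S * T = 1\<close>.\<close>

lemma schur_iso:
  assumes \<rho>: "irreducible_representation G n \<rho>" and \<sigma>: "irreducible_representation G m \<sigma>"
    and T: "T \<in> carrier_mat m n" and TI: "\<And>g. g \<in> carrier G \<Longrightarrow> T * \<rho> g = \<sigma> g * T"
    and T0: "T \<noteq> 0\<^sub>m m n"
  shows "n = m \<and> (\<exists>S\<in>carrier_mat n m. T * S = 1\<^sub>m m \<and> S * T = 1\<^sub>m n)"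
proof -
  have r: "representation G n \<rho>" and s: "representation G m \<sigma>"
    using \<rho> \<sigma> by (auto simp: irreducible_representation_def)
  let ?K = "{v \<in> carrier_vec n. T *\<^sub>v v = 0\<^sub>v m}" and ?I = "(\<lambda>v. T *\<^sub>v v) ` carrier_vec n"
  have "?K = {0\<^sub>v n} \<or> ?K = carrier_vec n"
    by (rule irreducibleD[OF \<rho>]) (rule intertwiner_kernel_invariant[OF r s T TI])
  hence K: "?K = {0\<^sub>v n}"
    using mat_eq_zero_iff[OF T] T0 by blast
  have "invariant_subspace G m \<sigma> ?I"
  proof (rule invariant_subspaceI, goal_cases)
    case 2
    have "T *\<^sub>v 0\<^sub>v n = 0\<^sub>v m" using T by auto
    thus ?case by (metis imageI zero_carrier_vec)
  next
    case (3 v w)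
    thus ?case using T by (auto simp: mult_add_distrib_mat_vec[symmetric])
  next
    case (4 c v)
    then obtain u where u: "u \<in> carrier_vec n" "v = T *\<^sub>v u" by auto
    hence "c \<cdot>\<^sub>v v = T *\<^sub>v (c \<cdot>\<^sub>v u)" using T by (simp add: mult_mat_vec)
    thus ?case using u by auto
  next
    case (5 g v)
    then obtain u where u: "u \<in> carrier_vec n" "v = T *\<^sub>v u" by auto
    have "\<sigma> g *\<^sub>v v = T *\<^sub>v (\<rho> g *\<^sub>v u)"
      using u 5 T rep_carrier[OF s] rep_carrier[OF r] TI
      by (metis assoc_mult_mat_vec)
    thus ?case using u rep_carrier[OF r] 5 by (metis imageI mult_mat_vec_carrier)
  qed (use T in auto)
  hence "?I = {0\<^sub>v m} \<or> ?I = carrier_vec m" by (rule irreducibleD[OF \<sigma>])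
  moreover have "?I \<noteq> {0\<^sub>v m}" using mat_eq_zero_iff[OF T] T0 by blast
  ultimately have I: "?I = carrier_vec m" by blast
  have "\<exists>v. v \<in> carrier_vec n \<and> T *\<^sub>v v = unit_vec m j" for j
    using I unit_vec_carrier[of m j] by (metis (no_types, lifting) imageE)
  then obtain v where v: "\<And>j. v j \<in> carrier_vec n" "\<And>j. T *\<^sub>v v j = unit_vec m j" by metis
  define S where "S = mat_of_cols n (map v [0..<m])"
  have S: "S \<in> carrier_mat n m" unfolding S_def by (metis length_map length_upt mat_of_cols_carrier(1) minus_nat.diff_0)
  have colS: "col S j = v j" if "j < m" for j using that v(1) by (simp add: S_def)
  have TS: "T * S = 1\<^sub>m m"
  proof (rule mat_col_eqI)
    fix j assume "j < dim_col (1\<^sub>m m :: complex mat)"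
    thus "col (T * S) j = col (1\<^sub>m m) j"
      using T S by (subst col_mult2[OF T S]) (simp_all add: colS v)
  qed (use T S in auto)
  have ST: "S * T = 1\<^sub>m n"
  proof -
    let ?D = "S * T - 1\<^sub>m n"
    have D: "?D \<in> carrier_mat n n" using S T by auto
    have "T * ?D = T * (S * T) - T * 1\<^sub>m n"
      by (rule mult_minus_distrib_mat[OF T]) (use S T in auto)
    also have "\<dots> = 0\<^sub>m m n" using S T TS assoc_mult_mat[OF T S T] by simp
    finally have TD: "T * ?D = 0\<^sub>m m n" .
    have "?D *\<^sub>v u = 0\<^sub>v n" if u: "u \<in> carrier_vec n" for u
    proof -
      have "T *\<^sub>v (?D *\<^sub>v u) = 0\<^sub>v m"
      proof -
        have "0\<^sub>m m n *\<^sub>v u = 0\<^sub>v m" using u by (intro eq_vecI) auto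
        thus ?thesis using assoc_mult_mat_vec[OF T D u] TD by metis
      qed
      moreover have "?D *\<^sub>v u \<in> carrier_vec n" using mult_mat_vec_carrier[OF D u] .
      ultimately show ?thesis using K by blast
    qed
    hence "?D = 0\<^sub>m n n" by (rule mat_eq_zero_iff[OF D])
    hence E: "?D $$ (i, j) = 0" if "i < n" "j < n" for i j using that by simp
    show ?thesis
    proof (rule eq_matI)
      fix i j assume ij: "i < dim_row (1\<^sub>m n :: complex mat)" "j < dim_col (1\<^sub>m n :: complex mat)"
      hence ij': "i < n" "j < n" by auto
      have "?D $$ (i, j) = (S * T) $$ (i, j) - 1\<^sub>m n $$ (i, j)"
        using ij' by (intro index_minus_mat(1)) auto
      thus "(S * T) $$ (i, j) = 1\<^sub>m n $$ (i, j)" using E[OF ij'] by simp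
    qed (use S T in auto)
  qed
  \<comment> \<open>The two traces are the dimensions \<open>m\<close> and \<open>n\<close>, so the
    sizes agree in characteristic zero.\<close>
  have "mtrace (T * S) = mtrace (S * T)" by (rule mtrace_mult_comm[OF T S])
  hence "of_nat m = (of_nat n :: complex)" by (simp add: TS ST mtrace_one)
  hence "m = n" by simp
  thus ?thesis using S TS ST by auto
qed

text \<open>Subtracting an eigenvalue from \<open>T\<close> leaves an intertwiner with nonzero
  kernel, which is not invertible and therefore vanishes.\<close>

lemma schur_scalar:
  assumes \<rho>: "irreducible_representation G n \<rho>"
    and T: "T \<in> carrier_mat n n" and TI: "\<And>g. g \<in> carrier G \<Longrightarrow> T * \<rho> g = \<rho> g * T"
  shows "\<exists>c. T = c \<cdot>\<^sub>m 1\<^sub>m n"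
proof -
  have r: "representation G n \<rho>" and n: "n > 0"
    using \<rho> by (auto simp: irreducible_representation_def)
  from spectrum_non_empty[OF T n] obtain c u where u: "eigenvector T u c"
    by (auto simp: spectrum_def eigenvalue_def)
  let ?D = "T - c \<cdot>\<^sub>m 1\<^sub>m n"
  have D: "?D \<in> carrier_mat n n" by auto
  have DI: "?D * \<rho> g = \<rho> g * ?D" if g: "g \<in> carrier G" for g
  proof -
    have R: "\<rho> g \<in> carrier_mat n n" using rep_carrier[OF r g] .
    have "?D * \<rho> g = T * \<rho> g - (c \<cdot>\<^sub>m 1\<^sub>m n) * \<rho> g"
      by (rule minus_mult_distrib_mat) (use T R in auto)
    moreover have "\<rho> g * ?D = \<rho> g * T - \<rho> g * (c \<cdot>\<^sub>m 1\<^sub>m n)"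
      by (rule mult_minus_distrib_mat) (use T R in auto)
    moreover have "(c \<cdot>\<^sub>m 1\<^sub>m n) * \<rho> g = \<rho> g * (c \<cdot>\<^sub>m 1\<^sub>m n)"
      using mult_smult_distrib[OF R, of "1\<^sub>m n" n c] mult_smult_assoc_mat[of "1\<^sub>m n" n n "\<rho> g" n c] R
      by simp
    ultimately show ?thesis by (simp add: TI g)
  qed
  have Dv: "?D *\<^sub>v v = T *\<^sub>v v - c \<cdot>\<^sub>v v" if "v \<in> carrier_vec n" for v
    using that T by (subst minus_mult_distrib_mat_vec[of _ n n]) (auto intro!: eq_vecI)
  have "?D = 0\<^sub>m n n"
  proof (rule ccontr)
    assume "?D \<noteq> 0\<^sub>m n n"
    from schur_iso[OF \<rho> \<rho> D DI this]
    obtain S where S: "S \<in> carrier_mat n n" "S * ?D = 1\<^sub>m n" by blast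
    have u': "u \<in> carrier_vec n" "u \<noteq> 0\<^sub>v n" "T *\<^sub>v u = c \<cdot>\<^sub>v u" using u T by (auto simp: eigenvector_def)
    have "?D *\<^sub>v u = 0\<^sub>v n" using u' Dv[of u] by (auto intro!: eq_vecI)
    hence "(S * ?D) *\<^sub>v u = S *\<^sub>v 0\<^sub>v n" using assoc_mult_mat_vec[OF S(1) D u'(1)] by simp
    hence "u = 0\<^sub>v n" using S u' by auto
    thus False using u' by simp
  qed
  hence E: "?D $$ (i, j) = 0" if "i < n" "j < n" for i j using that by simp
  have "T = c \<cdot>\<^sub>m 1\<^sub>m n"
  proof (rule eq_matI)
    fix i j assume ij: "i < dim_row (c \<cdot>\<^sub>m 1\<^sub>m n)" "j < dim_col (c \<cdot>\<^sub>m 1\<^sub>m n)"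
    thus "T $$ (i, j) = (c \<cdot>\<^sub>m 1\<^sub>m n) $$ (i, j)" using E[of i j] by simp
  qed (use T in auto)
  thus ?thesis by blast
qed

end

section \<open>Orthogonality relations\<close>

context fin_group
begin

lemma card_carrier_pos: "card (carrier G) > 0"
  using finite_carrier one_closed by (auto simp: card_gt_0_iff)

lemma bij_left_mult: "h \<in> carrier G \<Longrightarrow> bij_betw (\<lambda>g. h \<otimes> g) (carrier G) (carrier G)"
  by (rule bij_betwI[where g = "\<lambda>g. inv h \<otimes> g"]) (auto simp: m_assoc[symmetric])

lemma bij_right_mult: "h \<in> carrier G \<Longrightarrow> bij_betw (\<lambda>g. g \<otimes> h) (carrier G) (carrier G)"
  by (rule bij_betwI[where g = "\<lambda>g. g \<otimes> inv h"]) (auto simp: m_assoc)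

text \<open>Substituting h g for the summation variable g moves h from one side of the average to
  the other.\<close>

lemma average_intertwines:
  assumes \<rho>: "representation G n \<rho>" and \<sigma>: "representation G m \<sigma>" and U: "U \<in> carrier_mat m n"
    and h: "h \<in> carrier G"
  shows "msum m n (\<lambda>g. \<sigma> g * U * \<rho> (inv g)) (carrier G) * \<rho> h
       = \<sigma> h * msum m n (\<lambda>g. \<sigma> g * U * \<rho> (inv g)) (carrier G)"
proof -
  note [simp] = rep_carrier[OF \<rho>] rep_carrier[OF \<sigma>]
  have c: "\<sigma> g * U * \<rho> (inv g) \<in> carrier_mat m n" if "g \<in> carrier G" for g
    using that U by (intro mult_carrier_mat[where n = n] mult_carrier_mat[where n = m]) auto
  have "msum m n (\<lambda>g. \<sigma> g * U * \<rho> (inv g)) (carrier G) * \<rho> h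
      = msum m n (\<lambda>g. \<sigma> g * U * \<rho> (inv g) * \<rho> h) (carrier G)"
    by (rule msum_mult_right) (use h c in auto)
  also have "\<dots> = msum m n (\<lambda>g. \<sigma> (h \<otimes> g) * U * \<rho> (inv (h \<otimes> g)) * \<rho> h) (carrier G)"
    by (rule msum_reindex[OF bij_left_mult[OF h]])
  also have "\<dots> = msum m n (\<lambda>g. \<sigma> h * (\<sigma> g * U * \<rho> (inv g))) (carrier G)"
  proof (rule msum_cong)
    fix g assume g: "g \<in> carrier G"
    have sx: "\<sigma> g * U \<in> carrier_mat m n" "\<sigma> (h \<otimes> g) * U \<in> carrier_mat m n"
      using g h U by (auto intro!: mult_carrier_mat[where n = m])
    have "\<rho> (inv (h \<otimes> g)) * \<rho> h = \<rho> (inv g)"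
      using g h by (simp add: rep_mult[OF \<rho>, symmetric] inv_mult_group m_assoc)
    hence "\<sigma> (h \<otimes> g) * U * \<rho> (inv (h \<otimes> g)) * \<rho> h = \<sigma> (h \<otimes> g) * U * \<rho> (inv g)"
      using g h sx by (subst assoc_mult_mat[of _ m n _ n _ n]) auto
    moreover have "\<sigma> (h \<otimes> g) * U = \<sigma> h * (\<sigma> g * U)"
      using g h U by (simp add: rep_mult[OF \<sigma>] assoc_mult_mat[of _ m m _ m _ n])
    moreover have "\<sigma> h * (\<sigma> g * U) * \<rho> (inv g) = \<sigma> h * (\<sigma> g * U * \<rho> (inv g))"
      using g h sx by (subst assoc_mult_mat[of _ m m _ n _ n]) auto
    ultimately show "\<sigma> (h \<otimes> g) * U * \<rho> (inv (h \<otimes> g)) * \<rho> h = \<sigma> h * (\<sigma> g * U * \<rho> (inv g))"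
      by (simp only:)
  qed
  also have "\<dots> = \<sigma> h * msum m n (\<lambda>g. \<sigma> g * U * \<rho> (inv g)) (carrier G)"
    by (rule msum_mult_left[symmetric]) (use h c in auto)
  finally show ?thesis .
qed

lemma equivalent_afforded:
  assumes \<rho>: "representation G n \<rho>" and \<sigma>: "representation G n \<sigma>"
    and T: "T \<in> carrier_mat n n" and S: "S \<in> carrier_mat n n" and TS: "T * S = 1\<^sub>m n" "S * T = 1\<^sub>m n"
    and TI: "\<And>g. g \<in> carrier G \<Longrightarrow> T * \<rho> g = \<sigma> g * T"
  shows "afforded_character G n \<rho> = afforded_character G n \<sigma>"
proof
  fix g
  show "afforded_character G n \<rho> g = afforded_character G n \<sigma> g"
  proof (cases "g \<in> carrier G")
    case True
    note R = rep_carrier[OF \<rho> True] rep_carrier[OF \<sigma> True]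
    have "\<sigma> g * T * S = \<sigma> g * (T * S)" by (rule assoc_mult_mat[OF R(2) T S])
    hence "\<sigma> g = T * \<rho> g * S" using R by (simp add: TI True TS)
    thus ?thesis using mtrace_conjugate[OF T R(1) S TS(2)] True
      by (simp add: afforded_eq_mtrace[OF \<rho>] afforded_eq_mtrace[OF \<sigma>])
  qed (simp add: afforded_character_def)
qed

lemma irr_rep: "irreducible_representation G n \<rho> \<Longrightarrow> representation G n \<rho>"
  by (simp add: irreducible_representation_def)

lemma average_zero:
  assumes \<rho>: "irreducible_representation G n \<rho>" and \<sigma>: "irreducible_representation G m \<sigma>"
    and U: "U \<in> carrier_mat m n" and ne: "afforded_character G n \<rho> \<noteq> afforded_character G m \<sigma>"
  shows "msum m n (\<lambda>g. \<sigma> g * U * \<rho> (inv g)) (carrier G) = 0\<^sub>m m n"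
proof (rule ccontr)
  let ?T = "msum m n (\<lambda>g. \<sigma> g * U * \<rho> (inv g)) (carrier G)"
  note int = average_intertwines[OF irr_rep[OF \<rho>] irr_rep[OF \<sigma>] U]
  assume "?T \<noteq> 0\<^sub>m m n"
  from schur_iso[OF \<rho> \<sigma> _ int this] obtain S where
    "n = m" "S \<in> carrier_mat n m" "?T * S = 1\<^sub>m m" "S * ?T = 1\<^sub>m n" by auto
  with equivalent_afforded[OF irr_rep[OF \<rho>], of \<sigma> ?T S] irr_rep[OF \<sigma>] int ne
  show False by simp
qed

text \<open>The average commutes with the representation, so it is a scalar matrix. The scalar is
  found by traces: every summand has the trace of \<open>U\<close>.\<close>

lemma average_scalar:
  assumes \<rho>: "irreducible_representation G n \<rho>" and U: "U \<in> carrier_mat n n"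
  shows "msum n n (\<lambda>g. \<rho> g * U * \<rho> (inv g)) (carrier G)
       = (of_nat (card (carrier G)) * mtrace U / of_nat n) \<cdot>\<^sub>m 1\<^sub>m n"
proof -
  let ?T = "msum n n (\<lambda>g. \<rho> g * U * \<rho> (inv g)) (carrier G)"
  note r = irr_rep[OF \<rho>]
  have n: "n \<noteq> 0" using \<rho> by (simp add: irreducible_representation_def)
  obtain c where c: "?T = c \<cdot>\<^sub>m 1\<^sub>m n"
    using schur_scalar[OF \<rho> _ average_intertwines[OF r r U]] by auto
  have "mtrace ?T = (\<Sum>g\<in>carrier G. mtrace (\<rho> g * U * \<rho> (inv g)))"
    using U rep_carrier[OF r] by (intro mtrace_msum) (auto intro!: mult_carrier_mat[where n = n])
  also have "\<dots> = (\<Sum>g\<in>carrier G. mtrace U)"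
    using U rep_carrier[OF r] rep_inv[OF r] by (intro sum.cong refl mtrace_conjugate) auto
  finally have "mtrace ?T = of_nat (card (carrier G)) * mtrace U" by simp
  hence "c * of_nat n = of_nat (card (carrier G)) * mtrace U"
    unfolding c by (simp add: mtrace_smult[of _ n] mtrace_one)
  hence "c = of_nat (card (carrier G)) * mtrace U / of_nat n" using n by (simp add: field_simps)
  thus ?thesis using c by simp
qed

lemma mtrace_average_mult:
  assumes \<rho>: "representation G n \<rho>" and \<sigma>: "representation G m \<sigma>"
    and U: "U \<in> carrier_mat m n" and Y: "Y \<in> carrier_mat n m"
  shows "(\<Sum>g\<in>carrier G. mtrace (\<sigma> g * U * \<rho> (inv g) * Y))
       = mtrace (msum m n (\<lambda>g. \<sigma> g * U * \<rho> (inv g)) (carrier G) * Y)"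
proof -
  have c: "\<sigma> g * U * \<rho> (inv g) \<in> carrier_mat m n" if "g \<in> carrier G" for g
    using that U rep_carrier[OF \<rho>] rep_carrier[OF \<sigma>]
    by (intro mult_carrier_mat[where n = n] mult_carrier_mat[where n = m]) auto
  show ?thesis using c Y
    by (subst msum_mult_right[OF Y], auto, subst mtrace_msum)
      (auto intro!: mult_carrier_mat[OF _ Y])
qed

text \<open>\<open>U\<close> and \<open>Y\<close> are arbitrary matrices because later they are
  images of elements outside the group that is summed over.\<close>

lemma sum_mtrace_conj_mult:
  assumes \<rho>: "irreducible_representation G n \<rho>" and U: "U \<in> carrier_mat n n" and Y: "Y \<in> carrier_mat n n"
  shows "(\<Sum>g\<in>carrier G. mtrace (\<rho> g * U * \<rho> (inv g) * Y))
       = of_nat (card (carrier G)) / of_nat n * mtrace U * mtrace Y"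
proof -
  have "(c \<cdot>\<^sub>m 1\<^sub>m n) * Y = c \<cdot>\<^sub>m Y" for c
    using Y mult_smult_assoc_mat[of "1\<^sub>m n" n n Y n c] by simp
  thus ?thesis using Y
    by (simp add: mtrace_average_mult[OF irr_rep[OF \<rho>] irr_rep[OF \<rho>] U Y] average_scalar[OF \<rho> U]
          mtrace_smult[of _ n])
qed

lemma sum_mtrace_conj_mult_zero:
  assumes \<rho>: "irreducible_representation G n \<rho>" and \<sigma>: "irreducible_representation G m \<sigma>"
    and U: "U \<in> carrier_mat m n" and Y: "Y \<in> carrier_mat n m"
    and ne: "afforded_character G n \<rho> \<noteq> afforded_character G m \<sigma>"
  shows "(\<Sum>g\<in>carrier G. mtrace (\<sigma> g * U * \<rho> (inv g) * Y)) = 0"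
  using Y by (simp add: mtrace_average_mult[OF irr_rep[OF \<rho>] irr_rep[OF \<sigma>] U Y]
      average_zero[OF \<rho> \<sigma> U ne] mtrace_zero)

end

text \<open>For elementary matrices, P E_ij Q E_ji has trace P_ii Q_jj. A product of two traces thus
  becomes a sum of single traces of the shape that averaging can evaluate.\<close>

lemma mtrace_mult_unit:
  fixes P :: "'a :: comm_ring_1 mat"
  assumes P: "P \<in> carrier_mat m m" and Q: "Q \<in> carrier_mat n n"
  shows "mtrace P * mtrace Q = (\<Sum>i<m. \<Sum>j<n.
    mtrace (P * mat m n (\<lambda>p. if p = (i, j) then 1 else 0) * Q * mat n m (\<lambda>p. if p = (j, i) then 1 else 0)))"
proof -
  have "mtrace (P * mat m n (\<lambda>p. if p = (i, j) then 1 else 0) * Q * mat n m (\<lambda>p. if p = (j, i) then 1 else 0))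
      = P $$ (i, i) * Q $$ (j, j)" (is "mtrace (P * ?E * Q * ?F) = _") if ij: "i < m" "j < n" for i j
  proof -
    have E: "?E \<in> carrier_mat m n" "?F \<in> carrier_mat n m" by auto
    have PE: "(P * ?E) $$ (a, b) = (if b = j then P $$ (a, i) else 0)" if "a < m" "b < n" for a b
      using that ij by (subst index_mult_mat_sum[OF P E(1)]) (auto simp: if_distrib sum.delta cong: if_cong)
    have QF: "(Q * ?F) $$ (a, b) = (if b = i then Q $$ (a, j) else 0)" if "a < n" "b < m" for a b
      using that ij by (subst index_mult_mat_sum[OF Q E(2)]) (auto simp: if_distrib sum.delta cong: if_cong)
    have PEc: "P * ?E \<in> carrier_mat m n" and QFc: "Q * ?F \<in> carrier_mat n m"
      by (rule mult_carrier_mat[OF P E(1)], rule mult_carrier_mat[OF Q E(2)])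
    have "P * ?E * Q * ?F = P * ?E * (Q * ?F)"
      by (rule assoc_mult_mat[OF PEc Q E(2)])
    moreover have "dim_row (P * ?E * (Q * ?F)) = m" using P by simp
    ultimately have "mtrace (P * ?E * Q * ?F) = (\<Sum>a<m. (P * ?E * (Q * ?F)) $$ (a, a))"
      by (simp only: mtrace_def)
    also have "\<dots> = (\<Sum>a<m. \<Sum>b<n. (P * ?E) $$ (a, b) * (Q * ?F) $$ (b, a))"
      using PEc QFc by (intro sum.cong refl index_mult_mat_sum) auto
    also have "\<dots> = (\<Sum>a<m. \<Sum>b<n. (if b = j then P $$ (a, i) else 0) * (if a = i then Q $$ (b, j) else 0))"
      by (intro sum.cong refl) (simp only: PE QF lessThan_iff)
    also have "\<dots> = (\<Sum>a<m. \<Sum>b<n. if b = j then (if a = i then P $$ (a, i) * Q $$ (j, j) else 0) else 0)"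
      by (intro sum.cong refl) auto
    also have "\<dots> = (\<Sum>a<m. if a = i then P $$ (a, i) * Q $$ (j, j) else 0)"
      using ij by (simp add: sum.delta)
    also have "\<dots> = P $$ (i, i) * Q $$ (j, j)" using ij by (simp add: sum.delta)
    finally show ?thesis .
  qed
  hence "(\<Sum>i<m. \<Sum>j<n. mtrace (P * mat m n (\<lambda>p. if p = (i, j) then 1 else 0) * Q
            * mat n m (\<lambda>p. if p = (j, i) then 1 else 0)))
      = (\<Sum>i<m. \<Sum>j<n. P $$ (i, i) * Q $$ (j, j))"
    by (intro sum.cong refl) simp
  also have "\<dots> = mtrace P * mtrace Q" using P Q by (simp add: mtrace_def sum_product)
  finally show ?thesis by simp
qed

context fin_group
begin

lemma sum_mtrace_mult_expand:
  assumes \<rho>: "representation G n \<rho>" and \<sigma>: "representation G m \<sigma>"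
    and A: "A \<in> carrier_mat m m" and B: "B \<in> carrier_mat n n"
  shows "(\<Sum>g\<in>carrier G. mtrace (\<sigma> g * A) * mtrace (\<rho> (inv g) * B))
    = (\<Sum>i<m. \<Sum>j<n. \<Sum>g\<in>carrier G. mtrace (\<sigma> g * (A * mat m n (\<lambda>p. if p = (i, j) then 1 else 0))
         * \<rho> (inv g) * (B * mat n m (\<lambda>p. if p = (j, i) then 1 else 0))))"
proof -
  have *: "\<sigma> g * A * E * (\<rho> (inv g) * B) * F = \<sigma> g * (A * E) * \<rho> (inv g) * (B * F)"
    if g: "g \<in> carrier G" and E: "E \<in> carrier_mat m n" and F: "F \<in> carrier_mat n m" for g E F
  proof -
    note R = rep_carrier[OF \<sigma> g] rep_carrier[OF \<rho> inv_closed[OF g]]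
    have "\<sigma> g * A * E = \<sigma> g * (A * E)" by (rule assoc_mult_mat[OF R(1) A E])
    moreover have c: "\<sigma> g * (A * E) \<in> carrier_mat m n" "\<sigma> g * (A * E) * \<rho> (inv g) \<in> carrier_mat m n"
      using mult_carrier_mat[OF R(1) mult_carrier_mat[OF A E]] mult_carrier_mat[OF mult_carrier_mat[OF R(1) mult_carrier_mat[OF A E]] R(2)]
      by simp_all
    hence "\<sigma> g * (A * E) * (\<rho> (inv g) * B) = \<sigma> g * (A * E) * \<rho> (inv g) * B"
      by (intro assoc_mult_mat[symmetric, OF _ R(2) B])
    moreover have "\<sigma> g * (A * E) * \<rho> (inv g) * B * F = \<sigma> g * (A * E) * \<rho> (inv g) * (B * F)"
      using c by (intro assoc_mult_mat[OF _ B F])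
    ultimately show ?thesis by simp
  qed
  have "(\<Sum>g\<in>carrier G. mtrace (\<sigma> g * A) * mtrace (\<rho> (inv g) * B))
    = (\<Sum>g\<in>carrier G. \<Sum>i<m. \<Sum>j<n. mtrace (\<sigma> g * A * mat m n (\<lambda>p. if p = (i, j) then 1 else 0)
         * (\<rho> (inv g) * B) * mat n m (\<lambda>p. if p = (j, i) then 1 else 0)))"
    by (intro sum.cong refl mtrace_mult_unit mult_carrier_mat[OF _ A] mult_carrier_mat[OF _ B]
        rep_carrier[OF \<rho>] rep_carrier[OF \<sigma>] inv_closed)
  also have "\<dots> = (\<Sum>g\<in>carrier G. \<Sum>i<m. \<Sum>j<n. mtrace (\<sigma> g * (A * mat m n (\<lambda>p. if p = (i, j) then 1 else 0))
         * \<rho> (inv g) * (B * mat n m (\<lambda>p. if p = (j, i) then 1 else 0))))"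
    by (intro sum.cong refl arg_cong[where f = mtrace] *) auto
  also have "\<dots> = (\<Sum>i<m. \<Sum>g\<in>carrier G. \<Sum>j<n. mtrace (\<sigma> g * (A * mat m n (\<lambda>p. if p = (i, j) then 1 else 0))
         * \<rho> (inv g) * (B * mat n m (\<lambda>p. if p = (j, i) then 1 else 0))))"
    by (rule sum.swap)
  also have "\<dots> = (\<Sum>i<m. \<Sum>j<n. \<Sum>g\<in>carrier G. mtrace (\<sigma> g * (A * mat m n (\<lambda>p. if p = (i, j) then 1 else 0))
         * \<rho> (inv g) * (B * mat n m (\<lambda>p. if p = (j, i) then 1 else 0))))"
    by (intro sum.cong refl sum.swap)
  finally show ?thesis .
qed

text \<open>The free factors \<open>A\<close> and \<open>B\<close> serve several relations at once:
  identity matrices give orthogonality of characters, an image of a group element in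
  \<open>B\<close> gives convolutions, and images of u and of its inverse give orthogonality on a
  coset N u.\<close>

lemma sum_mtrace_mult_zero:
  assumes \<rho>: "irreducible_representation G n \<rho>" and \<sigma>: "irreducible_representation G m \<sigma>"
    and A: "A \<in> carrier_mat m m" and B: "B \<in> carrier_mat n n"
    and ne: "afforded_character G n \<rho> \<noteq> afforded_character G m \<sigma>"
  shows "(\<Sum>g\<in>carrier G. mtrace (\<sigma> g * A) * mtrace (\<rho> (inv g) * B)) = 0"
proof -
  have "(\<Sum>g\<in>carrier G. mtrace (\<sigma> g * (A * mat m n (\<lambda>p. if p = (i, j) then 1 else 0))
         * \<rho> (inv g) * (B * mat n m (\<lambda>p. if p = (j, i) then 1 else 0)))) = 0" for i j
    by (rule sum_mtrace_conj_mult_zero[OF \<rho> \<sigma> _ _ ne])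
      (auto intro!: mult_carrier_mat[OF A] mult_carrier_mat[OF B])
  thus ?thesis by (simp add: sum_mtrace_mult_expand[OF irr_rep[OF \<rho>] irr_rep[OF \<sigma>] A B])
qed

lemma sum_mtrace_mult:
  assumes \<rho>: "irreducible_representation G n \<rho>"
    and A: "A \<in> carrier_mat n n" and B: "B \<in> carrier_mat n n"
  shows "(\<Sum>g\<in>carrier G. mtrace (\<rho> g * A) * mtrace (\<rho> (inv g) * B))
       = of_nat (card (carrier G)) / of_nat n * mtrace (A * B)"
proof -
  let ?E = "\<lambda>i j. mat n n (\<lambda>p. if p = (i, j) then 1 else 0) :: complex mat"
  have tr: "mtrace (M * ?E i j) = M $$ (j, i)" if M: "M \<in> carrier_mat n n" and ij: "i < n" "j < n" for M i j
  proof -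
    have "mtrace (M * ?E i j) = (\<Sum>a<n. \<Sum>b<n. M $$ (a, b) * ?E i j $$ (b, a))"
      using M unfolding mtrace_def
      by (intro sum.cong index_mult_mat_sum) (auto simp del: index_mult_mat(1))
    also have "\<dots> = (\<Sum>a<n. \<Sum>b<n. if b = i then (if a = j then M $$ (a, b) else 0) else 0)"
      by (intro sum.cong refl) auto
    also have "\<dots> = M $$ (j, i)" using ij by (simp add: sum.delta)
    finally show ?thesis .
  qed
  have "(\<Sum>g\<in>carrier G. mtrace (\<rho> g * (A * ?E i j) * \<rho> (inv g) * (B * ?E j i)))
      = of_nat (card (carrier G)) / of_nat n * (A $$ (j, i) * B $$ (i, j))" if "i < n" "j < n" for i j
    using that by (subst sum_mtrace_conj_mult[OF \<rho>])
      (auto intro!: mult_carrier_mat[OF A] mult_carrier_mat[OF B] simp: tr[OF A] tr[OF B])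
  hence "(\<Sum>g\<in>carrier G. mtrace (\<rho> g * A) * mtrace (\<rho> (inv g) * B))
      = (\<Sum>i<n. \<Sum>j<n. of_nat (card (carrier G)) / of_nat n * (A $$ (j, i) * B $$ (i, j)))"
    by (simp add: sum_mtrace_mult_expand[OF irr_rep[OF \<rho>] irr_rep[OF \<rho>] A B])
  also have "\<dots> = of_nat (card (carrier G)) / of_nat n * (\<Sum>j<n. \<Sum>i<n. A $$ (j, i) * B $$ (i, j))"
    by (subst sum.swap) (simp add: sum_distrib_left)
  also have "(\<Sum>j<n. \<Sum>i<n. A $$ (j, i) * B $$ (i, j)) = mtrace (A * B)"
    using A B unfolding mtrace_def
    by (intro sum.cong index_mult_mat_sum[symmetric]) (auto simp del: index_mult_mat(1))
  finally show ?thesis .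
qed

end

section \<open>Hermitian forms and character values at inverses\<close>

definition ctranspose :: "complex mat \<Rightarrow> complex mat" where
  "ctranspose A = map_mat cnj (transpose_mat A)"

lemma ctranspose_carrier [simp]: "A \<in> carrier_mat m n \<Longrightarrow> ctranspose A \<in> carrier_mat n m"
  by (simp add: ctranspose_def)

lemma ctranspose_mult:
  assumes A: "A \<in> carrier_mat m n" and B: "B \<in> carrier_mat n k"
  shows "ctranspose (A * B) = ctranspose B * ctranspose A"
proof (rule eq_matI)
  fix i j assume "i < dim_row (ctranspose B * ctranspose A)" "j < dim_col (ctranspose B * ctranspose A)"
  hence ij: "i < k" "j < m" using A B by (auto simp: ctranspose_def)
  have "(ctranspose B * ctranspose A) $$ (i, j) = (\<Sum>l<n. cnj (B $$ (l, i)) * cnj (A $$ (j, l)))"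
    using ij A B by (subst index_mult_mat_sum[of _ k n _ m]) (auto simp: ctranspose_def)
  also have "\<dots> = cnj ((A * B) $$ (j, i))"
    using ij by (subst index_mult_mat_sum[OF A B]) (auto simp: mult.commute)
  finally show "ctranspose (A * B) $$ (i, j) = (ctranspose B * ctranspose A) $$ (i, j)"
    using ij A B by (simp add: ctranspose_def)
qed (use A B in \<open>auto simp: ctranspose_def\<close>)

lemma mtrace_ctranspose: "A \<in> carrier_mat n n \<Longrightarrow> mtrace (ctranspose A) = cnj (mtrace A)"
  by (auto simp: mtrace_def ctranspose_def)

lemma mtrace_ctranspose_mult:
  assumes A: "A \<in> carrier_mat m n"
  shows "mtrace (ctranspose A * A) = of_real (\<Sum>j<n. \<Sum>i<m. (cmod (A $$ (i, j)))\<^sup>2)"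
proof -
  have "mtrace (ctranspose A * A) = (\<Sum>j<n. (ctranspose A * A) $$ (j, j))"
    using A by (simp add: mtrace_def ctranspose_def del: index_mult_mat(1))
  also have "\<dots> = (\<Sum>j<n. \<Sum>i<m. of_real ((cmod (A $$ (i, j)))\<^sup>2))"
  proof (intro sum.cong refl)
    fix j assume "j \<in> {..<n}"
    hence j: "j < n" by simp
    have "(ctranspose A * A) $$ (j, j) = (\<Sum>i<m. ctranspose A $$ (j, i) * A $$ (i, j))"
      by (rule index_mult_mat_sum[OF ctranspose_carrier[OF A] A j j])
    also have "\<dots> = (\<Sum>i<m. of_real ((cmod (A $$ (i, j)))\<^sup>2))"
      using A j by (intro sum.cong refl)
        (auto simp: ctranspose_def complex_norm_square mult.commute simp del: of_real_power)
    finally show "(ctranspose A * A) $$ (j, j) = (\<Sum>i<m. of_real ((cmod (A $$ (i, j)))\<^sup>2))" .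
  qed
  finally show ?thesis by simp
qed

context fin_group
begin

text \<open>Averaging the standard Hermitian form gives an isomorphism between \<open>\<rho>\<close> and its conjugate dual.\<close>

lemma afforded_inv:
  assumes \<rho>: "representation G n \<rho>" and h: "h \<in> carrier G"
  shows "afforded_character G n \<rho> (inv h) = cnj (afforded_character G n \<rho> h)"
proof -
  note [simp] = rep_carrier[OF \<rho>]
  define H where "H = msum n n (\<lambda>g. ctranspose (\<rho> g) * \<rho> g) (carrier G)"
  have H: "H \<in> carrier_mat n n" by (simp add: H_def)
  have c: "ctranspose (\<rho> g) * \<rho> g \<in> carrier_mat n n" if "g \<in> carrier G" for g
    using that by (intro mult_carrier_mat[where n = n]) auto
  \<comment> \<open>The summand for g becomes the one for g h, so \<open>H\<close> is an invariant
    Hermitian form.\<close>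
  have "ctranspose (\<rho> h) * H * \<rho> h = H"
  proof -
    have "ctranspose (\<rho> h) * H = msum n n (\<lambda>g. ctranspose (\<rho> h) * (ctranspose (\<rho> g) * \<rho> g)) (carrier G)"
      unfolding H_def by (rule msum_mult_left) (use h c in auto)
    hence "ctranspose (\<rho> h) * H * \<rho> h =
        msum n n (\<lambda>g. ctranspose (\<rho> h) * (ctranspose (\<rho> g) * \<rho> g)) (carrier G) * \<rho> h" by simp
    also have "\<dots> = msum n n (\<lambda>g. ctranspose (\<rho> h) * (ctranspose (\<rho> g) * \<rho> g) * \<rho> h) (carrier G)"
      by (rule msum_mult_right) (use h c in \<open>auto intro!: mult_carrier_mat[where n = n]\<close>)
    also have "\<dots> = msum n n (\<lambda>g. ctranspose (\<rho> (g \<otimes> h)) * \<rho> (g \<otimes> h)) (carrier G)"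
    proof (rule msum_cong)
      fix g assume g: "g \<in> carrier G"
      have "ctranspose (\<rho> h) * (ctranspose (\<rho> g) * \<rho> g) = ctranspose (\<rho> h) * ctranspose (\<rho> g) * \<rho> g"
        using g h by (intro assoc_mult_mat[symmetric, of _ n n _ n _ n]) auto
      also have "ctranspose (\<rho> h) * ctranspose (\<rho> g) = ctranspose (\<rho> (g \<otimes> h))"
        using g h by (simp add: rep_mult[OF \<rho>] ctranspose_mult[of _ n n _ n])
      also have "ctranspose (\<rho> (g \<otimes> h)) * \<rho> g * \<rho> h = ctranspose (\<rho> (g \<otimes> h)) * (\<rho> g * \<rho> h)"
        using g h by (intro assoc_mult_mat[of _ n n _ n _ n]) auto
      finally show "ctranspose (\<rho> h) * (ctranspose (\<rho> g) * \<rho> g) * \<rho> h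
          = ctranspose (\<rho> (g \<otimes> h)) * \<rho> (g \<otimes> h)" using g h by (simp add: rep_mult[OF \<rho>])
    qed
    also have "\<dots> = H" unfolding H_def by (rule msum_reindex[OF bij_right_mult[OF h], symmetric])
    finally show ?thesis .
  qed
  hence "ctranspose (\<rho> h) * H * \<rho> h * \<rho> (inv h) = H * \<rho> (inv h)" by simp
  moreover have "ctranspose (\<rho> h) * H * \<rho> h * \<rho> (inv h) = ctranspose (\<rho> h) * H * (\<rho> h * \<rho> (inv h))"
    using h H by (intro assoc_mult_mat[of _ n n _ n _ n]) (auto intro!: mult_carrier_mat[where n = n])
  moreover have "ctranspose (\<rho> h) * H \<in> carrier_mat n n"
    using h H by (intro mult_carrier_mat[where n = n]) auto
  ultimately have HI: "H * \<rho> (inv h) = ctranspose (\<rho> h) * H"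
    using h by (metis rep_inv(1)[OF \<rho>] right_mult_one_mat)
  have "det H \<noteq> 0"
  proof
    assume "det H = 0"
    then obtain v where v: "v \<in> carrier_vec n" "v \<noteq> 0\<^sub>v n" "H *\<^sub>v v = 0\<^sub>v n"
      using det_0_iff_vec_prod_zero[OF H] by auto
    \<comment> \<open>As a one-column matrix, \<open>v\<close> has its form value equal to the trace
      of a 1 by 1 matrix, so the trace lemmas express it as a sum of squared norms.\<close>
    define V where "V = mat_of_cols n [v]"
    have V: "V \<in> carrier_mat n 1" using mat_of_cols_carrier(1)[of n "[v]"] by (simp add: V_def)
    have colV: "col V 0 = v" using v by (simp add: V_def)
    have HV: "H * V = 0\<^sub>m n 1"
    proof (rule mat_col_eqI)
      fix j assume "j < dim_col (0\<^sub>m n 1 :: complex mat)"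
      thus "col (H * V) j = col (0\<^sub>m n 1) j" using V v by (subst col_mult2[OF H V]) (auto simp: colV)
    qed (use H V in auto)
    have "ctranspose V * (H * V) = msum 1 1 (\<lambda>g. ctranspose V * (ctranspose (\<rho> g) * \<rho> g * V)) (carrier G)"
      unfolding H_def using c V
      by (subst msum_mult_right, auto, subst msum_mult_left, auto intro!: mult_carrier_mat[where n = n])
    also have "\<dots> = msum 1 1 (\<lambda>g. ctranspose (\<rho> g * V) * (\<rho> g * V)) (carrier G)"
    proof (rule msum_cong)
      fix g assume g: "g \<in> carrier G"
      have "ctranspose (\<rho> g) * \<rho> g * V = ctranspose (\<rho> g) * (\<rho> g * V)"
        using g V by (intro assoc_mult_mat[of _ n n _ n _ 1]) auto
      moreover have "ctranspose V * (ctranspose (\<rho> g) * (\<rho> g * V)) = ctranspose V * ctranspose (\<rho> g) * (\<rho> g * V)"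
        using g V by (intro assoc_mult_mat[symmetric, of _ 1 n _ n _ 1]) (auto intro!: mult_carrier_mat[where n = n])
      ultimately show "ctranspose V * (ctranspose (\<rho> g) * \<rho> g * V) = ctranspose (\<rho> g * V) * (\<rho> g * V)"
        using g V by (simp add: ctranspose_mult[of _ n n _ 1])
    qed
    finally have "mtrace (ctranspose V * (H * V)) = (\<Sum>g\<in>carrier G. mtrace (ctranspose (\<rho> g * V) * (\<rho> g * V)))"
      using V by (subst mtrace_msum[symmetric])
        (auto intro!: mult_carrier_mat[where n = n] ctranspose_carrier)
    also have "\<dots> = of_real (\<Sum>g\<in>carrier G. \<Sum>j<1. \<Sum>i<n. (cmod ((\<rho> g * V) $$ (i, j)))\<^sup>2)"
      using V unfolding of_real_sum[of _ "carrier G"]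
      by (intro sum.cong refl mtrace_ctranspose_mult) (auto intro!: mult_carrier_mat[where n = n])
    finally have "complex_of_real (\<Sum>g\<in>carrier G. \<Sum>j<(1::nat). \<Sum>i<n. (cmod ((\<rho> g * V) $$ (i, j)))\<^sup>2)
        = mtrace (ctranspose V * 0\<^sub>m n 1)"
      by (simp only: HV)
    also have "\<dots> = 0" using V by (simp add: right_mult_zero_mat[OF ctranspose_carrier[OF V]] mtrace_zero)
    finally have "(\<Sum>g\<in>carrier G. \<Sum>j<(1::nat). \<Sum>i<n. (cmod ((\<rho> g * V) $$ (i, j)))\<^sup>2) = 0"
      by (simp only: of_real_eq_0_iff)
    \<comment> \<open>All summands are nonnegative, and the one at the identity is the squared norm
      of \<open>v\<close> itself.\<close>
    hence "(\<Sum>j<(1::nat). \<Sum>i<n. (cmod ((\<rho> \<one> * V) $$ (i, j)))\<^sup>2) = 0"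
      using finite_carrier by (subst (asm) sum_nonneg_eq_0_iff) (auto intro!: sum_nonneg)
    hence "(\<Sum>i<n. (cmod (V $$ (i, 0)))\<^sup>2) = 0"
      using V by (simp add: rep_one[OF \<rho>])
    hence "\<forall>i<n. V $$ (i, 0) = 0" by (subst (asm) sum_nonneg_eq_0_iff) auto
    hence "v = 0\<^sub>v n" using V v colV by (intro eq_vecI) (auto simp: col_def)
    thus False using v by simp
  qed
  from det_non_zero_imp_unit[OF H this] obtain P where P: "P \<in> carrier_mat n n" "P * H = 1\<^sub>m n" "H * P = 1\<^sub>m n"
    by (auto simp: Units_def ring_mat_def)
  have "ctranspose (\<rho> h) * H * P = ctranspose (\<rho> h) * (H * P)"
    using h H P by (intro assoc_mult_mat[of _ n n _ n _ n]) auto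
  hence "H * \<rho> (inv h) * P = ctranspose (\<rho> h)"
    using h P(3) right_mult_one_mat[OF ctranspose_carrier[OF rep_carrier[OF \<rho> h]]] by (metis HI)
  moreover have "mtrace (H * \<rho> (inv h) * P) = mtrace (\<rho> (inv h))"
    using h P H by (intro mtrace_conjugate[of _ n]) auto
  ultimately show ?thesis using h
    by (simp add: afforded_eq_mtrace[OF \<rho>] mtrace_ctranspose[of _ n])
qed

end

section \<open>Inner products and products of characters\<close>

definition char_inner :: "('a, 'b) monoid_scheme \<Rightarrow> ('a \<Rightarrow> complex) \<Rightarrow> ('a \<Rightarrow> complex) \<Rightarrow> complex" where
  "char_inner G \<phi> \<psi> = (\<Sum>g\<in>carrier G. \<phi> g * cnj (\<psi> g)) / of_nat (card (carrier G))"

text \<open>Characters of arbitrary representations; degree zero, and with it the zero function, is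
  included.\<close>

definition rep_char :: "('a, 'b) monoid_scheme \<Rightarrow> ('a \<Rightarrow> complex) \<Rightarrow> bool" where
  "rep_char G \<chi> \<longleftrightarrow> (\<exists>n \<rho>. representation G n \<rho> \<and> \<chi> = afforded_character G n \<rho>)"

context fin_group
begin

lemma IrrE:
  assumes "\<chi> \<in> Irr G"
  obtains n \<rho> where "irreducible_representation G n \<rho>" "\<chi> = afforded_character G n \<rho>" "n > 0"
  using assms by (auto simp: Irr_def irreducible_representation_def)

lemma Irr_rep_char: "\<chi> \<in> Irr G \<Longrightarrow> rep_char G \<chi>"
  by (auto simp: Irr_def rep_char_def irreducible_representation_def)

lemma rep_char_inv: "rep_char G \<chi> \<Longrightarrow> g \<in> carrier G \<Longrightarrow> \<chi> (inv g) = cnj (\<chi> g)"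
  by (auto simp: rep_char_def afforded_inv)

lemma afforded_one: "representation G n \<rho> \<Longrightarrow> afforded_character G n \<rho> \<one> = of_nat n"
  by (simp add: afforded_eq_mtrace rep_one mtrace_one)

lemma rep_char_outside: "rep_char G \<chi> \<Longrightarrow> g \<notin> carrier G \<Longrightarrow> \<chi> g = 0"
  by (auto simp: rep_char_def afforded_character_def)

lemma char_inner_Irr:
  assumes "\<chi> \<in> Irr G" "\<psi> \<in> Irr G"
  shows "char_inner G \<chi> \<psi> = (if \<chi> = \<psi> then 1 else 0)"
proof -
  from assms obtain n \<rho> m \<sigma> where \<rho>: "irreducible_representation G n \<rho>" "\<chi> = afforded_character G n \<rho>" "n > 0"
    and \<sigma>: "irreducible_representation G m \<sigma>" "\<psi> = afforded_character G m \<sigma>" "m > 0"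
    by (auto elim!: IrrE)
  have tr: "(\<Sum>g\<in>carrier G. \<chi> g * cnj (\<tau> g)) = (\<Sum>g\<in>carrier G. mtrace (\<rho> g * 1\<^sub>m n) * mtrace (\<sigma>' (inv g) * 1\<^sub>m k))"
    if \<sigma>': "irreducible_representation G k \<sigma>'" "\<tau> = afforded_character G k \<sigma>'" for \<tau> \<sigma>' k
  proof (intro sum.cong refl)
    fix g assume g: "g \<in> carrier G"
    have "cnj (\<tau> g) = mtrace (\<sigma>' (inv g))"
      using g afforded_eq_mtrace[OF irr_rep[OF \<sigma>'(1)], of "inv g"]
      by (simp add: \<sigma>'(2) afforded_inv[OF irr_rep[OF \<sigma>'(1)]])
    thus "\<chi> g * cnj (\<tau> g) = mtrace (\<rho> g * 1\<^sub>m n) * mtrace (\<sigma>' (inv g) * 1\<^sub>m k)"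
      using g rep_carrier[OF irr_rep[OF \<rho>(1)], of g] rep_carrier[OF irr_rep[OF \<sigma>'(1)], of "inv g"]
      by (simp add: \<rho>(2) afforded_eq_mtrace[OF irr_rep[OF \<rho>(1)]])
  qed
  show ?thesis
  proof (cases "\<chi> = \<psi>")
    case True
    have "(\<Sum>g\<in>carrier G. \<chi> g * cnj (\<chi> g)) = of_nat (card (carrier G))"
      using \<rho>(3) by (simp add: tr[OF \<rho>(1,2)] sum_mtrace_mult[OF \<rho>(1)] mtrace_one del: right_mult_one_mat')
    thus ?thesis using True card_carrier_pos by (simp add: char_inner_def)
  next
    case False
    hence "(\<Sum>g\<in>carrier G. \<chi> g * cnj (\<psi> g)) = 0"
      unfolding tr[OF \<sigma>(1,2)] using \<rho>(2) \<sigma>(2)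
      by (intro sum_mtrace_mult_zero[OF \<sigma>(1) \<rho>(1)]) auto
    thus ?thesis using False by (simp add: char_inner_def)
  qed
qed

text \<open>Both factors are class functions, so Schur's lemma linearises their product.\<close>

lemma Irr_mult:
  assumes "\<chi> \<in> Irr G" and g: "g \<in> carrier G" and h: "h \<in> carrier G"
  shows "(\<Sum>c\<in>carrier G. \<chi> (c \<otimes> g \<otimes> inv c \<otimes> h)) = of_nat (card (carrier G)) / \<chi> \<one> * \<chi> g * \<chi> h"
proof -
  from assms obtain n \<rho> where \<rho>: "irreducible_representation G n \<rho>" "\<chi> = afforded_character G n \<rho>" "n > 0"
    by (auto elim!: IrrE)
  note r = irr_rep[OF \<rho>(1)]
  have "(\<Sum>c\<in>carrier G. \<chi> (c \<otimes> g \<otimes> inv c \<otimes> h)) = (\<Sum>c\<in>carrier G. mtrace (\<rho> c * \<rho> g * \<rho> (inv c) * \<rho> h))"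
    using g h by (intro sum.cong refl) (simp add: \<rho>(2) afforded_eq_mtrace[OF r] rep_mult[OF r])
  thus ?thesis using g h
    by (simp add: sum_mtrace_conj_mult[OF \<rho>(1)] rep_carrier[OF r] \<rho>(2) afforded_eq_mtrace[OF r] rep_one[OF r] mtrace_one)
qed

lemma rep_char_conj:
  assumes "rep_char G \<chi>" and g: "g \<in> carrier G" and x: "x \<in> carrier G"
  shows "\<chi> (x \<otimes> g \<otimes> inv x) = \<chi> g"
proof -
  from assms(1) obtain n \<rho> where \<rho>: "representation G n \<rho>" "\<chi> = afforded_character G n \<rho>"
    by (auto simp: rep_char_def)
  show ?thesis using g x rep_carrier[OF \<rho>(1)] rep_inv[OF \<rho>(1)]
    by (simp add: \<rho>(2) afforded_eq_mtrace[OF \<rho>(1)] rep_mult[OF \<rho>(1)] mtrace_conjugate[of _ n])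
qed

lemma rep_char_commute:
  assumes "rep_char G \<chi>" and g: "g \<in> carrier G" and x: "x \<in> carrier G"
  shows "\<chi> (g \<otimes> x) = \<chi> (x \<otimes> g)"
  using rep_char_conj[OF assms(1), of "g \<otimes> x" x] g x by (simp add: m_assoc)

end

section \<open>Decomposition into irreducible characters\<close>

lemma subspace_linear_combination:
  fixes W :: "complex vec set"
  assumes W: "subspace class_ring W (module_vec TYPE(complex) n)"
    and P: "P \<in> carrier_mat n n" and cols: "\<And>j. j < m \<Longrightarrow> col P j \<in> W" and m: "m \<le> n"
  shows "vec n (\<lambda>i. \<Sum>j<m. P $$ (i, j) * u j) \<in> W"
  using cols m
proof (induction m)
  case 0
  have "vec n (\<lambda>i. \<Sum>j<(0::nat). P $$ (i, j) * u j) = 0\<^sub>v n" by auto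
  thus ?case using W by (auto simp: subspace_iff)
next
  case (Suc m)
  have "vec n (\<lambda>i. \<Sum>j<Suc m. P $$ (i, j) * u j) = vec n (\<lambda>i. \<Sum>j<m. P $$ (i, j) * u j) + u m \<cdot>\<^sub>v col P m"
    using P Suc.prems by (auto intro!: eq_vecI simp: mult.commute)
  moreover have "vec n (\<lambda>i. \<Sum>j<m. P $$ (i, j) * u j) \<in> W" using Suc by auto
  moreover have "u m \<cdot>\<^sub>v col P m \<in> W" using Suc.prems W by (auto simp: subspace_iff)
  ultimately show ?case using W by (auto simp: subspace_iff)
qed

lemma mult_mat_vec_sum:
  assumes "P \<in> carrier_mat m n" "u \<in> carrier_vec n"
  shows "P *\<^sub>v u = vec m (\<lambda>i. \<Sum>j<n. P $$ (i, j) * u $ j)"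
  using assms by (auto intro!: eq_vecI simp: scalar_prod_def atLeast0LessThan)

text \<open>An invertible matrix with the largest possible number of leading columns in \<open>W\<close>
  has a basis of \<open>W\<close> in these columns: otherwise one more vector could be exchanged in.\<close>

lemma adapted_basis:
  fixes W :: "complex vec set"
  assumes W: "subspace class_ring W (module_vec TYPE(complex) n)"
    and W0: "W \<noteq> {0\<^sub>v n}" and W1: "W \<noteq> carrier_vec n"
  obtains k P Q where "0 < k" "k < n" "P \<in> carrier_mat n n" "Q \<in> carrier_mat n n"
    "P * Q = 1\<^sub>m n" "Q * P = 1\<^sub>m n" "\<And>j. j < k \<Longrightarrow> col P j \<in> W"
    "\<And>w i. w \<in> W \<Longrightarrow> k \<le> i \<Longrightarrow> i < n \<Longrightarrow> (Q *\<^sub>v w) $ i = 0"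
proof -
  have Wc: "w \<in> carrier_vec n" if "w \<in> W" for w using W that by (auto simp: subspace_iff)
  define ok where "ok k \<longleftrightarrow> k \<le> n \<and> (\<exists>P\<in>carrier_mat n n. det P \<noteq> 0 \<and> (\<forall>j<k. col P j \<in> W))" for k
  have "ok 0" by (auto simp: ok_def intro!: bexI[of _ "1\<^sub>m n"])
  moreover have "\<forall>k. ok k \<longrightarrow> k \<le> n" by (simp add: ok_def)
  ultimately have "\<exists>k. ok k \<and> (\<forall>l. ok l \<longrightarrow> l \<le> k)"
    using Greatest_le_nat[of ok _ n] GreatestI_nat[of ok 0 n] by blast
  then obtain k where k: "ok k" and kmax: "\<And>l. ok l \<Longrightarrow> l \<le> k" by blast
  from k obtain P where P: "P \<in> carrier_mat n n" "det P \<noteq> 0" "\<And>j. j < k \<Longrightarrow> col P j \<in> W" and kn: "k \<le> n"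
    by (auto simp: ok_def)
  from det_non_zero_imp_unit[OF P(1,2)] obtain Q where Q: "Q \<in> carrier_mat n n" "P * Q = 1\<^sub>m n" "Q * P = 1\<^sub>m n"
    by (auto simp: Units_def ring_mat_def)
  have PQ: "P *\<^sub>v (Q *\<^sub>v w) = w" if "w \<in> carrier_vec n" for w
    using that assoc_mult_mat_vec[OF P(1) Q(1) that] Q by simp
  have zero: "(Q *\<^sub>v w) $ i = 0" if w: "w \<in> W" and i: "k \<le> i" "i < n" for w i
  proof (rule ccontr)
    assume ne: "(Q *\<^sub>v w) $ i \<noteq> 0"
    define v where "v = Q *\<^sub>v w"
    have v: "v \<in> carrier_vec n" "v $ i \<noteq> 0" "P *\<^sub>v v = w"
      using ne Q(1) PQ[OF Wc[OF w]] Wc[OF w] by (simp_all add: v_def mult_mat_vec_carrier[OF Q(1)])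
    \<comment> \<open>\<open>R\<close> below is the identity with columns \<open>k\<close> and
      \<open>i\<close> exchanged and column \<open>k\<close> then replaced by \<open>v\<close>. It
      is invertible because the \<open>i\<close>-th entry of \<open>v\<close> is nonzero.
      Multiplying \<open>P\<close> by it puts \<open>w\<close> into column \<open>k\<close> and
      leaves the earlier columns alone.\<close>
    define s where "s b = (if b = k then i else if b = i then k else b)" for b
    have ss: "s (s b) = b" "b < n \<Longrightarrow> s b < n" for b using i by (auto simp: s_def)
    define R where "R = mat n n (\<lambda>(a, b). if b = k then v $ a else if a = s b then 1 else 0)"
    have R: "R \<in> carrier_mat n n" by (simp add: R_def)
    have "det R \<noteq> 0"
    proof
      assume "det R = 0"
      then obtain u where u: "u \<in> carrier_vec n" "u \<noteq> 0\<^sub>v n" "R *\<^sub>v u = 0\<^sub>v n"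
        using det_0_iff_vec_prod_zero[OF R] by auto
      have eq: "v $ a * u $ k + (if a = i then 0 else u $ s a) = 0" if a: "a < n" for a
      proof -
        have "0 = (R *\<^sub>v u) $ a" using u a by simp
        also have "\<dots> = (\<Sum>b<n. R $$ (a, b) * u $ b)" using a by (simp only: mult_mat_vec_sum[OF R u(1)] index_vec)
        also have "\<dots> = (\<Sum>b<n. (if b = k then v $ a * u $ k else 0) + (if b = s a then (if a = i then 0 else u $ b) else 0))"
          using a by (intro sum.cong refl) (auto simp: R_def s_def split: if_splits)
        also have "\<dots> = v $ a * u $ k + (if a = i then 0 else u $ s a)"
          using a i ss(2)[OF a] by (simp add: sum.distrib sum.delta)
        finally show ?thesis by simp
      qed
      have "u $ k = 0" using eq[OF i(2)] v by simp
      moreover have "u $ b = 0" if "b < n" "b \<noteq> k" for b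
        using eq[of "s b"] that ss[of b] \<open>u $ k = 0\<close> by (auto simp: s_def split: if_splits)
      ultimately have "u $ b = 0" if "b < n" for b using that by metis
      hence "u = 0\<^sub>v n" using u by (intro eq_vecI) auto
      thus False using u by simp
    qed
    hence "det (P * R) \<noteq> 0" using P(1,2) R by (simp add: det_mult)
    moreover have "col (P * R) j \<in> W" if j: "j < Suc k" for j
    proof (cases "j = k")
      case True
      have "col R j = v" using True i v by (auto simp: R_def)
      thus ?thesis using v w True i by (subst col_mult2[OF P(1) R]) auto
    next
      case False
      have "col R j = unit_vec n j" using j False i by (auto simp: R_def s_def)
      hence "col (P * R) j = col P j"
        using j False i P(1) by (subst col_mult2[OF P(1) R]) (auto simp: mult_mat_vec_unit)
      thus ?thesis using P(3) j False by simp
    qed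
    ultimately have "ok (Suc k)" using P(1) R i unfolding ok_def
      by (intro conjI bexI[of _ "P * R"]) auto
    thus False using kmax[of "Suc k"] by simp
  qed
  have "k \<noteq> 0"
  proof
    assume "k = 0"
    have "w = 0\<^sub>v n" if w: "w \<in> W" for w
    proof -
      have *: "P *\<^sub>v 0\<^sub>v n = 0\<^sub>v n" using P(1) by (intro eq_vecI) auto
      have "Q *\<^sub>v w = 0\<^sub>v n" 
      proof (rule eq_vecI)
        fix i assume "i < dim_vec (0\<^sub>v n :: complex vec)"
        thus "(Q *\<^sub>v w) $ i = 0\<^sub>v n $ i" using zero[OF w, of i] \<open>k = 0\<close> by simp
      qed (use Q(1) in simp)
      thus ?thesis using PQ[OF Wc[OF w]] * by metis
    qed
    moreover have "0\<^sub>v n \<in> W" using W by (simp add: subspace_iff)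
    ultimately have "W = {0\<^sub>v n}" by blast
    thus False using W0 by contradiction
  qed
  moreover have "k \<noteq> n"
  proof
    assume "k = n"
    have "w \<in> W" if w: "w \<in> carrier_vec n" for w
    proof -
      have "P *\<^sub>v (Q *\<^sub>v w) = vec n (\<lambda>i. \<Sum>j<n. P $$ (i, j) * (Q *\<^sub>v w) $ j)"
        using P(1) Q(1) w by (intro mult_mat_vec_sum) auto
      thus ?thesis using subspace_linear_combination[OF W P(1), of k "\<lambda>j. (Q *\<^sub>v w) $ j"] P(3) PQ[OF w] \<open>k = n\<close>
        by simp
    qed
    thus False using W1 Wc by auto
  qed
  ultimately show thesis using that[of k P Q] P Q zero kn by auto
qed

lemma sum_lessThan_split:
  fixes f :: "nat \<Rightarrow> 'a :: comm_monoid_add"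
  assumes "k \<le> n"
  shows "(\<Sum>l<n. f l) = (\<Sum>l<k. f l) + (\<Sum>l<n - k. f (l + k))"
proof -
  have "(\<Sum>l<k + d. f l) = (\<Sum>l<k. f l) + (\<Sum>l<d. f (l + k))" for d
    by (induction d) (simp_all add: add.assoc add.commute[of k])
  from this[of "n - k"] show ?thesis using assms by simp
qed

context fin_group
begin

text \<open>In a basis adapted to an invariant subspace all matrices are block upper triangular.
  Both diagonal blocks are multiplicative and the trace sees only them, so the characters add
  whatever the upper right block is.\<close>

lemma reducible_split:
  assumes \<rho>: "representation G n \<rho>" and n: "n \<noteq> 0" and red: "\<not> irreducible_representation G n \<rho>"
  obtains k \<sigma> \<tau> where "0 < k" "k < n" "representation G k \<sigma>" "representation G (n - k) \<tau>"
    "\<And>g. afforded_character G n \<rho> g = afforded_character G k \<sigma> g + afforded_character G (n - k) \<tau> g"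
proof -
  from red \<rho> n obtain W where inv: "invariant_subspace G n \<rho> W" and W: "W \<noteq> {0\<^sub>v n}" "W \<noteq> carrier_vec n"
    by (auto simp: irreducible_representation_def)
  have sub: "subspace class_ring W (module_vec TYPE(complex) n)"
    and act: "\<And>g w. g \<in> carrier G \<Longrightarrow> w \<in> W \<Longrightarrow> \<rho> g *\<^sub>v w \<in> W"
    using inv by (auto simp: invariant_subspace_def)
  from adapted_basis[OF sub W] obtain k P Q where k: "0 < k" "k < n"
    and P: "P \<in> carrier_mat n n" and Q: "Q \<in> carrier_mat n n" and PQ: "P * Q = 1\<^sub>m n" "Q * P = 1\<^sub>m n"
    and cols: "\<And>j. j < k \<Longrightarrow> col P j \<in> W"
    and zero: "\<And>w i. w \<in> W \<Longrightarrow> k \<le> i \<Longrightarrow> i < n \<Longrightarrow> (Q *\<^sub>v w) $ i = 0" by metis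
  define M where "M g = Q * (\<rho> g * P)" for g
  note R = rep_carrier[OF \<rho>]
  have RP: "\<rho> g * P \<in> carrier_mat n n" if "g \<in> carrier G" for g using R[OF that] P by auto
  have M: "M g \<in> carrier_mat n n" if "g \<in> carrier G" for g using RP[OF that] Q by (auto simp: M_def)
  \<comment> \<open>The lower left block vanishes because the first \<open>k\<close> basis vectors
    are mapped into \<open>W\<close>.\<close>
  have M0: "M g $$ (i, j) = 0" if g: "g \<in> carrier G" and i: "k \<le> i" "i < n" and j: "j < k" for g i j
  proof -
    have "col (M g) j = Q *\<^sub>v (\<rho> g *\<^sub>v col P j)"
      using j k unfolding M_def by (subst col_mult2[OF Q RP[OF g]], simp, subst col_mult2[OF R[OF g] P], auto)
    hence "col (M g) j $ i = 0" using zero[OF act[OF g cols[OF j]] i] by simp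
    thus ?thesis using i j k carrier_matD[OF M[OF g]] by simp
  qed
  have Mmult: "M (g \<otimes> h) = M g * M h" if g: "g \<in> carrier G" and h: "h \<in> carrier G" for g h
  proof -
    have "M g * M h = Q * (\<rho> g * P * M h)"
      unfolding M_def[of g] by (rule assoc_mult_mat[OF Q RP[OF g] M[OF h]])
    also have "\<rho> g * P * M h = \<rho> g * P * Q * (\<rho> h * P)"
      unfolding M_def by (rule assoc_mult_mat[symmetric, OF RP[OF g] Q RP[OF h]])
    also have "\<rho> g * P * Q = \<rho> g"
      using assoc_mult_mat[OF R[OF g] P Q] PQ R[OF g] by simp
    also have "\<rho> g * (\<rho> h * P) = \<rho> (g \<otimes> h) * P"
      using g h P by (simp add: rep_mult[OF \<rho>] assoc_mult_mat[OF R[OF g] R[OF h] P])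
    finally show ?thesis by (simp add: M_def)
  qed
  have M1: "M \<one> = 1\<^sub>m n" using P PQ by (simp add: M_def rep_one[OF \<rho>])
  have Mm: "M (g \<otimes> h) $$ (i, j) = (\<Sum>l<k. M g $$ (i, l) * M h $$ (l, j)) + (\<Sum>l<n - k. M g $$ (i, l + k) * M h $$ (l + k, j))"
    if "g \<in> carrier G" "h \<in> carrier G" "i < n" "j < n" for g h i j
    using that k by (simp add: Mmult index_mult_mat_sum[OF M M] sum_lessThan_split[of k n] del: index_mult_mat(1))
  define \<sigma> where "\<sigma> g = mat k k (\<lambda>(i, j). M g $$ (i, j))" for g
  define \<tau> where "\<tau> g = mat (n - k) (n - k) (\<lambda>(i, j). M g $$ (i + k, j + k))" for g
  have \<sigma>c: "\<sigma> g \<in> carrier_mat k k" and \<tau>c: "\<tau> g \<in> carrier_mat (n - k) (n - k)" for g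
    by (simp_all add: \<sigma>_def \<tau>_def)
  have "representation G k \<sigma>"
    unfolding representation_iff
  proof (intro conjI ballI)
    fix g h assume gh: "g \<in> carrier G" "h \<in> carrier G"
    show "\<sigma> (g \<otimes> h) = \<sigma> g * \<sigma> h"
    proof (rule eq_matI)
      fix i j assume "i < dim_row (\<sigma> g * \<sigma> h)" "j < dim_col (\<sigma> g * \<sigma> h)"
      hence ij: "i < k" "j < k" using \<sigma>c by (auto simp: \<sigma>_def)
      have "(\<sigma> g * \<sigma> h) $$ (i, j) = (\<Sum>l<k. M g $$ (i, l) * M h $$ (l, j))"
        using ij
        by (subst index_mult_mat_sum[OF \<sigma>c \<sigma>c]) (auto simp: \<sigma>_def intro!: sum.cong)
      thus "\<sigma> (g \<otimes> h) $$ (i, j) = (\<sigma> g * \<sigma> h) $$ (i, j)"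
        using ij k gh by (simp add: \<sigma>_def[of "g \<otimes> h"] Mm M0 del: index_mult_mat(1))
    qed (use \<sigma>c in \<open>auto simp: \<sigma>_def\<close>)
  qed (use k \<sigma>c in \<open>auto simp: \<sigma>_def M1\<close>)
  moreover have "representation G (n - k) \<tau>"
    unfolding representation_iff
  proof (intro conjI ballI)
    fix g h assume gh: "g \<in> carrier G" "h \<in> carrier G"
    show "\<tau> (g \<otimes> h) = \<tau> g * \<tau> h"
    proof (rule eq_matI)
      fix i j assume "i < dim_row (\<tau> g * \<tau> h)" "j < dim_col (\<tau> g * \<tau> h)"
      hence ij: "i < n - k" "j < n - k" using \<tau>c by (auto simp: \<tau>_def)
      have "(\<tau> g * \<tau> h) $$ (i, j) = (\<Sum>l<n - k. M g $$ (i + k, l + k) * M h $$ (l + k, j + k))"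
        using ij
        by (subst index_mult_mat_sum[OF \<tau>c \<tau>c]) (auto simp: \<tau>_def intro!: sum.cong)
      thus "\<tau> (g \<otimes> h) $$ (i, j) = (\<tau> g * \<tau> h) $$ (i, j)"
        using ij k gh by (simp add: \<tau>_def[of "g \<otimes> h"] Mm M0 del: index_mult_mat(1))
    qed (use \<tau>c in \<open>auto simp: \<tau>_def\<close>)
  qed (use k \<tau>c in \<open>auto simp: \<tau>_def M1\<close>)
  moreover have "afforded_character G n \<rho> g = afforded_character G k \<sigma> g + afforded_character G (n - k) \<tau> g" for g
  proof (cases "g \<in> carrier G")
    case True
    have "afforded_character G n \<rho> g = mtrace (Q * \<rho> g * P)"
      using mtrace_conjugate[OF Q R[OF True] P PQ(1)] True by (simp add: afforded_eq_mtrace[OF \<rho>])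
    also have "Q * \<rho> g * P = M g" unfolding M_def by (rule assoc_mult_mat[OF Q R[OF True] P])
    also have "mtrace (M g) = (\<Sum>i<n. M g $$ (i, i))" using carrier_matD[OF M[OF True]] by (simp add: mtrace_def)
    also have "\<dots> = (\<Sum>i<k. M g $$ (i, i)) + (\<Sum>i<n - k. M g $$ (i + k, i + k))"
      using k by (intro sum_lessThan_split) simp
    also have "\<dots> = afforded_character G k \<sigma> g + afforded_character G (n - k) \<tau> g"
      using True by (simp add: afforded_character_def \<sigma>_def \<tau>_def)
    finally show ?thesis .
  qed (simp add: afforded_character_def)
  ultimately show thesis using that k by blast
qed

text \<open>Lists keep multiplicities. The last two clauses work together: nonempty lists for both
  blocks make the list of a reducible representation longer than one, so length one certifies
  irreducibility, as the norm criterion requires.\<close>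

lemma decomposition:
  assumes "representation G n \<rho>"
  shows "\<exists>xs. set xs \<subseteq> Irr G \<and> (\<forall>g. afforded_character G n \<rho> g = (\<Sum>\<xi>\<leftarrow>xs. \<xi> g)) \<and>
    (n \<noteq> 0 \<longrightarrow> xs \<noteq> []) \<and> (length xs = 1 \<longrightarrow> irreducible_representation G n \<rho>)"
  using assms
proof (induction n arbitrary: \<rho> rule: less_induct)
  case (less n)
  consider "n = 0" | "irreducible_representation G n \<rho>" | "n \<noteq> 0" "\<not> irreducible_representation G n \<rho>" by blast
  thus ?case
  proof cases
    case 1
    thus ?thesis by (intro exI[of _ "[]"]) (auto simp: afforded_character_def)
  next
    case 2
    thus ?thesis by (intro exI[of _ "[afforded_character G n \<rho>]"]) (auto simp: Irr_def)
  next
    case 3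
    from reducible_split[OF less.prems 3] obtain k \<sigma> \<tau> where k: "0 < k" "k < n"
      "representation G k \<sigma>" "representation G (n - k) \<tau>"
      "\<And>g. afforded_character G n \<rho> g = afforded_character G k \<sigma> g + afforded_character G (n - k) \<tau> g"
      by metis
    from less.IH[OF k(2,3)] obtain xs where xs: "set xs \<subseteq> Irr G"
      "\<And>g. afforded_character G k \<sigma> g = (\<Sum>\<xi>\<leftarrow>xs. \<xi> g)" "xs \<noteq> []" using k by blast
    from less.IH[OF _ k(4)] k obtain ys where ys: "set ys \<subseteq> Irr G"
      "\<And>g. afforded_character G (n - k) \<tau> g = (\<Sum>\<xi>\<leftarrow>ys. \<xi> g)" "ys \<noteq> []" by fastforce
    have "length (xs @ ys) \<noteq> 1" using xs ys by (cases xs; cases ys) auto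
    thus ?thesis using xs ys k by (intro exI[of _ "xs @ ys"]) auto
  qed
qed

lemma rep_char_decomposition:
  assumes "rep_char G \<chi>"
  obtains xs where "set xs \<subseteq> Irr G" "\<chi> = (\<lambda>g. \<Sum>\<xi>\<leftarrow>xs. \<xi> g)"
proof -
  from assms obtain n \<rho> where \<rho>: "representation G n \<rho>" "\<chi> = afforded_character G n \<rho>"
    by (auto simp: rep_char_def)
  from decomposition[OF \<rho>(1)] obtain xs where "set xs \<subseteq> Irr G" "\<forall>g. afforded_character G n \<rho> g = (\<Sum>\<xi>\<leftarrow>xs. \<xi> g)"
    by blast
  hence "\<chi> = (\<lambda>g. \<Sum>\<xi>\<leftarrow>xs. \<xi> g)" by (simp add: \<rho>(2) fun_eq_iff)
  thus thesis using that \<open>set xs \<subseteq> Irr G\<close> by blast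
qed

lemma char_inner_sum_list: "char_inner G (\<lambda>g. \<Sum>\<xi>\<leftarrow>xs. \<xi> g) \<psi> = (\<Sum>\<xi>\<leftarrow>xs. char_inner G \<xi> \<psi>)"
  by (induction xs) (simp_all add: char_inner_def distrib_right sum.distrib add_divide_distrib)

lemma char_inner_commute: "char_inner G \<phi> \<psi> = cnj (char_inner G \<psi> \<phi>)"
  by (simp add: char_inner_def mult.commute)

lemma char_inner_count:
  assumes "set xs \<subseteq> Irr G" "\<psi> \<in> Irr G"
  shows "char_inner G (\<lambda>g. \<Sum>\<xi>\<leftarrow>xs. \<xi> g) \<psi> = of_nat (count_list xs \<psi>)"
  unfolding char_inner_sum_list using assms by (induction xs) (auto simp: char_inner_Irr)

text \<open>The norm is the sum over the list entries of their own counts, that is, the sum of the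
  squared multiplicities. Each entry counts at least once, so norm one leaves a single
  entry.\<close>

lemma norm_one_irreducible:
  assumes \<rho>: "representation G n \<rho>"
    and norm: "char_inner G (afforded_character G n \<rho>) (afforded_character G n \<rho>) = 1"
  shows "irreducible_representation G n \<rho>"
proof -
  from decomposition[OF \<rho>] obtain xs where xs: "set xs \<subseteq> Irr G"
    "afforded_character G n \<rho> = (\<lambda>g. \<Sum>\<xi>\<leftarrow>xs. \<xi> g)" "length xs = 1 \<longrightarrow> irreducible_representation G n \<rho>"
    by (auto simp: fun_eq_iff)
  let ?\<chi> = "\<lambda>g. \<Sum>\<xi>\<leftarrow>xs. \<xi> g"
  have "char_inner G ?\<chi> ?\<chi> = (\<Sum>\<xi>\<leftarrow>xs. char_inner G \<xi> ?\<chi>)" by (rule char_inner_sum_list)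
  also have "\<dots> = (\<Sum>\<xi>\<leftarrow>xs. of_nat (count_list xs \<xi>))"
    using xs(1) by (intro arg_cong[where f = sum_list] map_cong refl)
      (metis (no_types, lifting) char_inner_commute char_inner_count[OF xs(1)] complex_cnj_of_nat subsetD)
  also have "\<dots> = of_nat (\<Sum>\<xi>\<leftarrow>xs. count_list xs \<xi>)" 
  proof -
    have "(\<Sum>\<xi>\<leftarrow>ys. of_nat (count_list xs \<xi>)) = (of_nat (\<Sum>\<xi>\<leftarrow>ys. count_list xs \<xi>) :: complex)" for ys
      by (induction ys) auto
    thus ?thesis .
  qed
  finally have "of_nat (\<Sum>\<xi>\<leftarrow>xs. count_list xs \<xi>) = (1 :: complex)" using norm xs(2) by simp
  hence *: "(\<Sum>\<xi>\<leftarrow>xs. count_list xs \<xi>) = 1" by (metis of_nat_eq_1_iff)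
  have "(\<Sum>\<xi>\<leftarrow>xs. 1) \<le> (\<Sum>\<xi>\<leftarrow>xs. count_list xs \<xi>)"
    by (rule sum_list_mono) (simp add: Suc_le_eq count_list_0_iff[THEN iffD1, THEN contrapos_pp] neq0_conv[symmetric] count_list_0_iff)
  hence "length xs \<le> 1" using * by (simp add: sum_list_triv)
  moreover have "xs \<noteq> []" using * by auto
  ultimately have "length xs = 1" by (cases xs) auto
  thus ?thesis using xs by blast
qed

lemma rep_char_norm_one_Irr: "rep_char G \<chi> \<Longrightarrow> char_inner G \<chi> \<chi> = 1 \<Longrightarrow> \<chi> \<in> Irr G"
  by (auto simp: rep_char_def Irr_def intro!: norm_one_irreducible)

section \<open>Regular character and column orthogonality\<close>

lemma regular_rep_char: "rep_char G (\<lambda>g. if g = \<one> then of_nat (card (carrier G)) else 0)"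
proof -
  let ?N = "card (carrier G)"
  obtain e where e: "bij_betw e {..<?N} (carrier G)"
    using ex_bij_betw_nat_finite[OF finite_carrier] by (auto simp: atLeast0LessThan)
  have ec: "e i \<in> carrier G" if "i < ?N" for i using e that by (auto simp: bij_betw_def)
  \<comment> \<open>Permutation matrices of left multiplication; the trace counts fixed points, and
    only the identity has any.\<close>
  define R where "R g = mat ?N ?N (\<lambda>(i, j). if e i = g \<otimes> e j then 1 else 0 :: complex)" for g
  have "representation G ?N R"
    unfolding representation_iff
  proof (intro conjI ballI)
    fix g h assume gh: "g \<in> carrier G" "h \<in> carrier G"
    show "R (g \<otimes> h) = R g * R h"
    proof (rule eq_matI)
      fix i j assume "i < dim_row (R g * R h)" "j < dim_col (R g * R h)"
      hence ij: "i < ?N" "j < ?N" by (auto simp: R_def)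
      have "(R g * R h) $$ (i, j) = (\<Sum>l<?N. (if e i = g \<otimes> e l then 1 else 0) * (if e l = h \<otimes> e j then 1 else 0))"
        using ij by (subst index_mult_mat_sum[of _ ?N ?N _ ?N]) (auto simp: R_def)
      also have "\<dots> = (\<Sum>x\<in>carrier G. (if e i = g \<otimes> x then 1 else 0) * (if x = h \<otimes> e j then 1 else 0))"
        by (rule sum.reindex_bij_betw[OF e])
      also have "\<dots> = (\<Sum>x\<in>carrier G. if x = h \<otimes> e j then (if e i = g \<otimes> x then 1 else 0) else 0)"
        by (intro sum.cong) auto
      also have "\<dots> = (if e i = g \<otimes> h \<otimes> e j then 1 else 0)"
        using gh ec ij finite_carrier by (simp add: sum.delta m_assoc)
      finally show "R (g \<otimes> h) $$ (i, j) = (R g * R h) $$ (i, j)"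
        using ij by (simp add: R_def[of "g \<otimes> h"])
    qed (auto simp: R_def)
  next
    have "inj_on e {..<?N}" using e by (simp add: bij_betw_def)
    thus "R \<one> = 1\<^sub>m ?N" using ec by (auto simp: R_def inj_on_def)
  qed (auto simp: R_def)
  moreover have "(\<lambda>g. if g = \<one> then of_nat ?N else 0) = afforded_character G ?N R"
  proof
    fix g
    have "afforded_character G ?N R g = (if g = \<one> then of_nat ?N else 0)" if g: "g \<in> carrier G"
    proof -
      have "e i = g \<otimes> e i \<longleftrightarrow> g = \<one>" if "i < ?N" for i
        using g ec[OF that] by (metis l_one one_closed right_cancel)
      thus ?thesis using g by (simp add: afforded_character_def R_def)
    qed
    thus "(if g = \<one> then of_nat ?N else 0) = afforded_character G ?N R g"
      by (cases "g \<in> carrier G") (auto simp: afforded_character_def)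
  qed
  ultimately show ?thesis by (auto simp: rep_char_def)
qed

lemma
  shows Irr_one_nonzero: "\<chi> \<in> Irr G \<Longrightarrow> \<chi> \<one> \<noteq> 0"
  and Irr_one_cnj: "\<chi> \<in> Irr G \<Longrightarrow> cnj (\<chi> \<one>) = \<chi> \<one>"
  by (auto elim!: IrrE simp: afforded_one irr_rep)

lemma count_sum_list:
  fixes f :: "'c \<Rightarrow> 'd :: comm_semiring_1"
  assumes "finite A" "set xs \<subseteq> A"
  shows "(\<Sum>x\<leftarrow>xs. f x) = (\<Sum>x\<in>A. of_nat (count_list xs x) * f x)"
  using assms(2)
proof (induction xs)
  case (Cons y xs)
  have "(\<Sum>x\<in>A. of_nat (count_list (y # xs) x) * f x)
      = (\<Sum>x\<in>A. (if x = y then f x else 0) + of_nat (count_list xs x) * f x)"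
    by (intro sum.cong) (auto simp: algebra_simps)
  thus ?case using Cons assms(1) by (simp add: sum.distrib sum.delta)
qed simp

text \<open>Each \<open>\<psi>\<close> occurs \<open>\<psi> \<one>\<close> times in the regular
  character. Degrees are nonzero, so its finite list of constituents contains every irreducible
  character.\<close>

lemma
  shows finite_Irr: "finite (Irr G)"
  and sum_Irr_degree: "z \<in> carrier G \<Longrightarrow>
    (\<Sum>\<chi>\<in>Irr G. \<chi> \<one> * \<chi> z) = (if z = \<one> then of_nat (card (carrier G)) else 0)"
proof -
  let ?r = "\<lambda>g. if g = \<one> then of_nat (card (carrier G)) else 0 :: complex"
  from rep_char_decomposition[OF regular_rep_char] obtain xs where
    xs: "set xs \<subseteq> Irr G" "?r = (\<lambda>g. \<Sum>\<xi>\<leftarrow>xs. \<xi> g)" by blast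
  have count: "of_nat (count_list xs \<psi>) = \<psi> \<one>" if \<psi>: "\<psi> \<in> Irr G" for \<psi>
  proof -
    have "of_nat (count_list xs \<psi>) = char_inner G ?r \<psi>"
      unfolding xs(2) using char_inner_count[OF xs(1) \<psi>] by simp
    also have "\<dots> = \<psi> \<one>"
    proof -
      have "(\<Sum>g\<in>carrier G. ?r g * cnj (\<psi> g))
          = (\<Sum>g\<in>carrier G. if g = \<one> then of_nat (card (carrier G)) * cnj (\<psi> g) else 0)"
        by (intro sum.cong) auto
      also have "\<dots> = of_nat (card (carrier G)) * \<psi> \<one>"
        using finite_carrier by (simp add: sum.delta Irr_one_cnj[OF \<psi>])
      finally show ?thesis using card_carrier_pos unfolding char_inner_def by (simp only:) simp
    qed
    finally show ?thesis .
  qed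
  have "Irr G \<subseteq> set xs"
    using count Irr_one_nonzero by (metis count_list_0_iff of_nat_0 subsetI)
  thus fin: "finite (Irr G)" by (rule finite_subset) simp
  show "(\<Sum>\<chi>\<in>Irr G. \<chi> \<one> * \<chi> z) = ?r z"
    using fun_cong[OF xs(2), of z] by (simp add: count_sum_list[OF fin xs(1)] count)
qed

text \<open>Linearising the product with \<open>Irr_mult\<close> produces the regular character,
  which counts solutions \<open>c\<close>. As neither factor is conjugated, the elements counted
  carry \<open>g\<close> to the inverse of \<open>h\<close>.\<close>

lemma second_orthogonality:
  assumes g: "g \<in> carrier G" and h: "h \<in> carrier G"
  shows "(\<Sum>\<chi>\<in>Irr G. \<chi> g * \<chi> h) = of_nat (card {c \<in> carrier G. c \<otimes> g \<otimes> inv c \<otimes> h = \<one>})"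
proof -
  let ?N = "of_nat (card (carrier G)) :: complex"
  have "(\<Sum>\<chi>\<in>Irr G. \<chi> g * \<chi> h) = (\<Sum>\<chi>\<in>Irr G. \<Sum>c\<in>carrier G. \<chi> \<one> * \<chi> (c \<otimes> g \<otimes> inv c \<otimes> h) / ?N)"
  proof (intro sum.cong refl)
    fix \<chi> assume \<chi>: "\<chi> \<in> Irr G"
    show "\<chi> g * \<chi> h = (\<Sum>c\<in>carrier G. \<chi> \<one> * \<chi> (c \<otimes> g \<otimes> inv c \<otimes> h) / ?N)"
      using Irr_one_nonzero[OF \<chi>] card_carrier_pos
      by (simp add: sum_divide_distrib[symmetric] sum_distrib_left[symmetric] Irr_mult[OF \<chi> g h])
  qed
  also have "\<dots> = (\<Sum>c\<in>carrier G. (\<Sum>\<chi>\<in>Irr G. \<chi> \<one> * \<chi> (c \<otimes> g \<otimes> inv c \<otimes> h)) / ?N)"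
    by (subst sum.swap) (simp add: sum_divide_distrib)
  also have "\<dots> = (\<Sum>c\<in>carrier G. if c \<otimes> g \<otimes> inv c \<otimes> h = \<one> then 1 else 0)"
    using g h card_carrier_pos by (intro sum.cong refl) (simp add: sum_Irr_degree)
  also have "\<dots> = of_nat (card {c \<in> carrier G. c \<otimes> g \<otimes> inv c \<otimes> h = \<one>})"
    using finite_carrier by (simp add: sum.If_cases Int_def conj_commute)
  finally show ?thesis .
qed

end

section \<open>Characters of subgroups and induced characters\<close>

context fin_group
begin

lemma mult_inv_cancel [simp]:
  "x \<in> carrier G \<Longrightarrow> y \<in> carrier G \<Longrightarrow> inv x \<otimes> (x \<otimes> y) = y"
  "x \<in> carrier G \<Longrightarrow> y \<in> carrier G \<Longrightarrow> x \<otimes> (inv x \<otimes> y) = y"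
  by (simp_all add: m_assoc[symmetric])

lemma subgroup_fin_group: "subgroup H G \<Longrightarrow> fin_group (G\<lparr>carrier := H\<rparr>)"
  using finite_carrier subgroup.subset[of H G]
  by (auto simp: fin_group_def fin_group_axioms_def subgroup_imp_group intro: finite_subset)

lemma sub_inv: "subgroup H G \<Longrightarrow> x \<in> H \<Longrightarrow> inv\<^bsub>G\<lparr>carrier := H\<rparr>\<^esub> x = inv x"
  using m_inv_consistent by simp

lemma finite_subgroup: "subgroup H G \<Longrightarrow> finite H"
  using finite_carrier subgroup.subset[of H G] by (auto intro: finite_subset)

lemma card_subgroup_pos: "subgroup H G \<Longrightarrow> card H > 0"
  using finite_subgroup subgroup.one_closed by (auto simp: card_gt_0_iff)

lemma rep_restrict:
  assumes "representation G n \<rho>" "subgroup H G"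
  shows "representation (G\<lparr>carrier := H\<rparr>) n \<rho>"
  using assms subgroup.subset[OF assms(2)]
  by (auto simp: fin_group.representation_iff[OF subgroup_fin_group] representation_iff)

lemma rep_char_restrict:
  assumes "rep_char G \<chi>" "subgroup H G"
  shows "rep_char (G\<lparr>carrier := H\<rparr>) (\<lambda>g. if g \<in> H then \<chi> g else 0)"
  using assms rep_restrict[OF _ assms(2)] subgroup.subset[OF assms(2)]
  by (fastforce simp: rep_char_def afforded_character_def)

lemma rep_char_dual:
  assumes "rep_char G \<chi>"
  shows "rep_char G (dual_character \<chi>)"
proof -
  from assms obtain n \<rho> where \<rho>: "representation G n \<rho>" "\<chi> = afforded_character G n \<rho>"
    by (auto simp: rep_char_def)
  note R = rep_carrier[OF \<rho>(1)]
  have "representation G n (\<lambda>g. map_mat cnj (\<rho> g))"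
    unfolding representation_iff
  proof (intro conjI ballI)
    fix g h assume gh: "g \<in> carrier G" "h \<in> carrier G"
    show "map_mat cnj (\<rho> (g \<otimes> h)) = map_mat cnj (\<rho> g) * map_mat cnj (\<rho> h)"
    proof (rule eq_matI)
      fix i j assume "i < dim_row (map_mat cnj (\<rho> g) * map_mat cnj (\<rho> h))"
        "j < dim_col (map_mat cnj (\<rho> g) * map_mat cnj (\<rho> h))"
      hence ij: "i < n" "j < n" using carrier_matD[OF R[OF gh(1)]] carrier_matD[OF R[OF gh(2)]] by auto
      have "(map_mat cnj (\<rho> g) * map_mat cnj (\<rho> h)) $$ (i, j) = (\<Sum>l<n. cnj (\<rho> g $$ (i, l)) * cnj (\<rho> h $$ (l, j)))"
        using ij carrier_matD[OF R[OF gh(1)]] carrier_matD[OF R[OF gh(2)]]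
        by (subst index_mult_mat_sum[of _ n n _ n]) auto
      also have "\<dots> = cnj ((\<rho> g * \<rho> h) $$ (i, j))"
        by (subst index_mult_mat_sum[OF R[OF gh(1)] R[OF gh(2)] ij]) simp
      also have "\<dots> = map_mat cnj (\<rho> (g \<otimes> h)) $$ (i, j)"
        using ij gh carrier_matD[OF R[OF m_closed[OF gh]]] by (simp add: rep_mult[OF \<rho>(1) gh, symmetric])
      finally show "map_mat cnj (\<rho> (g \<otimes> h)) $$ (i, j) = (map_mat cnj (\<rho> g) * map_mat cnj (\<rho> h)) $$ (i, j)" ..
    qed (use gh carrier_matD[OF R[OF gh(1)]] carrier_matD[OF R[OF gh(2)]] carrier_matD[OF R[OF m_closed[OF gh]]] in auto)
  next
    show "map_mat cnj (\<rho> \<one>) = 1\<^sub>m n" by (auto simp: rep_one[OF \<rho>(1)])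
  qed (use R in auto)
  moreover have "dual_character \<chi> = afforded_character G n (\<lambda>g. map_mat cnj (\<rho> g))"
    using carrier_matD[OF R] by (auto simp: dual_character_def \<rho>(2) afforded_character_def)
  ultimately show ?thesis by (auto simp: rep_char_def)
qed

lemma Irr_dual:
  assumes "\<chi> \<in> Irr G"
  shows "dual_character \<chi> \<in> Irr G"
proof (rule rep_char_norm_one_Irr[OF rep_char_dual[OF Irr_rep_char[OF assms]]])
  have "char_inner G (dual_character \<chi>) (dual_character \<chi>) = char_inner G \<chi> \<chi>"
    by (simp add: char_inner_def dual_character_def mult.commute)
  thus "char_inner G (dual_character \<chi>) (dual_character \<chi>) = 1" by (simp add: char_inner_Irr assms)
qed

lemma real_iff_dual:
  assumes "\<chi> \<in> Irr G"
  shows "(\<forall>g\<in>carrier G. \<chi> g \<in> \<real>) \<longleftrightarrow> \<chi> = dual_character \<chi>"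
proof
  assume *: "\<forall>g\<in>carrier G. \<chi> g \<in> \<real>"
  show "\<chi> = dual_character \<chi>"
  proof
    fix g show "\<chi> g = dual_character \<chi> g"
      using * rep_char_outside[OF Irr_rep_char[OF assms], of g]
      by (cases "g \<in> carrier G") (auto simp: dual_character_def Reals_cnj_iff)
  qed
next
  assume "\<chi> = dual_character \<chi>"
  hence "cnj (\<chi> g) = \<chi> g" for g by (metis dual_character_def)
  thus "\<forall>g\<in>carrier G. \<chi> g \<in> \<real>" by (simp add: Reals_cnj_iff)
qed

text \<open>The sum is |G| times the inner product of \<open>\<chi>\<close> with its dual.\<close>

lemma sum_square_Irr:
  assumes "\<chi> \<in> Irr G"
  shows "(\<Sum>g\<in>carrier G. \<chi> g * \<chi> g) = (if \<forall>g\<in>carrier G. \<chi> g \<in> \<real> then of_nat (card (carrier G)) else 0)"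
  using char_inner_Irr[OF assms Irr_dual[OF assms]] card_carrier_pos
  by (simp add: real_iff_dual[OF assms] char_inner_def dual_character_def field_simps split: if_splits)

lemma Irr_convolution:
  assumes "\<phi> \<in> Irr G" "\<psi> \<in> Irr G" and w: "w \<in> carrier G"
  shows "(\<Sum>y\<in>carrier G. \<phi> y * \<psi> (inv y \<otimes> w)) = (if \<phi> = \<psi> then of_nat (card (carrier G)) / \<phi> \<one> * \<phi> w else 0)"
proof -
  from assms obtain n \<rho> m \<sigma> where \<rho>: "irreducible_representation G n \<rho>" "\<phi> = afforded_character G n \<rho>"
    and \<sigma>: "irreducible_representation G m \<sigma>" "\<psi> = afforded_character G m \<sigma>"
    by (auto elim!: IrrE)
  note r = irr_rep[OF \<rho>(1)] and s = irr_rep[OF \<sigma>(1)]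
  have e: "(\<Sum>y\<in>carrier G. \<phi> y * \<tau> (inv y \<otimes> w)) = (\<Sum>y\<in>carrier G. mtrace (\<rho> y * 1\<^sub>m n) * mtrace (\<sigma>' (inv y) * \<sigma>' w))"
    if "representation G k \<sigma>'" "\<tau> = afforded_character G k \<sigma>'" for \<tau> \<sigma>' k
  proof (intro sum.cong refl)
    fix y assume y: "y \<in> carrier G"
    thus "\<phi> y * \<tau> (inv y \<otimes> w) = mtrace (\<rho> y * 1\<^sub>m n) * mtrace (\<sigma>' (inv y) * \<sigma>' w)"
      using w that rep_carrier[OF r y]
      by (simp add: \<rho>(2) afforded_eq_mtrace[OF r] afforded_eq_mtrace[OF that(1)] rep_mult[OF that(1)])
  qed
  show ?thesis
  proof (cases "\<phi> = \<psi>")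
    case True
    have "(\<Sum>y\<in>carrier G. \<phi> y * \<phi> (inv y \<otimes> w)) = of_nat (card (carrier G)) / of_nat n * mtrace (1\<^sub>m n * \<rho> w)"
      unfolding e[OF r \<rho>(2)] by (rule sum_mtrace_mult[OF \<rho>(1)]) (use w rep_carrier[OF r] in auto)
    moreover have "1\<^sub>m n * \<rho> w = \<rho> w" using rep_carrier[OF r w] by simp
    ultimately show ?thesis using w unfolding True[symmetric]
      by (simp only: \<rho>(2) afforded_eq_mtrace[OF r] afforded_one[OF r] if_True simp_thms)
  next
    case False
    thus ?thesis using sum_mtrace_mult_zero[OF \<sigma>(1) \<rho>(1), of "1\<^sub>m n" "\<sigma> w"] \<rho>(2) \<sigma>(2) rep_carrier[OF s w]
      unfolding e[OF s \<sigma>(2)] by simp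
  qed
qed

text \<open>The element of the group algebra with coefficients \<open>a\<close> is central, so it
  acts on a representation affording \<open>\<chi>\<close> by a scalar. On the level of characters,
  averaging y over its conjugates makes \<open>Irr_mult\<close> applicable.\<close>

lemma class_function_mult_Irr:
  assumes \<chi>: "\<chi> \<in> Irr G" and a: "\<And>x y. x \<in> carrier G \<Longrightarrow> y \<in> carrier G \<Longrightarrow> a (x \<otimes> y \<otimes> inv x) = a y"
    and h: "h \<in> carrier G"
  shows "(\<Sum>y\<in>carrier G. a y * \<chi> (y \<otimes> h)) = (\<Sum>y\<in>carrier G. a y * \<chi> y) / \<chi> \<one> * \<chi> h"
proof -
  let ?n = "of_nat (card (carrier G)) :: complex"
  have "(\<Sum>y\<in>carrier G. a y * \<chi> (y \<otimes> h)) = (\<Sum>y\<in>carrier G. a y * \<chi> (x \<otimes> y \<otimes> inv x \<otimes> h))"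
    if x: "x \<in> carrier G" for x
  proof -
    have "bij_betw (\<lambda>y. x \<otimes> y \<otimes> inv x) (carrier G) (carrier G)"
      using x by (intro bij_betwI[where g = "\<lambda>y. inv x \<otimes> y \<otimes> x"]) (auto simp: m_assoc)
    from sum.reindex_bij_betw[OF this, of "\<lambda>y. a y * \<chi> (y \<otimes> h)"] show ?thesis
      using a x by simp
  qed
  hence "(\<Sum>x\<in>carrier G. \<Sum>y\<in>carrier G. a y * \<chi> (y \<otimes> h))
      = (\<Sum>x\<in>carrier G. \<Sum>y\<in>carrier G. a y * \<chi> (x \<otimes> y \<otimes> inv x \<otimes> h))"
    by (rule sum.cong[OF refl])
  also have "\<dots> = (\<Sum>y\<in>carrier G. a y * (\<Sum>x\<in>carrier G. \<chi> (x \<otimes> y \<otimes> inv x \<otimes> h)))"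
    by (subst sum.swap) (simp add: sum_distrib_left)
  also have "\<dots> = (\<Sum>y\<in>carrier G. ?n * (a y * \<chi> y / \<chi> \<one> * \<chi> h))"
    using h by (intro sum.cong refl) (simp add: Irr_mult[OF \<chi>])
  also have "\<dots> = ?n * ((\<Sum>y\<in>carrier G. a y * \<chi> y) / \<chi> \<one> * \<chi> h)"
    by (simp add: sum_distrib_left sum_distrib_right sum_divide_distrib)
  finally have "?n * (\<Sum>y\<in>carrier G. a y * \<chi> (y \<otimes> h)) = ?n * ((\<Sum>y\<in>carrier G. a y * \<chi> y) / \<chi> \<one> * \<chi> h)"
    by simp
  moreover have "?n \<noteq> 0" using card_carrier_pos by simp
  ultimately show ?thesis using mult_left_cancel by blast
qed

lemma conj_cancel: "x \<in> carrier G \<Longrightarrow> y \<in> carrier G \<Longrightarrow> inv x \<otimes> (x \<otimes> y \<otimes> inv x) \<otimes> x = y"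
  "x \<in> carrier G \<Longrightarrow> y \<in> carrier G \<Longrightarrow> x \<otimes> (inv x \<otimes> y \<otimes> x) \<otimes> inv x = y"
  by (simp_all add: m_assoc)

lemma bij_conj:
  assumes x: "x \<in> carrier G" and H: "H \<subseteq> carrier G"
    and "\<And>h. h \<in> H \<Longrightarrow> x \<otimes> h \<otimes> inv x \<in> H" "\<And>h. h \<in> H \<Longrightarrow> inv x \<otimes> h \<otimes> x \<in> H"
  shows "bij_betw (\<lambda>h. x \<otimes> h \<otimes> inv x) H H"
  using assms by (intro bij_betwI[where g = "\<lambda>h. inv x \<otimes> h \<otimes> x"]) (auto simp: conj_cancel subset_eq)

lemma conj_mem_iff:
  assumes x: "x \<in> carrier G" and y: "y \<in> carrier G"
    and "\<And>h. h \<in> H \<Longrightarrow> x \<otimes> h \<otimes> inv x \<in> H" "\<And>h. h \<in> H \<Longrightarrow> inv x \<otimes> h \<otimes> x \<in> H"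
  shows "x \<otimes> y \<otimes> inv x \<in> H \<longleftrightarrow> y \<in> H"
  using assms conj_cancel(1)[OF x y] by metis

lemma conj_mult:
  "x \<in> carrier G \<Longrightarrow> y \<in> carrier G \<Longrightarrow> z \<in> carrier G \<Longrightarrow>
    x \<otimes> (y \<otimes> z) \<otimes> inv x = (x \<otimes> y \<otimes> inv x) \<otimes> (x \<otimes> z \<otimes> inv x)"
  by (simp add: m_assoc)

lemma rep_conj:
  assumes x: "x \<in> carrier G" and H: "subgroup H G"
    and c: "\<And>h. h \<in> H \<Longrightarrow> x \<otimes> h \<otimes> inv x \<in> H"
    and \<rho>: "representation (G\<lparr>carrier := H\<rparr>) n \<rho>"
  shows "representation (G\<lparr>carrier := H\<rparr>) n (\<lambda>h. \<rho> (x \<otimes> h \<otimes> inv x))"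
proof -
  interpret S: fin_group "G\<lparr>carrier := H\<rparr>" by (rule subgroup_fin_group[OF H])
  show ?thesis
    using S.rep_carrier[OF \<rho>] S.rep_mult[OF \<rho>] S.rep_one[OF \<rho>] c x subgroup.subset[OF H]
    by (auto simp: S.representation_iff conj_mult subset_eq)
qed

text \<open>The two closure assumptions say that \<open>x\<close> normalises \<open>H\<close>.
  Conjugation then permutes \<open>H\<close>, so the norm of the character stays one.\<close>

lemma Irr_conj:
  assumes x: "x \<in> carrier G" and H: "subgroup H G"
    and c: "\<And>h. h \<in> H \<Longrightarrow> x \<otimes> h \<otimes> inv x \<in> H" "\<And>h. h \<in> H \<Longrightarrow> inv x \<otimes> h \<otimes> x \<in> H"
    and \<psi>: "\<psi> \<in> Irr (G\<lparr>carrier := H\<rparr>)"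
  shows "conj_character G \<psi> x \<in> Irr (G\<lparr>carrier := H\<rparr>)"
proof -
  interpret S: fin_group "G\<lparr>carrier := H\<rparr>" by (rule subgroup_fin_group[OF H])
  from \<psi> obtain n \<rho> where \<rho>: "irreducible_representation (G\<lparr>carrier := H\<rparr>) n \<rho>"
    "\<psi> = afforded_character (G\<lparr>carrier := H\<rparr>) n \<rho>" by (auto elim!: S.IrrE)
  have Hc: "h \<in> carrier G" if "h \<in> H" for h using that subgroup.subset[OF H] by auto
  have eq: "conj_character G \<psi> x = afforded_character (G\<lparr>carrier := H\<rparr>) n (\<lambda>h. \<rho> (x \<otimes> h \<otimes> inv x))"
    using conj_mem_iff[of x _ H, OF x _ c] Hc c
    by (auto simp: fun_eq_iff conj_character_def \<rho>(2) afforded_character_def)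
  have "rep_char (G\<lparr>carrier := H\<rparr>) (conj_character G \<psi> x)"
    using rep_conj[OF x H c(1) S.irr_rep[OF \<rho>(1)]] unfolding eq rep_char_def by blast
  moreover have "char_inner (G\<lparr>carrier := H\<rparr>) (conj_character G \<psi> x) (conj_character G \<psi> x)
      = char_inner (G\<lparr>carrier := H\<rparr>) \<psi> \<psi>"
    using sum.reindex_bij_betw[OF bij_conj[OF x subgroup.subset[OF H] c], of "\<lambda>h. \<psi> h * cnj (\<psi> h)"] Hc
    by (simp add: char_inner_def conj_character_def)
  ultimately show ?thesis using \<psi> by (intro S.rep_char_norm_one_Irr) (auto simp: S.char_inner_Irr)
qed

end

section \<open>Clifford theory above an irreducible character of a normal subgroup\<close>

locale irr_over_normal = fin_group +
  fixes N :: "'a set" and \<theta> :: "'a \<Rightarrow> complex"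
  assumes normal: "N \<lhd> G" and theta: "\<theta> \<in> Irr (G\<lparr>carrier := N\<rparr>)"
begin

lemma N_subgroup: "subgroup N G"
  using normal by (rule normal_imp_subgroup)

lemma N_carrier: "n \<in> N \<Longrightarrow> n \<in> carrier G"
  using subgroup.subset[OF N_subgroup] by auto

text \<open>The rewrites let facts about the group \<open>N\<close> be stated with the operations of
  \<open>G\<close>. Inverses are translated separately by \<open>sub_inv\<close>.\<close>

sublocale S: fin_group "G\<lparr>carrier := N\<rparr>"
  rewrites "carrier (G\<lparr>carrier := N\<rparr>) = N" and "monoid.mult (G\<lparr>carrier := N\<rparr>) = monoid.mult G"
    and "monoid.one (G\<lparr>carrier := N\<rparr>) = monoid.one G"
  by (rule subgroup_fin_group[OF N_subgroup]) simp_all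

lemma N_conj: "x \<in> carrier G \<Longrightarrow> n \<in> N \<Longrightarrow> x \<otimes> n \<otimes> inv x \<in> N"
  "x \<in> carrier G \<Longrightarrow> n \<in> N \<Longrightarrow> inv x \<otimes> n \<otimes> x \<in> N"
  by (rule normal.inv_op_closed2[OF normal], assumption+, rule normal.inv_op_closed1[OF normal])

lemma N_conj_iff: "x \<in> carrier G \<Longrightarrow> y \<in> carrier G \<Longrightarrow> x \<otimes> y \<otimes> inv x \<in> N \<longleftrightarrow> y \<in> N"
  by (rule conj_mem_iff) (simp_all only: N_conj)

lemma theta_outside: "y \<notin> N \<Longrightarrow> \<theta> y = 0"
  using S.rep_char_outside[OF S.Irr_rep_char[OF theta]] by simp

lemma theta_inv: "y \<in> N \<Longrightarrow> \<theta> (inv y) = cnj (\<theta> y)"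
  using S.rep_char_inv[OF S.Irr_rep_char[OF theta]] sub_inv[OF N_subgroup] by simp

lemma theta_one: "\<theta> \<one> \<noteq> 0"
  using S.Irr_one_nonzero[OF theta] by simp

lemma conj_theta_Irr: "x \<in> carrier G \<Longrightarrow> conj_character G \<theta> x \<in> Irr (G\<lparr>carrier := N\<rparr>)"
  by (rule Irr_conj[OF _ N_subgroup _ _ theta]) (auto simp: N_conj)

lemma conj_character_mult:
  assumes "x \<in> carrier G" "y \<in> carrier G"
  shows "conj_character G \<psi> (x \<otimes> y) = conj_character G (conj_character G \<psi> x) y"
  using assms by (auto simp: conj_character_def fun_eq_iff m_assoc inv_mult_group)

lemma conj_theta_one: "conj_character G \<theta> \<one> = \<theta>"
  using theta_outside N_carrier by (auto simp: conj_character_def fun_eq_iff)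

lemma inertia_subgroup: "subgroup (inertia G \<theta>) G"
proof (rule subgroupI)
  show "inertia G \<theta> \<noteq> {}" using conj_theta_one by (auto simp: inertia_def)
  fix x assume x: "x \<in> inertia G \<theta>"
  hence xc: "x \<in> carrier G" "conj_character G \<theta> x = \<theta>" by (auto simp: inertia_def)
  have "conj_character G \<theta> (inv x) = conj_character G (conj_character G \<theta> x) (inv x)" by (simp add: xc)
  also have "\<dots> = conj_character G \<theta> (x \<otimes> inv x)" by (rule conj_character_mult[symmetric]) (use xc in auto)
  also have "\<dots> = \<theta>" using xc by (simp add: conj_theta_one)
  finally show "inv x \<in> inertia G \<theta>" using xc by (simp add: inertia_def)
  fix y assume "y \<in> inertia G \<theta>"
  thus "x \<otimes> y \<in> inertia G \<theta>" using xc by (auto simp: inertia_def conj_character_mult)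
qed (auto simp: inertia_def)

text \<open>The elements acting on \<open>\<theta>\<close> as \<open>x\<close> does form the coset T
  x of the inertia group T.\<close>

lemma card_conj_theta_eq:
  assumes x: "x \<in> carrier G"
  shows "card {z \<in> carrier G. conj_character G \<theta> z = conj_character G \<theta> x} = card (inertia G \<theta>)"
proof -
  have "bij_betw (\<lambda>t. t \<otimes> x) (inertia G \<theta>) {z \<in> carrier G. conj_character G \<theta> z = conj_character G \<theta> x}"
  proof (rule bij_betwI[where g = "\<lambda>z. z \<otimes> inv x"])
    show "(\<lambda>z. z \<otimes> inv x) \<in> {z \<in> carrier G. conj_character G \<theta> z = conj_character G \<theta> x} \<rightarrow> inertia G \<theta>"
    proof
      fix z assume "z \<in> {z \<in> carrier G. conj_character G \<theta> z = conj_character G \<theta> x}"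
      hence z: "z \<in> carrier G" "conj_character G \<theta> z = conj_character G \<theta> x" by auto
      hence "conj_character G \<theta> (z \<otimes> inv x) = conj_character G \<theta> (x \<otimes> inv x)"
        using x by (simp only: conj_character_mult inv_closed)
      thus "z \<otimes> inv x \<in> inertia G \<theta>" using x z by (simp add: inertia_def conj_theta_one)
    qed
  qed (use x in \<open>auto simp: inertia_def conj_character_mult m_assoc\<close>)
  thus ?thesis by (rule bij_betw_same_card[symmetric])
qed

text \<open>Multiplicity of \<open>\<theta>\<close> in the restriction of \<open>\<chi>\<close> to
  \<open>N\<close>; by Frobenius reciprocity (\<open>induced_eq\<close>) also that of
  \<open>\<chi>\<close> in the induced character.\<close>

definition mlt :: "('a \<Rightarrow> complex) \<Rightarrow> complex" where
  "mlt \<chi> = (\<Sum>n\<in>N. \<chi> n * cnj (\<theta> n)) / of_nat (card N)"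

lemma card_N_pos: "card N > 0"
  by (rule card_subgroup_pos[OF N_subgroup])

lemma mlt_Nats: 
  assumes "\<chi> \<in> Irr G" shows "\<exists>k. mlt \<chi> = of_nat k"
proof -
  have "rep_char (G\<lparr>carrier := N\<rparr>) (\<lambda>g. if g \<in> N then \<chi> g else 0)"
    by (rule rep_char_restrict[OF Irr_rep_char[OF assms] N_subgroup])
  from S.rep_char_decomposition[OF this] obtain xs where xs: "set xs \<subseteq> Irr (G\<lparr>carrier := N\<rparr>)"
    "(\<lambda>g. if g \<in> N then \<chi> g else 0) = (\<lambda>g. \<Sum>\<xi>\<leftarrow>xs. \<xi> g)" by blast
  have "mlt \<chi> = char_inner (G\<lparr>carrier := N\<rparr>) (\<lambda>g. if g \<in> N then \<chi> g else 0) \<theta>"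
    by (simp add: mlt_def char_inner_def)
  also have "\<dots> = of_nat (count_list xs \<theta>)"
    unfolding xs(2) by (rule S.char_inner_count[OF xs(1) theta])
  finally show ?thesis by blast
qed

text \<open>Frobenius reciprocity from column orthogonality: summing the products of the values at
  \<open>z\<close> and at n over all irreducible characters counts the c with c z c^-1 = n^-1, and
  \<open>cnj (\<theta> n)\<close> is the value of \<open>\<theta>\<close> at that inverse.\<close>

lemma induced_eq:
  assumes z: "z \<in> carrier G"
  shows "induced_character G N \<theta> z = (\<Sum>\<xi>\<in>Irr G. mlt \<xi> * \<xi> z)"
proof -
  have "(\<Sum>\<xi>\<in>Irr G. mlt \<xi> * \<xi> z) = (\<Sum>\<xi>\<in>Irr G. \<Sum>n\<in>N. cnj (\<theta> n) / of_nat (card N) * (\<xi> z * \<xi> n))"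
    by (intro sum.cong refl) (simp add: mlt_def sum_distrib_left sum_distrib_right sum_divide_distrib mult_ac)
  also have "\<dots> = (\<Sum>n\<in>N. cnj (\<theta> n) / of_nat (card N) * (\<Sum>\<xi>\<in>Irr G. \<xi> z * \<xi> n))"
    by (subst sum.swap) (simp add: sum_distrib_left)
  also have "\<dots> = (\<Sum>n\<in>N. cnj (\<theta> n) / of_nat (card N) * (\<Sum>c\<in>carrier G. if c \<otimes> z \<otimes> inv c \<otimes> n = \<one> then 1 else 0))"
    using z N_carrier finite_carrier
    by (intro sum.cong refl) (simp add: second_orthogonality sum.If_cases Int_def conj_commute)
  also have "\<dots> = (\<Sum>c\<in>carrier G. \<Sum>n\<in>N. if c \<otimes> z \<otimes> inv c \<otimes> n = \<one> then cnj (\<theta> n) / of_nat (card N) else 0)"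
    unfolding sum.swap[of _ N] by (simp add: sum_distrib_left if_distrib cong: if_cong)
  also have "\<dots> = (\<Sum>c\<in>carrier G. \<theta> (c \<otimes> z \<otimes> inv c) / of_nat (card N))"
  proof (intro sum.cong refl)
    fix c assume c: "c \<in> carrier G"
    let ?w = "c \<otimes> z \<otimes> inv c"
    have w: "?w \<in> carrier G" using c z by simp
    have "(\<Sum>n\<in>N. if ?w \<otimes> n = \<one> then cnj (\<theta> n) / of_nat (card N) else 0)
        = (\<Sum>n\<in>N. if n = inv ?w then cnj (\<theta> n) / of_nat (card N) else 0)"
    proof -
      have "?w \<otimes> n = \<one> \<longleftrightarrow> n = inv ?w" if "n \<in> N" for n
        using w N_carrier[OF that] by (metis inv_equality inv_inv r_inv)
      thus ?thesis by (intro sum.cong refl) simp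
    qed
    also have "\<dots> = (if inv ?w \<in> N then cnj (\<theta> (inv ?w)) / of_nat (card N) else 0)"
      using finite_subgroup[OF N_subgroup] by (simp add: sum.delta)
    also have "\<dots> = \<theta> ?w / of_nat (card N)"
    proof (cases "?w \<in> N")
      case True
      thus ?thesis using subgroup.m_inv_closed[OF N_subgroup] by (simp add: theta_inv)
    next
      case False
      hence "inv ?w \<notin> N" using subgroup.m_inv_closed[OF N_subgroup, of "inv ?w"] w by auto
      thus ?thesis using False by (simp add: theta_outside)
    qed
    finally show "(\<Sum>n\<in>N. if ?w \<otimes> n = \<one> then cnj (\<theta> n) / of_nat (card N) else 0) = \<theta> ?w / of_nat (card N)" .
  qed
  finally show ?thesis using z by (simp add: induced_character_def sum_divide_distrib)
qed

text \<open>The inner product with \<open>\<chi>\<close> recovers its coefficient from any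
  decomposition, so it must be \<open>mlt \<chi>\<close>. Conversely, \<open>mlt\<close> is a
  natural number, as \<open>constituent\<close> demands.\<close>

lemma lies_over_iff:
  "lies_over G N \<theta> \<chi> \<longleftrightarrow> \<chi> \<in> Irr G \<and> mlt \<chi> \<noteq> 0"
proof
  assume "lies_over G N \<theta> \<chi>"
  then obtain m :: "_ \<Rightarrow> nat" where \<chi>: "\<chi> \<in> Irr G" and m: "0 < m \<chi>"
    "induced_character G N \<theta> = (\<lambda>g. \<Sum>\<xi>\<in>Irr G. of_nat (m \<xi>) * \<xi> g)"
    by (auto simp: lies_over_def constituent_def)
  have inner: "char_inner G (induced_character G N \<theta>) \<chi> = f \<chi>"
    if "\<And>g. g \<in> carrier G \<Longrightarrow> induced_character G N \<theta> g = (\<Sum>\<xi>\<in>Irr G. f \<xi> * \<xi> g)" for f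
  proof -
    have "char_inner G (induced_character G N \<theta>) \<chi>
        = (\<Sum>g\<in>carrier G. \<Sum>\<xi>\<in>Irr G. f \<xi> * \<xi> g * cnj (\<chi> g)) / of_nat (card (carrier G))"
      by (simp add: char_inner_def that sum_distrib_right)
    also have "\<dots> = (\<Sum>\<xi>\<in>Irr G. f \<xi> * char_inner G \<xi> \<chi>)"
      by (subst sum.swap) (simp add: char_inner_def sum_distrib_left sum_divide_distrib mult.assoc)
    also have "\<dots> = (\<Sum>\<xi>\<in>Irr G. if \<xi> = \<chi> then f \<xi> else 0)"
      using \<chi> by (intro sum.cong refl) (auto simp: char_inner_Irr)
    finally show ?thesis using \<chi> finite_Irr by (simp add: sum.delta)
  qed
  from inner[OF induced_eq] inner[of "\<lambda>\<xi>. of_nat (m \<xi>)"] m show "\<chi> \<in> Irr G \<and> mlt \<chi> \<noteq> 0"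
    using \<chi> by simp
next
  assume \<chi>: "\<chi> \<in> Irr G \<and> mlt \<chi> \<noteq> 0"
  from mlt_Nats obtain m where m: "\<And>\<xi>. \<xi> \<in> Irr G \<Longrightarrow> mlt \<xi> = of_nat (m \<xi>)" by metis
  have "induced_character G N \<theta> = (\<lambda>g. \<Sum>\<xi>\<in>Irr G. of_nat (m \<xi>) * \<xi> g)"
  proof
    fix g show "induced_character G N \<theta> g = (\<Sum>\<xi>\<in>Irr G. of_nat (m \<xi>) * \<xi> g)"
    proof (cases "g \<in> carrier G")
      case True
      thus ?thesis unfolding induced_eq[OF True] by (simp add: m)
    next
      case False
      thus ?thesis using rep_char_outside[OF Irr_rep_char False] by (simp add: induced_character_def)
    qed
  qed
  moreover have "0 < m \<chi>" using \<chi> m by (cases "m \<chi>") auto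
  ultimately show "lies_over G N \<theta> \<chi>" using \<chi> by (auto simp: lies_over_def constituent_def)
qed

text \<open>Clifford's degree formula: \<open>a\<close> is a multiple of the central idempotent belonging to the
  \<open>G\<close>-orbit of \<open>\<theta>\<close>, which acts on \<open>\<chi>\<close> by \<open>0\<close> or \<open>1\<close>.\<close>

lemma degree_formula:
  assumes \<chi>: "\<chi> \<in> Irr G" and m: "mlt \<chi> \<noteq> 0"
  shows "of_nat (card (inertia G \<theta>)) * \<chi> \<one> = of_nat (card (carrier G)) * \<theta> \<one> * mlt \<chi>"
proof -
  let ?T = "of_nat (card (inertia G \<theta>)) :: complex" and ?G = "of_nat (card (carrier G)) :: complex"
    and ?N = "of_nat (card N) :: complex"
  define b where "b y = (\<Sum>x\<in>carrier G. \<theta> (x \<otimes> y \<otimes> inv x))" for y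
  have b0: "b y = 0" if "y \<in> carrier G" "y \<notin> N" for y
    using that by (auto simp: b_def N_conj_iff theta_outside intro!: sum.neutral)
  have b_conj: "b (x \<otimes> y \<otimes> inv x) = b y" if x: "x \<in> carrier G" and y: "y \<in> carrier G" for x y
  proof -
    have "b y = (\<Sum>u\<in>carrier G. \<theta> ((u \<otimes> x) \<otimes> y \<otimes> inv (u \<otimes> x)))"
      unfolding b_def by (rule sum.reindex_bij_betw[OF bij_right_mult[OF x], symmetric])
    also have "\<dots> = b (x \<otimes> y \<otimes> inv x)"
      unfolding b_def using x y by (intro sum.cong refl) (simp add: m_assoc inv_mult_group)
    finally show ?thesis ..
  qed
  \<comment> \<open>\<open>b\<close> adds up the G-conjugates of \<open>\<theta>\<close>, each
    repeated |T| times. Distinct conjugates convolve to zero and equal ones reproduce themselves up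
    to the factor |N| / \<open>\<theta> \<one>\<close>, so \<open>b\<close> is idempotent up to a
    constant.\<close>
  have conv: "(\<Sum>y\<in>carrier G. b y * b (inv y \<otimes> w)) = ?T * ?N / \<theta> \<one> * b w" if w: "w \<in> carrier G" for w
  proof (cases "w \<in> N")
    case False
    have "b y * b (inv y \<otimes> w) = 0" if y: "y \<in> carrier G" for y
    proof (cases "y \<in> N")
      case True
      have "inv y \<otimes> w \<notin> N"
      proof
        assume "inv y \<otimes> w \<in> N"
        hence "y \<otimes> (inv y \<otimes> w) \<in> N" using True subgroup.m_closed[OF N_subgroup] by blast
        thus False using False y w by (simp add: m_assoc[symmetric])
      qed
      thus ?thesis using y w by (simp add: b0)
    qed (use y in \<open>simp add: b0\<close>)
    thus ?thesis using b0[OF w False] by simp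
  next
    case True
    let ?c = "conj_character G \<theta>"
    have b_eq: "b y = (\<Sum>x\<in>carrier G. ?c x y)" if "y \<in> carrier G" for y
      using that by (simp add: b_def conj_character_def)
    have "(\<Sum>y\<in>carrier G. b y * b (inv y \<otimes> w)) = (\<Sum>y\<in>N. b y * b (inv y \<otimes> w))"
      using finite_carrier subgroup.subset[OF N_subgroup] b0 by (intro sum.mono_neutral_right) auto
    also have "\<dots> = (\<Sum>y\<in>N. \<Sum>x\<in>carrier G. \<Sum>z\<in>carrier G. ?c x y * ?c z (inv y \<otimes> w))"
      using w N_carrier by (intro sum.cong refl) (simp add: b_eq sum_product)
    also have "\<dots> = (\<Sum>x\<in>carrier G. \<Sum>y\<in>N. \<Sum>z\<in>carrier G. ?c x y * ?c z (inv y \<otimes> w))"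
      by (rule sum.swap)
    also have "\<dots> = (\<Sum>x\<in>carrier G. \<Sum>z\<in>carrier G. \<Sum>y\<in>N. ?c x y * ?c z (inv y \<otimes> w))"
      by (intro sum.cong refl sum.swap)
    also have "\<dots> = (\<Sum>x\<in>carrier G. \<Sum>z\<in>carrier G. if ?c z = ?c x then ?N / \<theta> \<one> * ?c x w else 0)"
    proof (intro sum.cong refl)
      fix x z assume xz: "x \<in> carrier G" "z \<in> carrier G"
      have "(\<Sum>y\<in>N. ?c x y * ?c z (inv y \<otimes> w)) = (\<Sum>y\<in>N. ?c x y * ?c z (inv\<^bsub>G\<lparr>carrier := N\<rparr>\<^esub> y \<otimes> w))"
        by (intro sum.cong refl) (simp add: sub_inv[OF N_subgroup])
      also have "\<dots> = (if ?c x = ?c z then ?N / ?c x \<one> * ?c x w else 0)"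
        by (rule S.Irr_convolution[OF conj_theta_Irr[OF xz(1)] conj_theta_Irr[OF xz(2)] True])
      also have "?c x \<one> = \<theta> \<one>" using xz by (simp add: conj_character_def)
      finally show "(\<Sum>y\<in>N. ?c x y * ?c z (inv y \<otimes> w)) = (if ?c z = ?c x then ?N / \<theta> \<one> * ?c x w else 0)"
        by auto
    qed
    also have "\<dots> = (\<Sum>x\<in>carrier G. ?T * (?N / \<theta> \<one> * ?c x w))"
    proof (intro sum.cong refl)
      fix x assume x: "x \<in> carrier G"
      have "(\<Sum>z\<in>carrier G. if ?c z = ?c x then ?N / \<theta> \<one> * ?c x w else 0)
          = of_nat (card {z \<in> carrier G. ?c z = ?c x}) * (?N / \<theta> \<one> * ?c x w)"
        using finite_carrier by (simp add: sum.If_cases Int_def)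
      thus "(\<Sum>z\<in>carrier G. if ?c z = ?c x then ?N / \<theta> \<one> * ?c x w else 0) = ?T * (?N / \<theta> \<one> * ?c x w)"
        by (simp only: card_conj_theta_eq[OF x])
    qed
    also have "\<dots> = ?T * ?N / \<theta> \<one> * b w" by (simp add: b_eq[OF w] sum_distrib_left mult.assoc)
    finally show ?thesis .
  qed
  \<comment> \<open>The central idempotent of a character has the values at inverses as
    coefficients, hence the conjugate. \<open>\<omega>\<close> is the scalar by which the element
    with coefficients \<open>a\<close> acts on \<open>\<chi>\<close>.\<close>
  define a where "a y = cnj (b y)" for y
  define \<omega> where "\<omega> = (\<Sum>y\<in>carrier G. a y * \<chi> y) / \<chi> \<one>"
  have a: "(\<Sum>y\<in>carrier G. a y * \<chi> (y \<otimes> h)) = \<omega> * \<chi> h" if "h \<in> carrier G" for h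
    unfolding \<omega>_def by (rule class_function_mult_Irr[OF \<chi> _ that]) (simp add: a_def b_conj)
  have nz: "\<chi> \<one> \<noteq> 0" by (rule Irr_one_nonzero[OF \<chi>])
  have w1: "(\<Sum>y\<in>carrier G. a y * \<chi> y) = \<omega> * \<chi> \<one>" using nz by (simp add: \<omega>_def)
  \<comment> \<open>Applying \<open>a\<close> twice multiplies by the square of
    \<open>\<omega>\<close>; by the convolution identity the result is also a constant times one
    application of \<open>a\<close>.\<close>
  have "\<omega> * (\<omega> * \<chi> \<one>) = (\<Sum>z\<in>carrier G. a z * (\<omega> * \<chi> z))"
    by (simp add: w1[symmetric] sum_distrib_left mult_ac)
  also have "\<dots> = (\<Sum>z\<in>carrier G. \<Sum>y\<in>carrier G. a z * a y * \<chi> (y \<otimes> z))"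
    by (intro sum.cong refl) (simp add: a[symmetric] sum_distrib_left mult_ac)
  also have "\<dots> = (\<Sum>y\<in>carrier G. \<Sum>z\<in>carrier G. a z * a y * \<chi> (y \<otimes> z))"
    by (rule sum.swap)
  also have "\<dots> = (\<Sum>y\<in>carrier G. \<Sum>w\<in>carrier G. a (inv y \<otimes> w) * a y * \<chi> w)"
  proof (rule sum.cong[OF refl])
    fix y assume y: "y \<in> carrier G"
    have "(\<Sum>w\<in>carrier G. a (inv y \<otimes> w) * a y * \<chi> w)
        = (\<Sum>z\<in>carrier G. a (inv y \<otimes> (y \<otimes> z)) * a y * \<chi> (y \<otimes> z))"
      by (rule sum.reindex_bij_betw[OF bij_left_mult[OF y], symmetric])
    also have "\<dots> = (\<Sum>z\<in>carrier G. a z * a y * \<chi> (y \<otimes> z))"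
      using y by (intro sum.cong refl) (simp add: m_assoc[symmetric])
    finally show "(\<Sum>z\<in>carrier G. a z * a y * \<chi> (y \<otimes> z)) = (\<Sum>w\<in>carrier G. a (inv y \<otimes> w) * a y * \<chi> w)" ..
  qed
  also have "\<dots> = (\<Sum>w\<in>carrier G. cnj (\<Sum>y\<in>carrier G. b y * b (inv y \<otimes> w)) * \<chi> w)"
    by (subst sum.swap) (simp add: a_def sum_distrib_left sum_distrib_right mult_ac)
  also have "\<dots> = (\<Sum>w\<in>carrier G. cnj (?T * ?N / \<theta> \<one>) * (a w * \<chi> w))"
    by (intro sum.cong refl) (simp add: conv a_def)
  also have "\<dots> = cnj (?T * ?N / \<theta> \<one>) * (\<omega> * \<chi> \<one>)"
    by (simp only: sum_distrib_left[symmetric] w1)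
  also have "\<dots> = ?T * ?N / \<theta> \<one> * (\<omega> * \<chi> \<one>)"
    using S.Irr_one_cnj[OF theta] by simp
  finally have "(\<omega> * \<omega>) * \<chi> \<one> = (?T * ?N / \<theta> \<one> * \<omega>) * \<chi> \<one>" by (simp only: mult.assoc)
  hence quad: "\<omega> * \<omega> = ?T * ?N / \<theta> \<one> * \<omega>" using nz mult_right_cancel by blast
  \<comment> \<open>Computed directly, \<open>\<omega>\<close> is proportional to
    \<open>mlt \<chi>\<close>, which excludes the root 0 of the quadratic equation. Equating the two
    values of \<open>\<omega>\<close> is the degree formula.\<close>
  have "\<omega> * \<chi> \<one> = (\<Sum>y\<in>carrier G. \<Sum>x\<in>carrier G. cnj (\<theta> (x \<otimes> y \<otimes> inv x)) * \<chi> y)"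
    by (simp add: w1[symmetric] a_def b_def sum_distrib_right)
  also have "\<dots> = (\<Sum>x\<in>carrier G. \<Sum>y\<in>carrier G. cnj (\<theta> (x \<otimes> y \<otimes> inv x)) * \<chi> y)"
    by (rule sum.swap)
  also have "\<dots> = (\<Sum>x\<in>carrier G. \<Sum>y\<in>carrier G. cnj (\<theta> y) * \<chi> y)"
  proof (rule sum.cong[OF refl])
    fix x assume x: "x \<in> carrier G"
    have "(\<Sum>y\<in>carrier G. cnj (\<theta> y) * \<chi> y)
        = (\<Sum>y\<in>carrier G. cnj (\<theta> (x \<otimes> y \<otimes> inv x)) * \<chi> (x \<otimes> y \<otimes> inv x))"
      using x by (intro sum.reindex_bij_betw[OF bij_conj, symmetric]) auto
    thus "(\<Sum>y\<in>carrier G. cnj (\<theta> (x \<otimes> y \<otimes> inv x)) * \<chi> y) = (\<Sum>y\<in>carrier G. cnj (\<theta> y) * \<chi> y)"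
      using x by (simp add: rep_char_conj[OF Irr_rep_char[OF \<chi>]])
  qed
  also have "\<dots> = ?G * (\<Sum>y\<in>carrier G. cnj (\<theta> y) * \<chi> y)" by simp
  also have "(\<Sum>y\<in>carrier G. cnj (\<theta> y) * \<chi> y) = (\<Sum>y\<in>N. cnj (\<theta> y) * \<chi> y)"
    using finite_carrier subgroup.subset[OF N_subgroup]
    by (intro sum.mono_neutral_right) (auto simp: theta_outside)
  also have "\<dots> = ?N * mlt \<chi>" using card_N_pos by (simp add: mlt_def mult_ac)
  finally have \<omega>: "\<omega> * \<chi> \<one> = ?G * (?N * mlt \<chi>)" .
  hence "\<omega> \<noteq> 0" using m card_N_pos card_carrier_pos by auto
  with quad have "\<omega> = ?T * ?N / \<theta> \<one>" using mult_right_cancel by blast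
  with \<omega> have "?N * (?T * \<chi> \<one>) = ?N * (?G * \<theta> \<one> * mlt \<chi>)" using theta_one by (simp add: field_simps)
  thus ?thesis using card_N_pos by simp
qed

text \<open>One |G| in the denominator comes from the norm of \<open>\<chi>\<close> and one from
  averaging over c. The degree formula trades the first for \<open>\<theta> \<one>\<close> / |T|;
  the conjugating variable of the induced character cancels the second and leaves 1 / |N|.\<close>

lemma card_real_eq_sum:
  "of_nat (card {\<chi> \<in> Irr G. lies_over G N \<theta> \<chi> \<and> (\<forall>g\<in>carrier G. \<chi> g \<in> \<real>)})
   = \<theta> \<one> / (of_nat (card (inertia G \<theta>)) * of_nat (card N)) *
     (\<Sum>g\<in>carrier G. \<Sum>c\<in>carrier G. \<theta> (c \<otimes> g \<otimes> inv c \<otimes> g))"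
proof -
  let ?T = "of_nat (card (inertia G \<theta>)) :: complex" and ?G = "of_nat (card (carrier G)) :: complex"
    and ?N = "of_nat (card N) :: complex"
  let ?I = "{\<chi> \<in> Irr G. mlt \<chi> \<noteq> 0}"
  have pos: "?T \<noteq> 0" "?G \<noteq> 0" "?N \<noteq> 0"
    using card_subgroup_pos[OF inertia_subgroup] card_carrier_pos card_N_pos by auto
  have finI: "finite ?I" using finite_Irr by simp
  have "{\<chi> \<in> Irr G. lies_over G N \<theta> \<chi> \<and> (\<forall>g\<in>carrier G. \<chi> g \<in> \<real>)} = {\<chi> \<in> ?I. \<forall>g\<in>carrier G. \<chi> g \<in> \<real>}"
    by (auto simp: lies_over_iff)
  hence "of_nat (card {\<chi> \<in> Irr G. lies_over G N \<theta> \<chi> \<and> (\<forall>g\<in>carrier G. \<chi> g \<in> \<real>)})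
      = (\<Sum>\<chi>\<in>?I. if \<forall>g\<in>carrier G. \<chi> g \<in> \<real> then 1 else 0 :: complex)"
    using finI by (simp add: sum.If_cases Int_def conj_commute)
  also have "\<dots> = (\<Sum>\<chi>\<in>?I. (\<Sum>g\<in>carrier G. \<chi> g * \<chi> g) / ?G)"
    using pos by (intro sum.cong refl) (auto simp: sum_square_Irr)
  also have "\<dots> = (\<Sum>\<chi>\<in>?I. \<Sum>g\<in>carrier G. \<Sum>c\<in>carrier G. \<chi> \<one> * \<chi> (c \<otimes> g \<otimes> inv c \<otimes> g) / (?G * ?G))"
  proof (rule sum.cong[OF refl])
    fix \<chi> assume "\<chi> \<in> ?I"
    hence \<chi>: "\<chi> \<in> Irr G" by simp
    have "\<chi> g * \<chi> g / ?G = (\<Sum>c\<in>carrier G. \<chi> \<one> * \<chi> (c \<otimes> g \<otimes> inv c \<otimes> g) / (?G * ?G))" if "g \<in> carrier G" for g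
      using that pos Irr_one_nonzero[OF \<chi>]
      by (simp add: sum_divide_distrib[symmetric] sum_distrib_left[symmetric] Irr_mult[OF \<chi>])
    thus "(\<Sum>g\<in>carrier G. \<chi> g * \<chi> g) / ?G
        = (\<Sum>g\<in>carrier G. \<Sum>c\<in>carrier G. \<chi> \<one> * \<chi> (c \<otimes> g \<otimes> inv c \<otimes> g) / (?G * ?G))"
      by (simp add: sum_divide_distrib)
  qed
  also have "\<dots> = (\<Sum>g\<in>carrier G. \<Sum>c\<in>carrier G. \<Sum>\<chi>\<in>?I. \<chi> \<one> * \<chi> (c \<otimes> g \<otimes> inv c \<otimes> g) / (?G * ?G))"
    by (subst sum.swap, intro sum.cong refl, rule sum.swap)
  also have "\<dots> = (\<Sum>g\<in>carrier G. \<Sum>c\<in>carrier G. \<theta> \<one> / (?T * ?G) * induced_character G N \<theta> (c \<otimes> g \<otimes> inv c \<otimes> g))"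
  proof (intro sum.cong refl)
    fix g c assume gc: "g \<in> carrier G" "c \<in> carrier G"
    let ?z = "c \<otimes> g \<otimes> inv c \<otimes> g"
    have "(\<Sum>\<chi>\<in>?I. \<chi> \<one> * \<chi> ?z / (?G * ?G)) = (\<Sum>\<chi>\<in>?I. \<theta> \<one> / (?T * ?G) * (mlt \<chi> * \<chi> ?z))"
    proof (rule sum.cong[OF refl])
      fix \<chi> assume "\<chi> \<in> ?I"
      hence "?T * \<chi> \<one> = ?G * \<theta> \<one> * mlt \<chi>" by (simp add: degree_formula)
      hence "\<chi> \<one> = ?G * \<theta> \<one> * mlt \<chi> / ?T" using pos by (simp add: field_simps)
      thus "\<chi> \<one> * \<chi> ?z / (?G * ?G) = \<theta> \<one> / (?T * ?G) * (mlt \<chi> * \<chi> ?z)"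
        using pos by simp
    qed
    also have "\<dots> = (\<Sum>\<chi>\<in>Irr G. \<theta> \<one> / (?T * ?G) * (mlt \<chi> * \<chi> ?z))"
      using finite_Irr by (intro sum.mono_neutral_left) auto
    also have "\<dots> = \<theta> \<one> / (?T * ?G) * induced_character G N \<theta> ?z"
      using gc by (simp add: induced_eq sum_distrib_left)
    finally show "(\<Sum>\<chi>\<in>?I. \<chi> \<one> * \<chi> ?z / (?G * ?G)) = \<theta> \<one> / (?T * ?G) * induced_character G N \<theta> ?z" .
  qed
  also have "\<dots> = \<theta> \<one> / (?T * ?G) * (\<Sum>g\<in>carrier G. \<Sum>c\<in>carrier G. induced_character G N \<theta> (c \<otimes> g \<otimes> inv c \<otimes> g))"
    by (simp add: sum_distrib_left)
  also have "(\<Sum>g\<in>carrier G. \<Sum>c\<in>carrier G. induced_character G N \<theta> (c \<otimes> g \<otimes> inv c \<otimes> g))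
      = (\<Sum>g\<in>carrier G. \<Sum>c\<in>carrier G. \<Sum>x\<in>carrier G. \<theta> (x \<otimes> (c \<otimes> g \<otimes> inv c \<otimes> g) \<otimes> inv x) / ?N)"
    by (intro sum.cong refl) (simp add: induced_character_def sum_divide_distrib)
  also have "\<dots> = (\<Sum>g\<in>carrier G. \<Sum>x\<in>carrier G. \<Sum>c\<in>carrier G. \<theta> (x \<otimes> (c \<otimes> g \<otimes> inv c \<otimes> g) \<otimes> inv x) / ?N)"
    by (intro sum.cong refl sum.swap)
  also have "\<dots> = (\<Sum>x\<in>carrier G. \<Sum>g\<in>carrier G. \<Sum>c\<in>carrier G. \<theta> (x \<otimes> (c \<otimes> g \<otimes> inv c \<otimes> g) \<otimes> inv x) / ?N)"
    by (rule sum.swap)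
  \<comment> \<open>Conjugation by x is an automorphism. Substituting it in g and c simultaneously
    shows that every x contributes the same sum.\<close>
  also have "\<dots> = (\<Sum>x\<in>carrier G. \<Sum>g\<in>carrier G. \<Sum>c\<in>carrier G. \<theta> (c \<otimes> g \<otimes> inv c \<otimes> g) / ?N)"
  proof (rule sum.cong[OF refl])
    fix x assume x: "x \<in> carrier G"
    let ?k = "\<lambda>y. x \<otimes> y \<otimes> inv x"
    have bij: "bij_betw ?k (carrier G) (carrier G)" using x by (intro bij_conj) auto
    have inv_k: "inv (?k y) = ?k (inv y)" if "y \<in> carrier G" for y
      using x that by (simp add: inv_mult_group m_assoc)
    have "(\<Sum>g\<in>carrier G. \<Sum>c\<in>carrier G. \<theta> (c \<otimes> g \<otimes> inv c \<otimes> g) / ?N)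
        = (\<Sum>g\<in>carrier G. \<Sum>c\<in>carrier G. \<theta> (c \<otimes> ?k g \<otimes> inv c \<otimes> ?k g) / ?N)"
      by (rule sum.reindex_bij_betw[OF bij, symmetric])
    also have "\<dots> = (\<Sum>g\<in>carrier G. \<Sum>c\<in>carrier G. \<theta> (?k c \<otimes> ?k g \<otimes> inv (?k c) \<otimes> ?k g) / ?N)"
      by (intro sum.cong refl sum.reindex_bij_betw[OF bij, symmetric])
    also have "\<dots> = (\<Sum>g\<in>carrier G. \<Sum>c\<in>carrier G. \<theta> (?k (c \<otimes> g \<otimes> inv c \<otimes> g)) / ?N)"
      using x by (intro sum.cong refl) (simp add: inv_k conj_mult del: m_assoc)
    finally show "(\<Sum>g\<in>carrier G. \<Sum>c\<in>carrier G. \<theta> (?k (c \<otimes> g \<otimes> inv c \<otimes> g)) / ?N)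
        = (\<Sum>g\<in>carrier G. \<Sum>c\<in>carrier G. \<theta> (c \<otimes> g \<otimes> inv c \<otimes> g) / ?N)" ..
  qed
  also have "\<dots> = ?G * (\<Sum>g\<in>carrier G. \<Sum>c\<in>carrier G. \<theta> (c \<otimes> g \<otimes> inv c \<otimes> g)) / ?N"
    by (simp add: sum_divide_distrib[symmetric])
  finally show ?thesis using pos by simp
qed

end

section \<open>Extensions to cyclic overgroups\<close>

context fin_group
begin

text \<open>If every average vanished, the sum of products of the two characters would vanish too,
  but for equal irreducible characters it is |G|. A nonzero average is the required
  isomorphism.\<close>

lemma equivalent_of_afforded_eq:
  assumes \<rho>: "irreducible_representation G n \<rho>" and \<sigma>: "irreducible_representation G n \<sigma>"
    and eq: "afforded_character G n \<rho> = afforded_character G n \<sigma>"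
  obtains T S where "T \<in> carrier_mat n n" "S \<in> carrier_mat n n" "T * S = 1\<^sub>m n" "S * T = 1\<^sub>m n"
    "\<And>g. g \<in> carrier G \<Longrightarrow> T * \<rho> g = \<sigma> g * T"
proof -
  note r = irr_rep[OF \<rho>] and s = irr_rep[OF \<sigma>]
  have "\<exists>U\<in>carrier_mat n n. msum n n (\<lambda>g. \<sigma> g * U * \<rho> (inv g)) (carrier G) \<noteq> 0\<^sub>m n n"
  proof (rule ccontr)
    assume "\<not> ?thesis"
    hence z: "msum n n (\<lambda>g. \<sigma> g * U * \<rho> (inv g)) (carrier G) = 0\<^sub>m n n" if "U \<in> carrier_mat n n" for U
      using that by blast
    have "(\<Sum>g\<in>carrier G. mtrace (\<sigma> g * U * \<rho> (inv g) * Y)) = 0"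
      if U: "U \<in> carrier_mat n n" and Y: "Y \<in> carrier_mat n n" for U Y
      using Y by (simp add: mtrace_average_mult[OF r s U Y] z[OF U] mtrace_zero)
    hence "(\<Sum>g\<in>carrier G. mtrace (\<sigma> g * 1\<^sub>m n) * mtrace (\<rho> (inv g) * 1\<^sub>m n)) = 0"
      by (subst sum_mtrace_mult_expand[OF r s]) auto
    moreover have "mtrace (\<sigma> g * 1\<^sub>m n) = mtrace (\<rho> g * 1\<^sub>m n)" if "g \<in> carrier G" for g
      using fun_cong[OF eq, of g] that rep_carrier[OF r that] rep_carrier[OF s that]
      by (simp add: afforded_eq_mtrace[OF r] afforded_eq_mtrace[OF s])
    ultimately have "(\<Sum>g\<in>carrier G. mtrace (\<rho> g * 1\<^sub>m n) * mtrace (\<rho> (inv g) * 1\<^sub>m n)) = 0"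
      by (simp cong: sum.cong)
    thus False using card_carrier_pos \<rho>
      by (subst (asm) sum_mtrace_mult[OF \<rho>]) (auto simp: mtrace_one irreducible_representation_def)
  qed
  then obtain U where U: "U \<in> carrier_mat n n"
    and nz: "msum n n (\<lambda>g. \<sigma> g * U * \<rho> (inv g)) (carrier G) \<noteq> 0\<^sub>m n n" by blast
  note int = average_intertwines[OF r s U]
  from schur_iso[OF \<rho> \<sigma> msum_carrier int nz] obtain S where "S \<in> carrier_mat n n"
    "msum n n (\<lambda>g. \<sigma> g * U * \<rho> (inv g)) (carrier G) * S = 1\<^sub>m n"
    "S * msum n n (\<lambda>g. \<sigma> g * U * \<rho> (inv g)) (carrier G) = 1\<^sub>m n" by blast
  thus thesis using that[OF msum_carrier _ _ _ int] by blast
qed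

lemma afforded_Irr_irreducible:
  assumes "representation G n \<rho>" "afforded_character G n \<rho> \<in> Irr G"
  shows "irreducible_representation G n \<rho>"
  using assms by (intro norm_one_irreducible) (auto simp: char_inner_Irr)

lemma irr_dim_eq:
  assumes "representation G n \<rho>" "representation G m \<sigma>" "afforded_character G n \<rho> = afforded_character G m \<sigma>"
  shows "n = m"
  using afforded_one[OF assms(1)] afforded_one[OF assms(2)] assms(3) by simp

lemma rep_similar:
  assumes \<sigma>: "representation G n \<sigma>" and T: "T \<in> carrier_mat n n" and S: "S \<in> carrier_mat n n"
    and TS: "T * S = 1\<^sub>m n" "S * T = 1\<^sub>m n"
  shows "representation G n (\<lambda>g. S * \<sigma> g * T)"
    "g \<in> carrier G \<Longrightarrow> mtrace (S * \<sigma> g * T) = mtrace (\<sigma> g)"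
proof -
  note R = rep_carrier[OF \<sigma>]
  have SR: "S * \<sigma> g \<in> carrier_mat n n" if "g \<in> carrier G" for g
    by (rule mult_carrier_mat[OF S R[OF that]])
  have c: "S * \<sigma> g * T \<in> carrier_mat n n" if "g \<in> carrier G" for g
    by (rule mult_carrier_mat[OF SR[OF that] T])
  show "representation G n (\<lambda>g. S * \<sigma> g * T)"
    unfolding representation_iff
  proof (intro conjI ballI)
    fix g h assume g: "g \<in> carrier G" and h: "h \<in> carrier G"
    have "S * \<sigma> g * T * (S * \<sigma> h * T) = S * \<sigma> g * (T * (S * \<sigma> h * T))"
      by (rule assoc_mult_mat[OF SR[OF g] T c[OF h]])
    also have "T * (S * \<sigma> h * T) = T * (S * \<sigma> h) * T"
      by (rule assoc_mult_mat[symmetric, OF T SR[OF h] T])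
    also have "T * (S * \<sigma> h) = T * S * \<sigma> h"
      by (rule assoc_mult_mat[symmetric, OF T S R[OF h]])
    also have "\<dots> = \<sigma> h" using R[OF h] by (simp add: TS)
    also have "S * \<sigma> g * (\<sigma> h * T) = S * \<sigma> g * \<sigma> h * T"
      by (rule assoc_mult_mat[symmetric, OF SR[OF g] R[OF h] T])
    also have "S * \<sigma> g * \<sigma> h = S * (\<sigma> g * \<sigma> h)"
      by (rule assoc_mult_mat[OF S R[OF g] R[OF h]])
    finally show "S * \<sigma> (g \<otimes> h) * T = S * \<sigma> g * T * (S * \<sigma> h * T)"
      by (simp only: rep_mult[OF \<sigma> g h])
  next
    show "S * \<sigma> \<one> * T = 1\<^sub>m n" using S TS by (simp add: rep_one[OF \<sigma>])
  qed (rule c)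
  show "g \<in> carrier G \<Longrightarrow> mtrace (S * \<sigma> g * T) = mtrace (\<sigma> g)"
    by (rule mtrace_conjugate[OF S R T TS(1)])
qed

end

lemma pow_mat_add:
  fixes A :: "'a :: semiring_1 mat"
  assumes A: "A \<in> carrier_mat n n"
  shows "A ^\<^sub>m (i + j) = A ^\<^sub>m i * A ^\<^sub>m j"
proof (induction j)
  case (Suc j)
  have "A ^\<^sub>m i * A ^\<^sub>m j * A = A ^\<^sub>m i * (A ^\<^sub>m j * A)"
    by (rule assoc_mult_mat[OF pow_carrier_mat[OF A] pow_carrier_mat[OF A] A])
  thus ?case using Suc by simp
qed (use A in simp)

lemma pow_mat_smult:
  fixes A :: "'a :: comm_semiring_1 mat"
  assumes A: "A \<in> carrier_mat n n"
  shows "(c \<cdot>\<^sub>m A) ^\<^sub>m i = c ^ i \<cdot>\<^sub>m (A ^\<^sub>m i)"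
proof (induction i)
  case 0
  show ?case using A by (auto intro!: eq_matI)
next
  case (Suc i)
  have "(c ^ i \<cdot>\<^sub>m (A ^\<^sub>m i)) * (c \<cdot>\<^sub>m A) = c ^ i \<cdot>\<^sub>m (A ^\<^sub>m i * (c \<cdot>\<^sub>m A))"
    by (rule mult_smult_assoc_mat[OF pow_carrier_mat[OF A], where nc = n]) (use A in simp)
  also have "A ^\<^sub>m i * (c \<cdot>\<^sub>m A) = c \<cdot>\<^sub>m (A ^\<^sub>m i * A)"
    by (rule mult_smult_distrib[OF pow_carrier_mat[OF A] A])
  also have "c ^ i \<cdot>\<^sub>m (c \<cdot>\<^sub>m (A ^\<^sub>m i * A)) = c ^ Suc i \<cdot>\<^sub>m (A ^\<^sub>m Suc i)"
    by (auto intro!: eq_matI simp: mult_ac)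
  finally show ?case by (simp add: Suc)
qed

context irr_over_normal
begin

definition cyc :: "'a \<Rightarrow> 'a set" where
  "cyc x = N <#> generate G {x}"

text \<open>Finite order makes the inverse a natural power. So the elements of \<open>cyc x\<close>
  are n x^i with natural i, and only natural powers of matrices occur.\<close>

lemma pow_inverse:
  assumes x: "x \<in> carrier G"
  obtains o' where "inv x = x [^] (o' :: nat)" "x [^] Suc o' = \<one>"
proof -
  have "ord x > 0" using ord_ge_1[OF finite_carrier x] by simp
  then obtain k where k: "ord x = Suc k" by (cases "ord x") auto
  hence e: "x [^] Suc k = \<one>" using pow_ord_eq_1[OF x] by simp
  hence "x [^] k \<otimes> x = \<one>" by simp
  hence "inv x = x [^] k" using x by (intro inv_equality) auto
  thus thesis using that e by blast
qed

lemma generate_nat_pow: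
  assumes x: "x \<in> carrier G"
  shows "h \<in> generate G {x} \<longleftrightarrow> (\<exists>i::nat. h = x [^] i)"
proof
  assume "h \<in> generate G {x}"
  thus "\<exists>i::nat. h = x [^] i"
  proof (induction rule: generate.induct)
    case one
    show ?case by (intro exI[of _ 0]) simp
  next
    case (incl h)
    thus ?case using x by (intro exI[of _ 1]) simp
  next
    case (inv h)
    hence "h = x" by simp
    obtain o' where "inv x = x [^] (o' :: nat)" using pow_inverse[OF x] by metis
    thus ?case unfolding \<open>h = x\<close> by (rule exI)
  next
    case (eng h1 h2)
    then obtain i j :: nat where "h1 = x [^] i" "h2 = x [^] j" by blast
    thus ?case using nat_pow_mult[OF x, of i j] by (intro exI[of _ "i + j"]) simp
  qed
next
  assume "\<exists>i::nat. h = x [^] i"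
  then obtain i :: nat where h: "h = x [^] i" by blast
  have "x [^] (int i) \<in> generate G {x}" using generate_pow[OF x] by blast
  thus "h \<in> generate G {x}" using h by (simp add: int_pow_int)
qed

lemma mem_cyc: "x \<in> carrier G \<Longrightarrow> h \<in> cyc x \<longleftrightarrow> (\<exists>n\<in>N. \<exists>i::nat. h = n \<otimes> x [^] i)"
proof -
  assume "x \<in> carrier G"
  hence g: "generate G {x} = {x [^] (i::nat) | i. True}" using generate_nat_pow by auto
  show ?thesis unfolding cyc_def set_mult_def g by blast
qed

lemma cyc_subgroup:
  assumes x: "x \<in> carrier G"
  shows "subgroup (cyc x) G"
  unfolding cyc_def using normal x by (intro mult_norm_subgroup generate_is_subgroup) auto

lemma N_cyc: "x \<in> carrier G \<Longrightarrow> n \<in> N \<Longrightarrow> n \<in> cyc x"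
  using N_carrier by (auto simp: mem_cyc intro!: bexI[of _ n] exI[of _ "0::nat"])

lemma x_cyc: "x \<in> carrier G \<Longrightarrow> x \<in> cyc x"
  using subgroup.one_closed[OF N_subgroup] by (auto simp: mem_cyc intro!: bexI[of _ \<one>] exI[of _ "1::nat"])

text \<open>\<open>\<alpha>\<close> is a parameter because conjugates and duals of an extension of
  \<open>\<theta>\<close> extend conjugates and duals of \<open>\<theta>\<close>.\<close>

definition extends :: "'a set \<Rightarrow> ('a \<Rightarrow> complex) \<Rightarrow> ('a \<Rightarrow> complex) \<Rightarrow> bool" where
  "extends H \<psi> \<alpha> \<longleftrightarrow> \<psi> \<in> Irr (G\<lparr>carrier := H\<rparr>) \<and> (\<forall>n\<in>N. \<psi> n = \<alpha> n)"

text \<open>A single matrix representation affords \<open>\<psi>\<close> and, on \<open>N\<close>,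
  the irreducible \<open>\<alpha>\<close>. This makes Schur's lemma for \<open>N\<close> available
  with images of elements outside \<open>N\<close>.\<close>

lemma extends_rep:
  assumes H: "subgroup H G" "N \<subseteq> H" and \<alpha>: "\<alpha> \<in> Irr (G\<lparr>carrier := N\<rparr>)" and e: "extends H \<psi> \<alpha>"
  obtains d \<rho> where "representation (G\<lparr>carrier := H\<rparr>) d \<rho>" "\<psi> = afforded_character (G\<lparr>carrier := H\<rparr>) d \<rho>"
    "irreducible_representation (G\<lparr>carrier := N\<rparr>) d \<rho>" "\<alpha> = afforded_character (G\<lparr>carrier := N\<rparr>) d \<rho>"
    "\<psi> \<one> = of_nat d"
proof -
  interpret H: fin_group "G\<lparr>carrier := H\<rparr>" by (rule subgroup_fin_group[OF H(1)])
  from e obtain d \<rho> where \<rho>: "irreducible_representation (G\<lparr>carrier := H\<rparr>) d \<rho>"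
    "\<psi> = afforded_character (G\<lparr>carrier := H\<rparr>) d \<rho>" by (auto simp: extends_def elim!: H.IrrE)
  note r = H.irr_rep[OF \<rho>(1)]
  have "subgroup N (G\<lparr>carrier := H\<rparr>)" using N_subgroup H by (simp add: subgroup_incl)
  from H.rep_restrict[OF r this] have rN: "representation (G\<lparr>carrier := N\<rparr>) d \<rho>" by simp
  have "\<alpha> x = afforded_character (G\<lparr>carrier := N\<rparr>) d \<rho> x" for x
  proof (cases "x \<in> N")
    case True
    hence "\<alpha> x = \<psi> x" using e by (simp add: extends_def)
    thus ?thesis using True H(2) by (auto simp: \<rho>(2) afforded_character_def)
  next
    case False
    thus ?thesis using S.rep_char_outside[OF S.Irr_rep_char[OF \<alpha>]] by (simp add: afforded_character_def)
  qed
  hence a: "\<alpha> = afforded_character (G\<lparr>carrier := N\<rparr>) d \<rho>" by blast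
  have "irreducible_representation (G\<lparr>carrier := N\<rparr>) d \<rho>"
    using S.afforded_Irr_irreducible[OF rN] \<alpha> a by simp
  moreover have "\<psi> \<one> = of_nat d" using H.afforded_one[OF r] \<rho>(2) by simp
  ultimately show thesis using that r \<rho>(2) a by blast
qed

text \<open>Averaging over \<open>N\<close> alone separates the factors, since the representation
  stays irreducible on \<open>N\<close>.\<close>

lemma extends_conj_sum:
  assumes H: "subgroup H G" "N \<subseteq> H" and e: "extends H \<psi> \<theta>" and u: "u \<in> H" and w: "w \<in> H"
  shows "(\<Sum>n\<in>N. \<psi> (n \<otimes> u \<otimes> inv n \<otimes> w)) = of_nat (card N) / \<theta> \<one> * \<psi> u * \<psi> w"
proof -
  interpret H: fin_group "G\<lparr>carrier := H\<rparr>" by (rule subgroup_fin_group[OF H(1)])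
  from extends_rep[OF H theta e] obtain d \<rho> where
    r: "representation (G\<lparr>carrier := H\<rparr>) d \<rho>" and \<psi>: "\<psi> = afforded_character (G\<lparr>carrier := H\<rparr>) d \<rho>"
    and i: "irreducible_representation (G\<lparr>carrier := N\<rparr>) d \<rho>" and d: "\<psi> \<one> = of_nat d" by blast
  have \<psi>_eq: "\<psi> h = mtrace (\<rho> h)" if "h \<in> H" for h using that H.afforded_eq_mtrace[OF r] by (simp add: \<psi>)
  have m: "\<rho> (g \<otimes> h) = \<rho> g * \<rho> h" if "g \<in> H" "h \<in> H" for g h using H.rep_mult[OF r] that by simp
  have c: "\<rho> g \<in> carrier_mat d d" if "g \<in> H" for g using H.rep_carrier[OF r] that by simp
  note mc = subgroup.m_closed[OF H(1)]
  have NH: "n \<in> H" "inv n \<in> H" if "n \<in> N" for n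
    using that H(2) subgroup.m_inv_closed[OF N_subgroup that] by auto
  have "(\<Sum>n\<in>N. \<psi> (n \<otimes> u \<otimes> inv n \<otimes> w))
      = (\<Sum>n\<in>N. mtrace (\<rho> n * \<rho> u * \<rho> (inv\<^bsub>G\<lparr>carrier := N\<rparr>\<^esub> n) * \<rho> w))"
    using u w by (intro sum.cong refl) (simp add: \<psi>_eq m NH mc sub_inv[OF N_subgroup])
  also have "\<dots> = of_nat (card N) / of_nat d * mtrace (\<rho> u) * mtrace (\<rho> w)"
    by (rule S.sum_mtrace_conj_mult[OF i c[OF u] c[OF w]])
  also have "of_nat d = \<theta> \<one>" using d e subgroup.one_closed[OF N_subgroup] by (simp add: extends_def)
  finally show ?thesis using u w by (simp add: \<psi>_eq)
qed

text \<open>Orthogonality already holds on a single coset: the conjugated value at n u is the value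
  at its inverse, so the images of u and u^-1 become the free matrix factors of a sum over
  \<open>N\<close>.\<close>

lemma extends_coset_sum:
  assumes H: "subgroup H G" "N \<subseteq> H" and \<alpha>: "\<alpha> \<in> Irr (G\<lparr>carrier := N\<rparr>)" and \<beta>: "\<beta> \<in> Irr (G\<lparr>carrier := N\<rparr>)"
    and e: "extends H \<psi> \<alpha>" and e': "extends H \<phi> \<beta>" and u: "u \<in> H"
  shows "\<alpha> \<noteq> \<beta> \<Longrightarrow> (\<Sum>n\<in>N. \<psi> (n \<otimes> u) * cnj (\<phi> (n \<otimes> u))) = 0"
    and "\<psi> = \<phi> \<Longrightarrow> (\<Sum>n\<in>N. \<psi> (n \<otimes> u) * cnj (\<phi> (n \<otimes> u))) = of_nat (card N)"
proof -
  interpret H: fin_group "G\<lparr>carrier := H\<rparr>" by (rule subgroup_fin_group[OF H(1)])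
  from extends_rep[OF H \<alpha> e] obtain d \<rho> where
    r: "representation (G\<lparr>carrier := H\<rparr>) d \<rho>" and \<psi>: "\<psi> = afforded_character (G\<lparr>carrier := H\<rparr>) d \<rho>"
    and i: "irreducible_representation (G\<lparr>carrier := N\<rparr>) d \<rho>" and a: "\<alpha> = afforded_character (G\<lparr>carrier := N\<rparr>) d \<rho>"
    by blast
  from extends_rep[OF H \<beta> e'] obtain k \<sigma> where
    s: "representation (G\<lparr>carrier := H\<rparr>) k \<sigma>" and \<phi>: "\<phi> = afforded_character (G\<lparr>carrier := H\<rparr>) k \<sigma>"
    and j: "irreducible_representation (G\<lparr>carrier := N\<rparr>) k \<sigma>" and b: "\<beta> = afforded_character (G\<lparr>carrier := N\<rparr>) k \<sigma>"
    by blast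
  note mc = subgroup.m_closed[OF H(1)] and ic = subgroup.m_inv_closed[OF H(1)]
  have Hc: "h \<in> carrier G" if "h \<in> H" for h using that subgroup.subset[OF H(1)] by auto
  have NH: "n \<in> H" "inv n \<in> H" if "n \<in> N" for n
    using that H(2) subgroup.m_inv_closed[OF N_subgroup that] by auto
  have key: "(\<Sum>n\<in>N. \<psi> (n \<otimes> u) * cnj (\<phi>' (n \<otimes> u)))
      = (\<Sum>n\<in>N. mtrace (\<rho> n * \<rho> u) * mtrace (\<tau> (inv\<^bsub>G\<lparr>carrier := N\<rparr>\<^esub> n) * \<tau> (inv u)))"
    if t: "representation (G\<lparr>carrier := H\<rparr>) l \<tau>" and \<phi>': "\<phi>' = afforded_character (G\<lparr>carrier := H\<rparr>) l \<tau>" for l \<tau> \<phi>'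
  proof (intro sum.cong refl)
    fix n assume n: "n \<in> N"
    have rc: "rep_char (G\<lparr>carrier := H\<rparr>) \<phi>'" using t \<phi>' by (auto simp: rep_char_def)
    have "cnj (\<phi>' (n \<otimes> u)) = \<phi>' (inv (n \<otimes> u))"
      using H.rep_char_inv[OF rc, of "n \<otimes> u"] mc NH n u by (simp add: sub_inv[OF H(1)])
    also have "\<dots> = \<phi>' (inv u \<otimes> inv n)" using n u Hc N_carrier by (simp add: inv_mult_group)
    also have "\<dots> = \<phi>' (inv n \<otimes> inv u)" using H.rep_char_commute[OF rc] NH n ic u by simp
    also have "\<dots> = mtrace (\<tau> (inv n) * \<tau> (inv u))"
      using H.afforded_eq_mtrace[OF t] H.rep_mult[OF t] mc NH n ic u by (simp add: \<phi>')
    finally show "\<psi> (n \<otimes> u) * cnj (\<phi>' (n \<otimes> u))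
        = mtrace (\<rho> n * \<rho> u) * mtrace (\<tau> (inv\<^bsub>G\<lparr>carrier := N\<rparr>\<^esub> n) * \<tau> (inv u))"
      using H.afforded_eq_mtrace[OF r] H.rep_mult[OF r] mc NH n u by (simp add: \<psi> sub_inv[OF N_subgroup])
  qed
  have cu: "\<rho> u \<in> carrier_mat d d" "\<sigma> (inv u) \<in> carrier_mat k k" "\<rho> (inv u) \<in> carrier_mat d d"
    using H.rep_carrier[OF r] H.rep_carrier[OF s] u ic by auto
  show "\<alpha> \<noteq> \<beta> \<Longrightarrow> (\<Sum>n\<in>N. \<psi> (n \<otimes> u) * cnj (\<phi> (n \<otimes> u))) = 0"
    unfolding key[OF s \<phi>] by (rule S.sum_mtrace_mult_zero[OF j i cu(1,2)]) (use a b in auto)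
  assume "\<psi> = \<phi>"
  have "\<rho> u * \<rho> (inv u) = 1\<^sub>m d" using H.rep_inv(1)[OF r] u by (simp add: sub_inv[OF H(1)])
  moreover have "d \<noteq> 0" using i by (simp add: irreducible_representation_def)
  ultimately show "(\<Sum>n\<in>N. \<psi> (n \<otimes> u) * cnj (\<phi> (n \<otimes> u))) = of_nat (card N)"
    unfolding \<open>\<psi> = \<phi>\<close>[symmetric] key[OF r \<psi>]
    by (subst S.sum_mtrace_mult[OF i cu(1,3)]) (simp add: mtrace_one)
qed

text \<open>After a change of basis the two representations agree on \<open>N\<close>. Their
  quotient at \<open>x\<close> then commutes with the irreducible image of \<open>N\<close>, so it
  is a scalar c, and multiplicativity yields c^i on N x^i.\<close>

lemma extends_unique:
  assumes x: "x \<in> carrier G" and e: "extends (cyc x) \<psi> \<theta>" and e': "extends (cyc x) \<phi> \<theta>"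
  shows "\<exists>c. \<forall>n\<in>N. \<forall>i::nat. \<phi> (n \<otimes> x [^] i) = c ^ i * \<psi> (n \<otimes> x [^] i)"
proof -
  let ?H = "cyc x"
  have H: "subgroup ?H G" "N \<subseteq> ?H" using cyc_subgroup[OF x] N_cyc[OF x] by auto
  interpret H: fin_group "G\<lparr>carrier := ?H\<rparr>" by (rule subgroup_fin_group[OF H(1)])
  from extends_rep[OF H theta e] obtain d \<rho> where
    r: "representation (G\<lparr>carrier := ?H\<rparr>) d \<rho>" and \<psi>: "\<psi> = afforded_character (G\<lparr>carrier := ?H\<rparr>) d \<rho>"
    and i: "irreducible_representation (G\<lparr>carrier := N\<rparr>) d \<rho>" and a: "\<theta> = afforded_character (G\<lparr>carrier := N\<rparr>) d \<rho>"
    by blast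
  from extends_rep[OF H theta e'] obtain k \<sigma> where
    s: "representation (G\<lparr>carrier := ?H\<rparr>) k \<sigma>" and \<phi>: "\<phi> = afforded_character (G\<lparr>carrier := ?H\<rparr>) k \<sigma>"
    and j: "irreducible_representation (G\<lparr>carrier := N\<rparr>) k \<sigma>" and b: "\<theta> = afforded_character (G\<lparr>carrier := N\<rparr>) k \<sigma>"
    by blast
  have "k = d" using S.irr_dim_eq[OF S.irr_rep[OF j] S.irr_rep[OF i]] a b by simp
  note s = s[unfolded this] and j = j[unfolded this] and b = b[unfolded this] and \<phi> = \<phi>[unfolded this]
  from S.equivalent_of_afforded_eq[OF i j] a b obtain T U where T: "T \<in> carrier_mat d d" and U: "U \<in> carrier_mat d d"
    and TU: "T * U = 1\<^sub>m d" "U * T = 1\<^sub>m d" and int: "\<And>n. n \<in> N \<Longrightarrow> T * \<rho> n = \<sigma> n * T" by metis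
  define \<tau> where "\<tau> h = U * \<sigma> h * T" for h
  have t: "representation (G\<lparr>carrier := ?H\<rparr>) d \<tau>" unfolding \<tau>_def by (rule H.rep_similar(1)[OF s T U TU])
  have tr: "mtrace (\<tau> h) = \<phi> h" if "h \<in> ?H" for h
    using that H.rep_similar(2)[OF s T U TU, of h] H.afforded_eq_mtrace[OF s] by (simp add: \<tau>_def \<phi>)
  have Hc: "h \<in> carrier G" if "h \<in> ?H" for h using that subgroup.subset[OF H(1)] by auto
  have c: "\<rho> h \<in> carrier_mat d d" "\<sigma> h \<in> carrier_mat d d" "\<tau> h \<in> carrier_mat d d" if "h \<in> ?H" for h
    using that H.rep_carrier[OF r] H.rep_carrier[OF s] H.rep_carrier[OF t] by auto
  have m: "\<rho> (g \<otimes> h) = \<rho> g * \<rho> h" "\<tau> (g \<otimes> h) = \<tau> g * \<tau> h" if "g \<in> ?H" "h \<in> ?H" for g h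
    using that H.rep_mult[OF r] H.rep_mult[OF t] by auto
  have NH: "n \<in> ?H" if "n \<in> N" for n using that H(2) by auto
  have tN: "\<tau> n = \<rho> n" if n: "n \<in> N" for n
  proof -
    have "U * \<sigma> n * T = U * (\<sigma> n * T)" by (rule assoc_mult_mat[OF U c(2)[OF NH[OF n]] T])
    also have "\<dots> = U * (T * \<rho> n)" by (simp add: int[OF n])
    also have "\<dots> = U * T * \<rho> n" by (rule assoc_mult_mat[symmetric, OF U T c(1)[OF NH[OF n]]])
    finally show ?thesis using c(1)[OF NH[OF n]] by (simp add: \<tau>_def TU)
  qed
  have xH: "x \<in> ?H" "inv x \<in> ?H" using x_cyc[OF x] subgroup.m_inv_closed[OF H(1)] by auto
  define D where "D = \<tau> x * \<rho> (inv x)"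
  have D: "D \<in> carrier_mat d d" unfolding D_def by (rule mult_carrier_mat[OF c(3)[OF xH(1)] c(1)[OF xH(2)]])
  have Dint: "D * \<rho> n = \<rho> n * D" if n: "n \<in> N" for n
  proof -
    let ?n' = "inv x \<otimes> n \<otimes> x"
    have n': "?n' \<in> N" using N_conj(2)[OF x n] .
    have "D * \<rho> n = \<tau> x * (\<rho> (inv x) * \<rho> n)"
      unfolding D_def by (rule assoc_mult_mat[OF c(3)[OF xH(1)] c(1)[OF xH(2)] c(1)[OF NH[OF n]]])
    also have "\<rho> (inv x) * \<rho> n = \<rho> (inv x \<otimes> n)" using m(1)[OF xH(2) NH[OF n]] by simp
    also have "inv x \<otimes> n = ?n' \<otimes> inv x" using x n N_carrier by (simp add: m_assoc)
    also have "\<rho> (?n' \<otimes> inv x) = \<rho> ?n' * \<rho> (inv x)" by (rule m(1)[OF NH[OF n'] xH(2)])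
    also have "\<tau> x * (\<rho> ?n' * \<rho> (inv x)) = \<tau> x * \<rho> ?n' * \<rho> (inv x)"
      by (rule assoc_mult_mat[symmetric, OF c(3)[OF xH(1)] c(1)[OF NH[OF n']] c(1)[OF xH(2)]])
    also have "\<tau> x * \<rho> ?n' = \<tau> (x \<otimes> ?n')" using m(2)[OF xH(1) NH[OF n']] tN[OF n'] by simp
    also have "x \<otimes> ?n' = n \<otimes> x" using x n N_carrier by (simp add: m_assoc)
    also have "\<tau> (n \<otimes> x) = \<rho> n * \<tau> x" using m(2)[OF NH[OF n] xH(1)] tN[OF n] by simp
    also have "\<rho> n * \<tau> x * \<rho> (inv x) = \<rho> n * D"
      unfolding D_def by (rule assoc_mult_mat[OF c(1)[OF NH[OF n]] c(3)[OF xH(1)] c(1)[OF xH(2)]])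
    finally show ?thesis .
  qed
  from S.schur_scalar[OF i D] Dint obtain l where l: "D = l \<cdot>\<^sub>m 1\<^sub>m d" by blast
  have "D * \<rho> x = \<tau> x * (\<rho> (inv x) * \<rho> x)"
    unfolding D_def by (rule assoc_mult_mat[OF c(3)[OF xH(1)] c(1)[OF xH(2)] c(1)[OF xH(1)]])
  also have "\<rho> (inv x) * \<rho> x = 1\<^sub>m d" using H.rep_inv(2)[OF r, of x] xH by (simp add: sub_inv[OF H(1)])
  also have "\<tau> x * 1\<^sub>m d = \<tau> x" using c(3)[OF xH(1)] by simp
  finally have "\<tau> x = D * \<rho> x" ..
  hence tx: "\<tau> x = l \<cdot>\<^sub>m \<rho> x"
    unfolding l using c(1)[OF xH(1)] mult_smult_assoc_mat[of "1\<^sub>m d" d d "\<rho> x" d l] by simp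
  have "\<tau> (n \<otimes> x [^] i) = l ^ i \<cdot>\<^sub>m \<rho> (n \<otimes> x [^] i) \<and> n \<otimes> x [^] i \<in> ?H" if n: "n \<in> N" for n and i :: nat
  proof (induction i)
    case 0
    show ?case using n N_carrier NH c(1)[OF NH[OF n]] by (auto simp: tN intro!: eq_matI)
  next
    case (Suc i)
    let ?h = "n \<otimes> x [^] i"
    have h: "?h \<in> ?H" and IH: "\<tau> ?h = l ^ i \<cdot>\<^sub>m \<rho> ?h" using Suc by auto
    have eq: "n \<otimes> x [^] Suc i = ?h \<otimes> x" using n x N_carrier by (simp add: m_assoc)
    have "\<tau> (?h \<otimes> x) = l ^ i \<cdot>\<^sub>m \<rho> ?h * (l \<cdot>\<^sub>m \<rho> x)" using m(2)[OF h xH(1)] IH tx by simp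
    also have "\<dots> = l ^ i \<cdot>\<^sub>m (\<rho> ?h * (l \<cdot>\<^sub>m \<rho> x))"
      by (rule mult_smult_assoc_mat[OF c(1)[OF h], where nc = d]) (use c(1)[OF xH(1)] in simp)
    also have "\<rho> ?h * (l \<cdot>\<^sub>m \<rho> x) = l \<cdot>\<^sub>m (\<rho> ?h * \<rho> x)"
      by (rule mult_smult_distrib[OF c(1)[OF h] c(1)[OF xH(1)]])
    also have "l ^ i \<cdot>\<^sub>m (l \<cdot>\<^sub>m (\<rho> ?h * \<rho> x)) = l ^ Suc i \<cdot>\<^sub>m \<rho> (?h \<otimes> x)"
      unfolding m(1)[OF h xH(1)] by (auto intro!: eq_matI simp: mult_ac)
    finally show ?case using eq subgroup.m_closed[OF H(1) h xH(1)] by simp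
  qed
  note pow = this
  have "\<phi> (n \<otimes> x [^] i) = l ^ i * \<psi> (n \<otimes> x [^] i)" if n: "n \<in> N" for n and i :: nat
  proof -
    let ?h = "n \<otimes> x [^] i"
    have h: "?h \<in> ?H" and t: "\<tau> ?h = l ^ i \<cdot>\<^sub>m \<rho> ?h" using pow[OF n] by blast+
    have "\<phi> ?h = mtrace (l ^ i \<cdot>\<^sub>m \<rho> ?h)" using tr[OF h] by (simp only: t)
    also have "\<dots> = l ^ i * mtrace (\<rho> ?h)" by (rule mtrace_smult[OF c(1)[OF h]])
    also have "mtrace (\<rho> ?h) = \<psi> ?h" using H.afforded_eq_mtrace[OF r, of ?h] h by (simp add: \<psi>)
    finally show ?thesis .
  qed
  thus ?thesis by blast
qed

end

section \<open>Existence of extensions\<close>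

lemma complex_root_exists:
  assumes "k > 0"
  shows "\<exists>z :: complex. z ^ k = w"
proof (intro exI)
  show "rcis (root k (cmod w)) (Arg w / of_nat k) ^ k = w"
    using assms by (simp add: DeMoivre2 rcis_cmod_Arg)
qed

context irr_over_normal
begin

lemma inertia_carrier: "x \<in> inertia G \<theta> \<Longrightarrow> x \<in> carrier G"
  by (simp add: inertia_def)

lemma theta_inertia:
  assumes "x \<in> inertia G \<theta>" "y \<in> carrier G"
  shows "\<theta> (x \<otimes> y \<otimes> inv x) = \<theta> y"
proof -
  have "\<theta> y = conj_character G \<theta> x y" using assms by (simp add: inertia_def)
  thus ?thesis using assms(2) by (simp add: conj_character_def)
qed

text \<open>An intertwiner \<open>T\<close> between \<open>\<rho>\<close> and \<open>\<rho>\<^sup>x\<close> satisfies \<open>T\<^sup>k = l \<rho>(x\<^sup>k)\<close> for the order \<open>k\<close> of \<open>x\<close>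
  modulo \<open>N\<close>; rescaling \<open>T\<close> by a \<open>k\<close>-th root of \<open>1/l\<close> gives a matrix that can serve as the image of \<open>x\<close>.\<close>

lemma extension_matrix:
  assumes x: "x \<in> inertia G \<theta>"
  obtains d \<rho> M where "irreducible_representation (G\<lparr>carrier := N\<rparr>) d \<rho>"
    "\<theta> = afforded_character (G\<lparr>carrier := N\<rparr>) d \<rho>" "M \<in> carrier_mat d d"
    "\<And>n i. n \<in> N \<Longrightarrow> M ^\<^sub>m i * \<rho> n = \<rho> (x [^] (i::nat) \<otimes> n \<otimes> inv (x [^] i)) * M ^\<^sub>m i"
    "\<And>i. x [^] (i::nat) \<in> N \<Longrightarrow> M ^\<^sub>m i = \<rho> (x [^] i)"
proof -
  have xc: "x \<in> carrier G" using x by (rule inertia_carrier)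
  obtain d \<rho> where i: "irreducible_representation (G\<lparr>carrier := N\<rparr>) d \<rho>"
    and \<theta>: "\<theta> = afforded_character (G\<lparr>carrier := N\<rparr>) d \<rho>" and d: "d > 0"
    using S.IrrE[OF theta] by metis
  note r = S.irr_rep[OF i] and c = S.rep_carrier[OF S.irr_rep[OF i]] and m = S.rep_mult[OF S.irr_rep[OF i]]
  have r': "representation (G\<lparr>carrier := N\<rparr>) d (\<lambda>h. \<rho> (x \<otimes> h \<otimes> inv x))"
    by (rule rep_conj[OF xc N_subgroup N_conj(1)[OF xc] r])
  have \<theta>': "\<theta> = afforded_character (G\<lparr>carrier := N\<rparr>) d (\<lambda>h. \<rho> (x \<otimes> h \<otimes> inv x))"
  proof
    fix y
    show "\<theta> y = afforded_character (G\<lparr>carrier := N\<rparr>) d (\<lambda>h. \<rho> (x \<otimes> h \<otimes> inv x)) y"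
    proof (cases "y \<in> N")
      case True
      have "\<theta> y = \<theta> (x \<otimes> y \<otimes> inv x)" using theta_inertia[OF x N_carrier[OF True]] by simp
      also have "\<dots> = mtrace (\<rho> (x \<otimes> y \<otimes> inv x))"
        using S.afforded_eq_mtrace[OF r N_conj(1)[OF xc True]] \<theta> by metis
      also have "\<dots> = afforded_character (G\<lparr>carrier := N\<rparr>) d (\<lambda>h. \<rho> (x \<otimes> h \<otimes> inv x)) y"
        by (rule S.afforded_eq_mtrace[OF r' True, symmetric])
      finally show ?thesis .
    qed (simp add: theta_outside afforded_character_def)
  qed
  have i': "irreducible_representation (G\<lparr>carrier := N\<rparr>) d (\<lambda>h. \<rho> (x \<otimes> h \<otimes> inv x))"
    using theta \<theta>' by (intro S.afforded_Irr_irreducible[OF r']) simp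
  obtain T U where T: "T \<in> carrier_mat d d" and U: "U \<in> carrier_mat d d" and TU: "T * U = 1\<^sub>m d"
    and int: "\<And>n. n \<in> N \<Longrightarrow> T * \<rho> n = \<rho> (x \<otimes> n \<otimes> inv x) * T"
    using S.equivalent_of_afforded_eq[OF i i'] \<theta> \<theta>' by metis
  note Tp = pow_carrier_mat[OF T]
  have Tint: "T ^\<^sub>m j * \<rho> n = \<rho> (x [^] j \<otimes> n \<otimes> inv (x [^] j)) * T ^\<^sub>m j" if "n \<in> N" for n and j :: nat
    using that
  proof (induction j arbitrary: n)
    case 0
    thus ?case using T c[OF 0] N_carrier by simp
  next
    case (Suc j)
    have n1: "x \<otimes> n \<otimes> inv x \<in> N" by (rule N_conj(1)[OF xc Suc.prems])
    have n2: "x [^] j \<otimes> (x \<otimes> n \<otimes> inv x) \<otimes> inv (x [^] j) \<in> N" by (rule N_conj(1)[OF _ n1]) (use xc in simp)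
    have e: "x [^] j \<otimes> (x \<otimes> n \<otimes> inv x) \<otimes> inv (x [^] j) = x [^] Suc j \<otimes> n \<otimes> inv (x [^] Suc j)"
      using xc N_carrier[OF Suc.prems] by (simp add: m_assoc inv_mult_group)
    have "T ^\<^sub>m j * T * \<rho> n = T ^\<^sub>m j * (T * \<rho> n)" by (rule assoc_mult_mat[OF Tp T c[OF Suc.prems]])
    also have "\<dots> = T ^\<^sub>m j * \<rho> (x \<otimes> n \<otimes> inv x) * T"
      unfolding int[OF Suc.prems] by (rule assoc_mult_mat[symmetric, OF Tp c[OF n1] T])
    also have "\<dots> = \<rho> (x [^] j \<otimes> (x \<otimes> n \<otimes> inv x) \<otimes> inv (x [^] j)) * (T ^\<^sub>m j * T)"
      unfolding Suc.IH[OF n1] by (rule assoc_mult_mat[OF c[OF n2] Tp T])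
    finally show ?case unfolding e by simp
  qed
  \<comment> \<open>The order of \<open>x\<close> modulo \<open>N\<close>; a positive exponent with
    this property exists because \<open>x\<close> has finite order.\<close>
  define k where "k = (LEAST k. 0 < k \<and> x [^] (k::nat) \<in> N)"
  obtain o' where "x [^] Suc o' = \<one>" using pow_inverse[OF xc] by metis
  hence "0 < Suc o' \<and> x [^] Suc o' \<in> N" using subgroup.one_closed[OF N_subgroup] by simp
  hence k: "0 < k" "x [^] k \<in> N" using LeastI[of "\<lambda>k. 0 < k \<and> x [^] (k::nat) \<in> N" "Suc o'"] by (auto simp: k_def)
  let ?y = "x [^] k"
  have yi: "inv ?y \<in> N" by (rule subgroup.m_inv_closed[OF N_subgroup k(2)])
  note yc = N_carrier[OF k(2)]
  \<comment> \<open>\<open>T ^\<^sub>m k\<close> and \<open>\<rho> ?y\<close> conjugate the image of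
    \<open>N\<close> in the same way, so their quotient \<open>D\<close> commutes with it.\<close>
  define D where "D = \<rho> (inv ?y) * T ^\<^sub>m k"
  have D: "D \<in> carrier_mat d d" unfolding D_def by (rule mult_carrier_mat[OF c[OF yi] Tp])
  have "D * \<rho> n = \<rho> n * D" if n: "n \<in> N" for n
  proof -
    have n1: "?y \<otimes> n \<otimes> inv ?y \<in> N" by (rule N_conj(1)[OF yc n])
    have "D * \<rho> n = \<rho> (inv ?y) * (T ^\<^sub>m k * \<rho> n)"
      unfolding D_def by (rule assoc_mult_mat[OF c[OF yi] Tp c[OF n]])
    also have "\<dots> = \<rho> (inv ?y) * \<rho> (?y \<otimes> n \<otimes> inv ?y) * T ^\<^sub>m k"
      unfolding Tint[OF n] by (rule assoc_mult_mat[symmetric, OF c[OF yi] c[OF n1] Tp])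
    also have "\<rho> (inv ?y) * \<rho> (?y \<otimes> n \<otimes> inv ?y) = \<rho> (inv ?y \<otimes> (?y \<otimes> n \<otimes> inv ?y))"
      by (rule m[OF yi n1, symmetric])
    also have "inv ?y \<otimes> (?y \<otimes> n \<otimes> inv ?y) = n \<otimes> inv ?y" using yc N_carrier[OF n] by (simp add: m_assoc)
    also have "\<rho> (n \<otimes> inv ?y) = \<rho> n * \<rho> (inv ?y)" by (rule m[OF n yi])
    also have "\<rho> n * \<rho> (inv ?y) * T ^\<^sub>m k = \<rho> n * D"
      unfolding D_def by (rule assoc_mult_mat[OF c[OF n] c[OF yi] Tp])
    finally show ?thesis .
  qed
  from S.schur_scalar[OF i D this] obtain l where l: "D = l \<cdot>\<^sub>m 1\<^sub>m d" by blast
  have "\<rho> ?y * D = \<rho> ?y * \<rho> (inv ?y) * T ^\<^sub>m k"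
    unfolding D_def by (rule assoc_mult_mat[symmetric, OF c[OF k(2)] c[OF yi] Tp])
  also have "\<rho> ?y * \<rho> (inv ?y) = 1\<^sub>m d"
    using S.rep_inv(1)[OF r k(2)] sub_inv[OF N_subgroup k(2)] by simp
  also have "1\<^sub>m d * T ^\<^sub>m k = T ^\<^sub>m k" by (rule left_mult_one_mat[OF Tp])
  finally have "T ^\<^sub>m k = \<rho> ?y * (l \<cdot>\<^sub>m 1\<^sub>m d)" using l by simp
  also have "\<dots> = l \<cdot>\<^sub>m (\<rho> ?y * 1\<^sub>m d)" by (rule mult_smult_distrib[OF c[OF k(2)], where nc = d]) simp
  finally have Tk: "T ^\<^sub>m k = l \<cdot>\<^sub>m \<rho> ?y" using c[OF k(2)] by simp
  \<comment> \<open>\<open>T\<close> has the right inverse \<open>U\<close>, so no power of it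
    vanishes. Hence \<open>l\<close> is nonzero and can be inverted before the root is
    taken.\<close>
  have Tnz: "T ^\<^sub>m j \<noteq> 0\<^sub>m d d" for j
  proof (induction j)
    case 0
    have "(1\<^sub>m d :: complex mat) $$ (0, 0) \<noteq> 0\<^sub>m d d $$ (0, 0)" using d by simp
    thus ?case using T by auto
  next
    case (Suc j)
    have "T ^\<^sub>m j * T * U = T ^\<^sub>m j * (T * U)" by (rule assoc_mult_mat[OF Tp T U])
    hence "T ^\<^sub>m Suc j * U = T ^\<^sub>m j" by (simp only: TU pow_mat.simps right_mult_one_mat[OF Tp])
    thus ?case using Suc U by auto
  qed
  have "l \<noteq> 0"
  proof
    assume "l = 0"
    hence "T ^\<^sub>m k = 0\<^sub>m d d" unfolding Tk using c[OF k(2)] by (auto intro!: eq_matI)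
    thus False using Tnz by blast
  qed
  obtain z where z: "z ^ k = 1 / l" using complex_root_exists[OF k(1)] by metis
  define M where "M = z \<cdot>\<^sub>m T"
  have M: "M \<in> carrier_mat d d" using T by (simp add: M_def)
  note Mp = pow_carrier_mat[OF M]
  have Mpow: "M ^\<^sub>m j = z ^ j \<cdot>\<^sub>m T ^\<^sub>m j" for j unfolding M_def by (rule pow_mat_smult[OF T])
  have Mk: "M ^\<^sub>m k = \<rho> ?y"
    unfolding Mpow Tk z using \<open>l \<noteq> 0\<close> c[OF k(2)] by (auto intro!: eq_matI)
  have Mint: "M ^\<^sub>m j * \<rho> n = \<rho> (x [^] j \<otimes> n \<otimes> inv (x [^] j)) * M ^\<^sub>m j" if n: "n \<in> N" for n and j :: nat
  proof -
    have n1: "x [^] j \<otimes> n \<otimes> inv (x [^] j) \<in> N" by (rule N_conj(1)[OF _ n]) (use xc in simp)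
    have "M ^\<^sub>m j * \<rho> n = z ^ j \<cdot>\<^sub>m (T ^\<^sub>m j * \<rho> n)"
      unfolding Mpow by (rule mult_smult_assoc_mat[OF Tp c[OF n]])
    also have "\<dots> = \<rho> (x [^] j \<otimes> n \<otimes> inv (x [^] j)) * (z ^ j \<cdot>\<^sub>m T ^\<^sub>m j)"
      unfolding Tint[OF n] by (rule mult_smult_distrib[symmetric, OF c[OF n1] Tp])
    finally show ?thesis unfolding Mpow .
  qed
  have mult_k: "x [^] (q * k) \<in> N \<and> M ^\<^sub>m (q * k) = \<rho> (x [^] (q * k))" for q
  proof (induction q)
    case 0
    thus ?case using M subgroup.one_closed[OF N_subgroup] S.rep_one[OF r] by simp
  next
    case (Suc q)
    have e: "x [^] (Suc q * k) = ?y \<otimes> x [^] (q * k)" using xc by (simp add: nat_pow_mult)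
    have "M ^\<^sub>m (Suc q * k) = M ^\<^sub>m k * M ^\<^sub>m (q * k)" using pow_mat_add[OF M, of k "q * k"] by simp
    also have "\<dots> = \<rho> (?y \<otimes> x [^] (q * k))" using Suc m[OF k(2)] Mk by simp
    finally show ?case using e subgroup.m_closed[OF N_subgroup k(2)] Suc by simp
  qed
  \<comment> \<open>By minimality of \<open>k\<close>, a power of \<open>x\<close> lying in
    \<open>N\<close> has an exponent divisible by \<open>k\<close>.\<close>
  have "M ^\<^sub>m j = \<rho> (x [^] j)" if j: "x [^] j \<in> N" for j :: nat
  proof -
    let ?q = "j div k" and ?r = "j mod k"
    have "x [^] j = x [^] (?q * k) \<otimes> x [^] ?r" using xc nat_pow_mult[OF xc, of "?q * k" ?r] by simp
    hence "x [^] ?r = inv (x [^] (?q * k)) \<otimes> x [^] j" using xc by (simp add: inv_solve_left)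
    hence "x [^] ?r \<in> N"
      using mult_k[of ?q] j subgroup.m_closed[OF N_subgroup] subgroup.m_inv_closed[OF N_subgroup] by metis
    moreover have "?r < k" using k by simp
    ultimately have "?r = 0" using not_less_Least[of ?r "\<lambda>k. 0 < k \<and> x [^] (k::nat) \<in> N"] by (auto simp: k_def)
    hence "j = ?q * k" using div_mult_mod_eq[of j k] by linarith
    thus ?thesis using mult_k[of ?q] by simp
  qed
  thus thesis using that[OF i \<theta> M Mint] by blast
qed

text \<open>The extension sends n x^i to \<open>\<rho> n * M ^\<^sub>m i\<close>. The value of
  \<open>M\<close> on powers in \<open>N\<close> makes this well defined, and its commutation rule
  makes it multiplicative. A subspace invariant under the larger group is invariant under
  \<open>N\<close>, which gives irreducibility.\<close>

lemma extension_exists: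
  assumes x: "x \<in> inertia G \<theta>"
  shows "\<exists>\<psi>. extends (cyc x) \<psi> \<theta>"
proof -
  have xc: "x \<in> carrier G" using x by (rule inertia_carrier)
  obtain d \<rho> M where i: "irreducible_representation (G\<lparr>carrier := N\<rparr>) d \<rho>"
    and \<theta>: "\<theta> = afforded_character (G\<lparr>carrier := N\<rparr>) d \<rho>" and M: "M \<in> carrier_mat d d"
    and int: "\<And>n i. n \<in> N \<Longrightarrow> M ^\<^sub>m i * \<rho> n = \<rho> (x [^] (i::nat) \<otimes> n \<otimes> inv (x [^] i)) * M ^\<^sub>m i"
    and MN: "\<And>i. x [^] (i::nat) \<in> N \<Longrightarrow> M ^\<^sub>m i = \<rho> (x [^] i)"
    using extension_matrix[OF x] by metis
  let ?H = "cyc x"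
  have H: "subgroup ?H G" "N \<subseteq> ?H" using cyc_subgroup[OF xc] N_cyc[OF xc] by auto
  interpret H: fin_group "G\<lparr>carrier := ?H\<rparr>" by (rule subgroup_fin_group[OF H(1)])
  note r = S.irr_rep[OF i] and c = S.rep_carrier[OF S.irr_rep[OF i]] and m = S.rep_mult[OF S.irr_rep[OF i]]
  note Mp = pow_carrier_mat[OF M]
  have wd: "\<rho> n * M ^\<^sub>m i = \<rho> n' * M ^\<^sub>m j"
    if n: "n \<in> N" and n': "n' \<in> N" and eq: "n \<otimes> x [^] i = n' \<otimes> x [^] j" and ij: "i \<le> j" for n n' and i j :: nat
  proof -
    let ?k = "j - i"
    have "n \<otimes> x [^] i = n' \<otimes> x [^] ?k \<otimes> x [^] i"
      using eq ij xc N_carrier[OF n'] by (simp add: m_assoc nat_pow_mult)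
    hence nn: "n = n' \<otimes> x [^] ?k" using xc N_carrier[OF n] N_carrier[OF n'] by (simp add: right_cancel)
    hence "x [^] ?k = inv n' \<otimes> n" using xc N_carrier[OF n'] by simp
    hence k: "x [^] ?k \<in> N" using n n' subgroup.m_closed[OF N_subgroup] subgroup.m_inv_closed[OF N_subgroup] by metis
    have "\<rho> n' * M ^\<^sub>m j = \<rho> n' * (M ^\<^sub>m ?k * M ^\<^sub>m i)" using ij pow_mat_add[OF M, of ?k i] by simp
    also have "\<dots> = \<rho> n' * M ^\<^sub>m ?k * M ^\<^sub>m i" by (rule assoc_mult_mat[symmetric, OF c[OF n'] Mp Mp])
    also have "\<rho> n' * M ^\<^sub>m ?k = \<rho> n" unfolding MN[OF k] nn by (rule m[OF n' k, symmetric])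
    finally show ?thesis ..
  qed
  \<comment> \<open>An element has many presentations n x^i. \<open>R\<close> picks one, and
    \<open>wd\<close> shows that the value is the same for all of them.\<close>
  define R where "R h = (let p = SOME p. fst p \<in> N \<and> h = fst p \<otimes> x [^] (snd p :: nat) in \<rho> (fst p) * M ^\<^sub>m snd p)" for h
  have R: "R (n \<otimes> x [^] i) = \<rho> n * M ^\<^sub>m i" if n: "n \<in> N" for n and i :: nat
  proof -
    let ?P = "\<lambda>p. fst p \<in> N \<and> n \<otimes> x [^] i = fst p \<otimes> x [^] (snd p :: nat)"
    define p where "p = (SOME p. ?P p)"
    have "?P p" unfolding p_def by (rule someI[of ?P "(n, i)"]) (use n in simp)
    hence "\<rho> (fst p) * M ^\<^sub>m snd p = \<rho> n * M ^\<^sub>m i"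
      using wd[of n "fst p" i "snd p"] wd[of "fst p" n "snd p" i] n by (cases "i \<le> snd p") auto
    thus ?thesis by (simp add: R_def p_def Let_def)
  qed
  have RN: "R n = \<rho> n" if "n \<in> N" for n
    using R[OF that, of 0] N_carrier[OF that] c[OF that] M by simp
  have "representation (G\<lparr>carrier := ?H\<rparr>) d R"
    unfolding H.representation_iff
  proof (intro conjI ballI)
    fix h assume "h \<in> carrier (G\<lparr>carrier := ?H\<rparr>)"
    then obtain n i where "n \<in> N" "h = n \<otimes> x [^] (i::nat)" using mem_cyc[OF xc] by auto
    thus "R h \<in> carrier_mat d d" using mult_carrier_mat[OF c Mp] by (simp add: R)
  next
    fix g h assume "g \<in> carrier (G\<lparr>carrier := ?H\<rparr>)" "h \<in> carrier (G\<lparr>carrier := ?H\<rparr>)"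
    then obtain n i n' j where n: "n \<in> N" and g: "g = n \<otimes> x [^] (i::nat)" and n': "n' \<in> N" and h: "h = n' \<otimes> x [^] (j::nat)"
      using mem_cyc[OF xc] by auto
    let ?k = "x [^] i \<otimes> n' \<otimes> inv (x [^] i)"
    have k: "?k \<in> N" by (rule N_conj(1)[OF _ n']) (use xc in simp)
    have nk: "n \<otimes> ?k \<in> N" by (rule subgroup.m_closed[OF N_subgroup n k])
    have gh: "g \<otimes> h = n \<otimes> ?k \<otimes> x [^] (i + j)"
      unfolding g h using xc N_carrier[OF n] N_carrier[OF n'] by (simp add: m_assoc nat_pow_mult[symmetric])
    have c1: "\<rho> n' * M ^\<^sub>m j \<in> carrier_mat d d" "\<rho> n * \<rho> ?k \<in> carrier_mat d d"
      by (rule mult_carrier_mat[OF c[OF n'] Mp], rule mult_carrier_mat[OF c[OF n] c[OF k]])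
    have "R g * R h = \<rho> n * M ^\<^sub>m i * (\<rho> n' * M ^\<^sub>m j)" by (simp add: g h R n n')
    also have "\<dots> = \<rho> n * (M ^\<^sub>m i * (\<rho> n' * M ^\<^sub>m j))" by (rule assoc_mult_mat[OF c[OF n] Mp c1(1)])
    also have "M ^\<^sub>m i * (\<rho> n' * M ^\<^sub>m j) = M ^\<^sub>m i * \<rho> n' * M ^\<^sub>m j"
      by (rule assoc_mult_mat[symmetric, OF Mp c[OF n'] Mp])
    also have "\<dots> = \<rho> ?k * (M ^\<^sub>m i * M ^\<^sub>m j)"
      unfolding int[OF n'] by (rule assoc_mult_mat[OF c[OF k] Mp Mp])
    also have "\<dots> = \<rho> ?k * M ^\<^sub>m (i + j)" by (simp only: pow_mat_add[OF M])
    also have "\<rho> n * (\<rho> ?k * M ^\<^sub>m (i + j)) = \<rho> n * \<rho> ?k * M ^\<^sub>m (i + j)"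
      by (rule assoc_mult_mat[symmetric, OF c[OF n] c[OF k] Mp])
    also have "\<dots> = R (n \<otimes> ?k \<otimes> x [^] (i + j))" unfolding R[OF nk] m[OF n k] ..
    finally show "R (g \<otimes>\<^bsub>G\<lparr>carrier := ?H\<rparr>\<^esub> h) = R g * R h" by (simp add: gh)
  next
    show "R \<one>\<^bsub>G\<lparr>carrier := ?H\<rparr>\<^esub> = 1\<^sub>m d"
      using RN[OF subgroup.one_closed[OF N_subgroup]] S.rep_one[OF r] by simp
  qed
  moreover have "W = {0\<^sub>v d} \<or> W = carrier_vec d" if "invariant_subspace (G\<lparr>carrier := ?H\<rparr>) d R W" for W
  proof (rule irreducibleD[OF i])
    show "invariant_subspace (G\<lparr>carrier := N\<rparr>) d \<rho> W"
      using that H(2) RN by (auto simp: invariant_subspace_def) (metis subsetD)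
  qed
  ultimately have "irreducible_representation (G\<lparr>carrier := ?H\<rparr>) d R"
    using i by (simp add: irreducible_representation_def)
  moreover have "afforded_character (G\<lparr>carrier := ?H\<rparr>) d R n = \<theta> n" if "n \<in> N" for n
    using that H(2) by (auto simp: \<theta> afforded_character_def RN)
  ultimately show ?thesis unfolding extends_def Irr_def by blast
qed

lemma chosen_extension_eq: "chosen_extension G N \<theta> x = (SOME \<psi>. extends (cyc x) \<psi> \<theta>)"
  by (simp add: chosen_extension_def extends_def cyc_def)

lemma chosen_extends: "x \<in> inertia G \<theta> \<Longrightarrow> extends (cyc x) (chosen_extension G N \<theta> x) \<theta>"
  unfolding chosen_extension_eq by (rule someI_ex[OF extension_exists])

text \<open>Conjugation by \<open>c\<close> maps the finite group \<open>cyc x\<close> injectively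
  into itself, hence onto itself, so the inverse conjugation preserves it as well.\<close>

lemma cyc_conj:
  assumes x: "x \<in> carrier G" and c: "c \<in> carrier G" and cx: "c \<otimes> x \<otimes> inv c \<in> cyc x" and h: "h \<in> cyc x"
  shows "c \<otimes> h \<otimes> inv c \<in> cyc x" "inv c \<otimes> h \<otimes> c \<in> cyc x"
proof -
  note mc = subgroup.m_closed[OF cyc_subgroup[OF x]]
  have *: "c \<otimes> h \<otimes> inv c \<in> cyc x" if "h \<in> cyc x" for h
  proof -
    from that obtain n i where n: "n \<in> N" and h: "h = n \<otimes> x [^] (i::nat)" using mem_cyc[OF x] by auto
    have "c \<otimes> x [^] i \<otimes> inv c \<in> cyc x"
    proof (induction i)
      case 0
      thus ?case using c subgroup.one_closed[OF cyc_subgroup[OF x]] by simp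
    next
      case (Suc i)
      have "c \<otimes> x [^] Suc i \<otimes> inv c = (c \<otimes> x [^] i \<otimes> inv c) \<otimes> (c \<otimes> x \<otimes> inv c)"
        using c x by (simp add: m_assoc)
      thus ?case using mc[OF Suc cx] by simp
    qed
    moreover have "c \<otimes> n \<otimes> inv c \<in> cyc x" by (rule N_cyc[OF x N_conj(1)[OF c n]])
    moreover have "c \<otimes> h \<otimes> inv c = (c \<otimes> n \<otimes> inv c) \<otimes> (c \<otimes> x [^] i \<otimes> inv c)"
      unfolding h using c x N_carrier[OF n] by (simp add: m_assoc)
    ultimately show ?thesis using mc by simp
  qed
  show "c \<otimes> h \<otimes> inv c \<in> cyc x" by (rule *[OF h])
  have Hc: "h \<in> carrier G" if "h \<in> cyc x" for h using that subgroup.subset[OF cyc_subgroup[OF x]] by auto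
  have "inj_on (\<lambda>h. c \<otimes> h \<otimes> inv c) (cyc x)"
    using c Hc by (intro inj_onI) (metis conj_cancel(1))
  from endo_inj_surj[OF finite_subgroup[OF cyc_subgroup[OF x]] _ this] have "(\<lambda>h. c \<otimes> h \<otimes> inv c) ` cyc x = cyc x"
    using * by auto
  then obtain h' where h': "h' \<in> cyc x" "h = c \<otimes> h' \<otimes> inv c" using h by auto
  thus "inv c \<otimes> h \<otimes> c \<in> cyc x" using conj_cancel(1)[OF c Hc[OF h'(1)]] by simp
qed

lemma extends_conj:
  assumes x: "x \<in> carrier G" and c: "c \<in> carrier G" and cx: "c \<otimes> x \<otimes> inv c \<in> cyc x" and e: "extends (cyc x) \<psi> \<alpha>"
  shows "extends (cyc x) (conj_character G \<psi> c) (conj_character G \<alpha> c)"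
  unfolding extends_def
proof
  show "conj_character G \<psi> c \<in> Irr (G\<lparr>carrier := cyc x\<rparr>)"
    using e by (intro Irr_conj[OF c cyc_subgroup[OF x]] cyc_conj[OF x c cx]) (auto simp: extends_def)
  show "\<forall>n\<in>N. conj_character G \<psi> c n = conj_character G \<alpha> c n"
    using e N_conj(1)[OF c] N_carrier by (simp add: extends_def conj_character_def)
qed

lemma extends_dual:
  assumes x: "x \<in> carrier G" and e: "extends (cyc x) \<psi> \<alpha>"
  shows "extends (cyc x) (dual_character \<psi>) (dual_character \<alpha>)"
  using fin_group.Irr_dual[OF subgroup_fin_group[OF cyc_subgroup[OF x]]] e
  by (auto simp: extends_def dual_character_def)

end

section \<open>Good classes\<close>

lemma (in group) conj_elem_FactGroup:
  assumes "H \<lhd> G" "x \<in> carrier G" "c \<in> carrier G"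
  shows "conj_elem (G Mod H) (H #> x) (H #> c) = H #> (inv c \<otimes> x \<otimes> c)"
proof -
  interpret normal H G by (rule assms(1))
  have "H #> c \<in> carrier (G Mod H)" using assms(3) by (auto simp: FactGroup_def RCOSETS_def)
  hence "inv\<^bsub>G Mod H\<^esub> (H #> c) = H #> inv c"
    using assms(3) by (simp add: inv_FactGroup rcos_inv)
  thus ?thesis using assms(2,3) by (simp add: conj_elem_def FactGroup_def rcos_sum)
qed

context irr_over_normal
begin

section \<open>Cosets of N under conjugation\<close>

lemma coset_eqI: "u \<in> N \<Longrightarrow> b \<in> carrier G \<Longrightarrow> N #> (u \<otimes> b) = N #> b"
  by (rule repr_independence[symmetric, OF _ _ N_subgroup]) (auto simp: r_coset_def)

lemma coset_eqE:
  assumes "N #> a = N #> b" "a \<in> carrier G" "b \<in> carrier G"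
  obtains u where "u \<in> N" "a = u \<otimes> b"
proof -
  have "a \<in> N #> a" by (rule rcos_self[OF assms(2) N_subgroup])
  thus thesis using that assms(1) by (auto simp: r_coset_def)
qed

lemma coset_eq_iff:
  assumes "a \<in> carrier G" "b \<in> carrier G"
  shows "N #> a = N #> b \<longleftrightarrow> a \<otimes> inv b \<in> N"
proof
  assume "N #> a = N #> b"
  then obtain u where "u \<in> N" "a = u \<otimes> b" using assms by (rule coset_eqE)
  thus "a \<otimes> inv b \<in> N" using assms N_carrier by (simp add: m_assoc)
next
  assume u: "a \<otimes> inv b \<in> N"
  have "a = (a \<otimes> inv b) \<otimes> b" using assms by (simp add: m_assoc)
  thus "N #> a = N #> b" using coset_eqI[OF u assms(2)] by simp
qed

lemma coset_conj:
  assumes "N #> a = N #> b" "a \<in> carrier G" "b \<in> carrier G" "c \<in> carrier G"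
  shows "N #> (c \<otimes> a \<otimes> inv c) = N #> (c \<otimes> b \<otimes> inv c)"
proof -
  obtain u where u: "u \<in> N" "a = u \<otimes> b" using assms(1-3) by (rule coset_eqE)
  have "c \<otimes> a \<otimes> inv c = (c \<otimes> u \<otimes> inv c) \<otimes> (c \<otimes> b \<otimes> inv c)"
    unfolding u(2) using u(1) assms N_carrier by (simp add: m_assoc)
  thus ?thesis using coset_eqI[OF N_conj(1)[OF assms(4) u(1)]] assms by simp
qed

text \<open>Conjugation of elements is defined as c^-1 x c, but conjugate characters are evaluated
  at c x c^-1; this passes between the two conventions.\<close>

lemma coset_conj_iff:
  assumes "a \<in> carrier G" "b \<in> carrier G" "c \<in> carrier G"
  shows "N #> (inv c \<otimes> a \<otimes> c) = N #> b \<longleftrightarrow> N #> a = N #> (c \<otimes> b \<otimes> inv c)"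
proof
  assume "N #> (inv c \<otimes> a \<otimes> c) = N #> b"
  from coset_conj[OF this _ assms(2,3)] assms conj_cancel(2)[OF assms(3,1)]
  show "N #> a = N #> (c \<otimes> b \<otimes> inv c)" by simp
next
  assume "N #> a = N #> (c \<otimes> b \<otimes> inv c)"
  from coset_conj[OF this, of "inv c"] assms conj_cancel(1)[OF assms(3,2)]
  show "N #> (inv c \<otimes> a \<otimes> c) = N #> b" by simp
qed

lemma N_inertia: "n \<in> N \<Longrightarrow> n \<in> inertia G \<theta>"
proof -
  assume n: "n \<in> N"
  have "conj_character G \<theta> n y = \<theta> y" for y
  proof (cases "y \<in> N")
    case True
    thus ?thesis using S.rep_char_conj[OF S.Irr_rep_char[OF theta] True n] N_carrier[OF True] n
      by (simp add: conj_character_def sub_inv[OF N_subgroup])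
  next
    case False
    thus ?thesis using N_conj_iff[OF N_carrier[OF n], of y] by (simp add: conj_character_def theta_outside)
  qed
  thus "n \<in> inertia G \<theta>" using N_carrier[OF n] by (auto simp: inertia_def)
qed

text \<open>The full preimage in \<open>G\<close> of the centraliser of the coset N g in T/N, where
  T is the inertia group.\<close>

definition cen :: "'a \<Rightarrow> 'a set" where
  "cen g = {c \<in> inertia G \<theta>. N #> (c \<otimes> g \<otimes> inv c) = N #> g}"

definition invt :: "'a \<Rightarrow> 'a set" where
  "invt g = {e \<in> carrier G. conj_character G \<theta> e = dual_character \<theta> \<and> N #> (e \<otimes> g \<otimes> inv e) = N #> inv g}"

lemma good_iff:
  assumes "x \<in> carrier G"
  shows "good G N \<theta> x \<longleftrightarrow>
    (\<forall>c\<in>cen x. conj_character G (chosen_extension G N \<theta> x) c = chosen_extension G N \<theta> x)"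
proof -
  have "conj_elem (G Mod N) (N #> x) (N #> c) = N #> x \<longleftrightarrow> N #> (c \<otimes> x \<otimes> inv c) = N #> x"
    if "c \<in> inertia G \<theta>" for c
    using coset_conj_iff[OF assms assms inertia_carrier[OF that]] assms inertia_carrier[OF that]
    by (auto simp: conj_elem_FactGroup[OF normal])
  thus ?thesis by (auto simp: good_def cen_def)
qed

text \<open>For inversion the direction of conjugation is immaterial: e^-1 x e x and e x e^-1 x
  become conjugate after one cyclic rearrangement each, so they lie in \<open>N\<close>
  together.\<close>

lemma inverts_iff:
  assumes "x \<in> carrier G"
  shows "inverts G N \<theta> x e \<longleftrightarrow> e \<in> invt x"
proof -
  have "N #> x \<in> carrier (G Mod N)" using assms by (auto simp: FactGroup_def RCOSETS_def)
  hence i: "inv\<^bsub>G Mod N\<^esub> (N #> x) = N #> inv x"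
    using normal.inv_FactGroup[OF normal] normal.rcos_inv[OF normal assms] by simp
  have "conj_elem (G Mod N) (N #> x) (N #> e) = N #> inv x \<longleftrightarrow> N #> (e \<otimes> x \<otimes> inv e) = N #> inv x"
    if e: "e \<in> carrier G"
  proof -
    have "N #> (inv e \<otimes> x \<otimes> e) = N #> inv x \<longleftrightarrow> inv e \<otimes> x \<otimes> e \<otimes> x \<in> N"
      using assms e by (simp add: coset_eq_iff)
    also have "\<dots> \<longleftrightarrow> e \<otimes> (inv e \<otimes> x \<otimes> e \<otimes> x) \<otimes> inv e \<in> N"
      using assms e by (simp add: N_conj_iff)
    also have "e \<otimes> (inv e \<otimes> x \<otimes> e \<otimes> x) \<otimes> inv e = x \<otimes> (e \<otimes> x \<otimes> inv e)"
      using assms e by (simp add: m_assoc)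
    also have "x \<otimes> (e \<otimes> x \<otimes> inv e) \<in> N \<longleftrightarrow> inv x \<otimes> (x \<otimes> (e \<otimes> x \<otimes> inv e)) \<otimes> inv (inv x) \<in> N"
      using assms e by (subst N_conj_iff) auto
    also have "inv x \<otimes> (x \<otimes> (e \<otimes> x \<otimes> inv e)) \<otimes> inv (inv x) = e \<otimes> x \<otimes> inv e \<otimes> inv (inv x)"
      using assms e by simp
    also have "\<dots> \<in> N \<longleftrightarrow> N #> (e \<otimes> x \<otimes> inv e) = N #> inv x"
      using assms e by (simp add: coset_eq_iff del: inv_inv)
    finally show ?thesis using assms e by (simp add: conj_elem_FactGroup[OF normal])
  qed
  thus ?thesis unfolding inverts_def i invt_def by (auto simp: extended_inertia_def)
qed

lemma conj_dual: "conj_character G (dual_character \<psi>) c = dual_character (conj_character G \<psi> c)"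
  by (auto simp: conj_character_def dual_character_def)

lemma dual_dual: "dual_character (dual_character \<psi>) = \<psi>"
  by (simp add: dual_character_def)

lemma coset_conj_mult:
  assumes "N #> (c \<otimes> g \<otimes> inv c) = N #> h" "N #> (d \<otimes> h \<otimes> inv d) = N #> k"
    "c \<in> carrier G" "d \<in> carrier G" "g \<in> carrier G" "h \<in> carrier G"
  shows "N #> ((d \<otimes> c) \<otimes> g \<otimes> inv (d \<otimes> c)) = N #> k"
proof -
  have "N #> (d \<otimes> (c \<otimes> g \<otimes> inv c) \<otimes> inv d) = N #> k"
    using coset_conj[OF assms(1) _ _ assms(4)] assms by simp
  thus ?thesis using assms by (simp add: m_assoc inv_mult_group)
qed

lemma coset_conj_inv:
  assumes "N #> (c \<otimes> g \<otimes> inv c) = N #> h" "c \<in> carrier G" "g \<in> carrier G" "h \<in> carrier G"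
  shows "N #> (inv c \<otimes> h \<otimes> inv (inv c)) = N #> g"
  using coset_conj_iff[of h g c] assms by simp

lemma coset_conj_of_inv:
  assumes "N #> (c \<otimes> g \<otimes> inv c) = N #> h" "c \<in> carrier G" "g \<in> carrier G" "h \<in> carrier G"
  shows "N #> (c \<otimes> inv g \<otimes> inv c) = N #> inv h"
proof -
  have "N #> inv (c \<otimes> g \<otimes> inv c) = N #> inv h"
    using assms normal.rcos_inv[OF normal, of "c \<otimes> g \<otimes> inv c"] normal.rcos_inv[OF normal, of h] by simp
  thus ?thesis using assms by (simp add: inv_mult_group m_assoc)
qed

lemma cen_subgroup:
  assumes g: "g \<in> carrier G"
  shows "subgroup (cen g) G"
proof (rule subgroupI)
  show "cen g \<noteq> {}" using subgroup.one_closed[OF inertia_subgroup] g by (auto simp: cen_def)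
  fix c assume c: "c \<in> cen g"
  hence cc: "c \<in> carrier G" by (simp add: cen_def inertia_carrier)
  show "inv c \<in> cen g"
    using c coset_conj_inv[OF _ cc g g] subgroup.m_inv_closed[OF inertia_subgroup] by (auto simp: cen_def)
  fix d assume d: "d \<in> cen g"
  hence dc: "d \<in> carrier G" by (simp add: cen_def inertia_carrier)
  show "c \<otimes> d \<in> cen g"
    using c d coset_conj_mult[OF _ _ dc cc g g] subgroup.m_closed[OF inertia_subgroup] by (auto simp: cen_def)
qed (auto simp: cen_def inertia_carrier)

text \<open>Inverting a coset and dualising a character are involutions, so two elements of
  \<open>invt g\<close> differ by one that fixes both N g and \<open>\<theta>\<close>.\<close>

lemma invt_bij:
  assumes g: "g \<in> carrier G" and e0: "e0 \<in> invt g"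
  shows "bij_betw (\<lambda>c. e0 \<otimes> c) (cen g) (invt g)"
proof (rule bij_betwI[where g = "\<lambda>e. inv e0 \<otimes> e"])
  have e0c: "e0 \<in> carrier G" and e0\<theta>: "conj_character G \<theta> e0 = dual_character \<theta>"
    and e0g: "N #> (e0 \<otimes> g \<otimes> inv e0) = N #> inv g"
    using e0 by (auto simp: invt_def)
  show "(\<lambda>c. e0 \<otimes> c) \<in> cen g \<rightarrow> invt g"
  proof
    fix c assume c: "c \<in> cen g"
    hence cc: "c \<in> carrier G" by (simp add: cen_def inertia_carrier)
    have "conj_character G \<theta> (e0 \<otimes> c) = dual_character \<theta>"
      using c cc e0c e0\<theta> by (simp add: conj_character_mult conj_dual cen_def inertia_def)
    thus "e0 \<otimes> c \<in> invt g"
      using c cc e0c coset_conj_mult[OF _ e0g cc e0c g g] by (simp add: invt_def cen_def)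
  qed
  show "(\<lambda>e. inv e0 \<otimes> e) \<in> invt g \<rightarrow> cen g"
  proof
    fix e assume "e \<in> invt g"
    hence ec: "e \<in> carrier G" and e\<theta>: "conj_character G \<theta> e = dual_character \<theta>"
      and eg: "N #> (e \<otimes> g \<otimes> inv e) = N #> inv g" by (auto simp: invt_def)
    have "conj_character G (dual_character \<theta>) (inv e0) = conj_character G \<theta> (e0 \<otimes> inv e0)"
      using e0c e0\<theta> by (simp only: conj_character_mult inv_closed)
    hence "conj_character G (dual_character \<theta>) (inv e0) = \<theta>" using e0c by (simp add: conj_theta_one)
    hence "dual_character (conj_character G \<theta> (inv e0)) = \<theta>" by (simp add: conj_dual)
    hence "conj_character G \<theta> (inv e0) = dual_character \<theta>" by (metis dual_dual)
    hence "conj_character G \<theta> (inv e0 \<otimes> e) = dual_character (dual_character \<theta>)"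
      using ec e0c e\<theta> by (simp add: conj_character_mult conj_dual)
    hence "inv e0 \<otimes> e \<in> inertia G \<theta>" using ec e0c by (simp add: inertia_def dual_dual)
    moreover have "N #> ((inv e0 \<otimes> e) \<otimes> g \<otimes> inv (inv e0 \<otimes> e)) = N #> g"
      using coset_conj_mult[OF eg _ ec inv_closed[OF e0c] g inv_closed[OF g]] coset_conj_inv[OF e0g e0c g] g by simp
    ultimately show "inv e0 \<otimes> e \<in> cen g" by (simp add: cen_def)
  qed
qed (use g e0 in \<open>auto simp: cen_def invt_def inertia_carrier\<close>)

text \<open>Elements that are not good are merged with those of type 0, since both contribute
  nothing to the sums below.\<close>

definition weight :: "'a \<Rightarrow> int" where
  "weight g = (if good G N \<theta> g then sigma G N \<theta> g else 0)"

text \<open>Here \<open>\<mu>\<close> compares the dual of \<open>\<psi>\<^sup>e\<close> with \<open>\<psi>\<close> on the coset \<open>N g\<close>; applying \<open>e\<close> twice gives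
  \<open>\<mu>\<^sup>2 = 1\<close>.\<close>

lemma sign_square:
  assumes g: "g \<in> carrier G" and e: "e \<in> invt g" and v: "v \<in> N" and nz: "\<psi> (v \<otimes> g) \<noteq> 0"
    and \<mu>: "\<And>n i. n \<in> N \<Longrightarrow> cnj (\<psi> (e \<otimes> (n \<otimes> g [^] (i::nat)) \<otimes> inv e)) = \<mu> ^ i * \<psi> (n \<otimes> g [^] i)"
    and fixed: "\<psi> (e \<otimes> e \<otimes> (v \<otimes> g) \<otimes> inv (e \<otimes> e)) = \<psi> (v \<otimes> g)" and one: "\<psi> \<one> \<noteq> 0" "cnj (\<psi> \<one>) = \<psi> \<one>"
  shows "\<mu> = 1 \<or> \<mu> = - 1"
proof -
  have ec: "e \<in> carrier G" and eg: "N #> (e \<otimes> g \<otimes> inv e) = N #> inv g" using e by (auto simp: invt_def)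
  \<comment> \<open>With g^-1 written as a power of \<open>g\<close>, the assumption on
    \<open>\<mu>\<close> can also be applied on N g^-1, where its exponent is
    \<open>o'\<close>.\<close>
  obtain o' where o: "inv g = g [^] (o' :: nat)" "g [^] Suc o' = \<one>" using pow_inverse[OF g] by metis
  let ?h = "v \<otimes> g" and ?y = "e \<otimes> (v \<otimes> g) \<otimes> inv e"
  have h: "?h \<in> carrier G" using v g N_carrier by simp
  have "N #> ?h = N #> g" by (rule coset_eqI[OF v g])
  from coset_conj[OF this h g ec] eg have "N #> ?y = N #> inv g" by simp
  then obtain n where n: "n \<in> N" "?y = n \<otimes> g [^] o'" using coset_eqE[of ?y "inv g"] ec h g o by auto
  have "\<psi> (e \<otimes> ?y \<otimes> inv e) = \<psi> ?h" using fixed ec h by (simp add: m_assoc inv_mult_group)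
  hence 1: "cnj (\<psi> ?h) = \<mu> ^ o' * \<psi> ?y" using \<mu>[OF n(1), of o'] n(2) by simp
  have "cnj (\<psi> ?y) = \<mu> * \<psi> ?h" using \<mu>[OF v, of 1] g by simp
  hence 2: "\<psi> ?y = cnj \<mu> * cnj (\<psi> ?h)" by (metis complex_cnj_cnj complex_cnj_mult)
  have "cnj (\<psi> ?h) = \<mu> ^ o' * cnj \<mu> * cnj (\<psi> ?h)" using 1 unfolding 2 by simp
  hence a: "\<mu> ^ o' * cnj \<mu> = 1" using nz by simp
  \<comment> \<open>The identity is the power \<open>Suc o'\<close> of \<open>g\<close>, so
    evaluating there makes \<open>\<mu>\<close> a root of unity. Compared with \<open>a\<close>, it
    also makes \<open>\<mu>\<close> real.\<close>
  have "cnj (\<psi> \<one>) = \<mu> ^ Suc o' * \<psi> \<one>"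
    using \<mu>[OF subgroup.one_closed[OF N_subgroup], of "Suc o'"] o(2) ec by simp
  hence b: "\<mu> ^ o' * \<mu> = 1" using one by (simp add: mult.commute)
  moreover have "\<mu> ^ o' \<noteq> 0" using a by auto
  ultimately have "cnj \<mu> = \<mu>" using a mult_left_cancel[of "\<mu> ^ o'" "cnj \<mu>" \<mu>] by simp
  moreover have "cmod \<mu> = 1"
  proof -
    have "cmod \<mu> ^ Suc o' = cmod (\<mu> ^ o' * \<mu>)" by (simp add: norm_mult norm_power mult.commute)
    hence "cmod \<mu> ^ Suc o' = 1" by (simp only: b norm_one)
    thus ?thesis using power_eq_imp_eq_base[of "cmod \<mu>" "Suc o'" 1] by simp
  qed
  ultimately have "\<mu> * \<mu> = 1" using complex_norm_square[of \<mu>] by simp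
  thus ?thesis by (simp only: square_eq_1_iff)
qed

text \<open>The inner sum is a pairing on N g of \<open>\<psi>\<close> with the dual of its
  conjugate by c. It vanishes unless both extend \<open>\<theta>\<close>, that is, unless c lies in
  \<open>invt g\<close>; otherwise it is |N| times the conjugate of \<open>\<mu> c\<close>. As
  \<open>invt g\<close> is empty or a coset of \<open>cen g\<close>, along which
  \<open>\<mu>\<close> changes by the linear character \<open>lam\<close>, a character sum over
  \<open>cen g\<close> remains.\<close>

lemma twisted_sum:
  assumes g: "g \<in> inertia G \<theta>"
  defines "\<psi> \<equiv> chosen_extension G N \<theta> g"
  shows "(\<Sum>c | c \<in> carrier G \<and> N #> (c \<otimes> g \<otimes> inv c) = N #> inv g.
      \<Sum>u\<in>N. \<psi> (c \<otimes> (u \<otimes> g) \<otimes> inv c) * \<psi> (u \<otimes> g))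
    = of_nat (card N) * of_nat (card (cen g)) * of_int (weight g)"
proof -
  have gc: "g \<in> carrier G" using g by (rule inertia_carrier)
  let ?H = "cyc g" and ?A = "{c. c \<in> carrier G \<and> N #> (c \<otimes> g \<otimes> inv c) = N #> inv g}"
  have H: "subgroup ?H G" "N \<subseteq> ?H" using cyc_subgroup[OF gc] N_cyc[OF gc] by auto
  interpret H: fin_group "G\<lparr>carrier := ?H\<rparr>" by (rule subgroup_fin_group[OF H(1)])
  have e: "extends ?H \<psi> \<theta>" unfolding \<psi>_def by (rule chosen_extends[OF g])
  have gH: "g \<in> ?H" "inv g \<in> ?H" using x_cyc[OF gc] subgroup.m_inv_closed[OF H(1)] by auto
  have cosetH: "a \<in> ?H" if ab: "N #> a = N #> b" "a \<in> carrier G" "b \<in> carrier G" "b \<in> ?H" for a b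
  proof -
    obtain u where "u \<in> N" "a = u \<otimes> b" using ab(1-3) by (rule coset_eqE)
    thus ?thesis using subgroup.m_closed[OF H(1)] H(2) ab(4) by auto
  qed
  have AH: "c \<otimes> g \<otimes> inv c \<in> ?H" if "c \<in> ?A" for c
    using cosetH[of "c \<otimes> g \<otimes> inv c" "inv g"] that gc gH by auto
  have CH: "c \<otimes> g \<otimes> inv c \<in> ?H" "c \<in> carrier G" if "c \<in> cen g" for c
    using cosetH[of "c \<otimes> g \<otimes> inv c" g] that gc gH by (auto simp: cen_def inertia_carrier)
  have ng: "n \<otimes> g [^] (i::nat) \<in> carrier G" if "n \<in> N" for n i using that gc N_carrier by simp
  have ext_dual: "extends ?H (dual_character (conj_character G \<psi> c)) (dual_character (conj_character G \<theta> c))"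
    if c: "c \<in> ?A" for c
    using c by (intro extends_dual[OF gc] extends_conj[OF gc _ AH[OF c] e]) simp
  have coset_norm: "(\<Sum>u\<in>N. \<psi> (u \<otimes> g) * cnj (\<psi> (u \<otimes> g))) = of_nat (card N)"
    by (rule extends_coset_sum(2)[OF H theta theta e e gH(1)]) simp
  \<comment> \<open>The squared values of \<open>\<psi>\<close> on N g add up to |N|, so
    \<open>\<psi>\<close> does not vanish there identically. Any nonzero value determines the
    scalars \<open>lam\<close> and \<open>\<mu>\<close>.\<close>
  have "\<exists>v\<in>N. \<psi> (v \<otimes> g) \<noteq> 0"
  proof (rule ccontr)
    assume "\<not> ?thesis"
    hence "(\<Sum>u\<in>N. \<psi> (u \<otimes> g) * cnj (\<psi> (u \<otimes> g))) = 0" by (intro sum.neutral) auto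
    thus False using coset_norm card_N_pos by simp
  qed
  then obtain v where v: "v \<in> N" "\<psi> (v \<otimes> g) \<noteq> 0" by blast
  have vg: "v \<otimes> g \<in> carrier G" using v gc N_carrier by simp
  have zero: "(\<Sum>u\<in>N. \<psi> (c \<otimes> (u \<otimes> g) \<otimes> inv c) * \<psi> (u \<otimes> g)) = 0" if c: "c \<in> ?A - invt g" for c
  proof -
    have cc: "c \<in> carrier G" "c \<in> ?A" using c by auto
    have "conj_character G \<theta> c \<noteq> dual_character \<theta>" using c by (auto simp: invt_def)
    hence ne: "\<theta> \<noteq> dual_character (conj_character G \<theta> c)" by (metis dual_dual)
    have "(\<Sum>u\<in>N. \<psi> (u \<otimes> g) * cnj (dual_character (conj_character G \<psi> c) (u \<otimes> g))) = 0"
      by (rule extends_coset_sum(1)[OF H theta S.Irr_dual[OF conj_theta_Irr[OF cc(1)]] e ext_dual[OF cc(2)] gH(1) ne])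
    moreover have "\<psi> (u \<otimes> g) * cnj (dual_character (conj_character G \<psi> c) (u \<otimes> g))
        = \<psi> (c \<otimes> (u \<otimes> g) \<otimes> inv c) * \<psi> (u \<otimes> g)" if "u \<in> N" for u
      using ng[OF that, of 1] gc by (simp add: dual_character_def conj_character_def)
    ultimately show ?thesis by (simp cong: sum.cong)
  qed
  have "\<exists>m. \<forall>n\<in>N. \<forall>i::nat. cnj (\<psi> (e' \<otimes> (n \<otimes> g [^] i) \<otimes> inv e')) = m ^ i * \<psi> (n \<otimes> g [^] i)"
    if e': "e' \<in> invt g" for e'
  proof -
    have "extends ?H (dual_character (conj_character G \<psi> e')) \<theta>"
      using ext_dual[of e'] e' by (simp add: invt_def dual_dual)
    from extends_unique[OF gc e this] obtain m where
      "\<forall>n\<in>N. \<forall>i::nat. dual_character (conj_character G \<psi> e') (n \<otimes> g [^] i) = m ^ i * \<psi> (n \<otimes> g [^] i)" by blast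
    thus ?thesis using ng by (intro exI[of _ m]) (simp add: dual_character_def conj_character_def)
  qed
  \<comment> \<open>All powers i are recorded because \<open>good\<close> and \<open>sigma\<close>
    compare characters on the whole of \<open>cyc g\<close>, not only on N g.\<close>
  then obtain \<mu> where \<mu>: "\<And>e' n i. e' \<in> invt g \<Longrightarrow> n \<in> N \<Longrightarrow>
      cnj (\<psi> (e' \<otimes> (n \<otimes> g [^] (i::nat)) \<otimes> inv e')) = \<mu> e' ^ i * \<psi> (n \<otimes> g [^] i)" by metis
  have \<mu>1: "\<psi> (e' \<otimes> (n \<otimes> g) \<otimes> inv e') = cnj (\<mu> e') * cnj (\<psi> (n \<otimes> g))"
    if "e' \<in> invt g" "n \<in> N" for e' n
    using arg_cong[OF \<mu>[OF that, of 1], of cnj] gc by simp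
  have "\<exists>m. \<forall>n\<in>N. \<forall>i::nat. \<psi> (c \<otimes> (n \<otimes> g [^] i) \<otimes> inv c) = m ^ i * \<psi> (n \<otimes> g [^] i)"
    if c: "c \<in> cen g" for c
  proof -
    have "conj_character G \<theta> c = \<theta>" using c by (simp add: cen_def inertia_def)
    hence "extends ?H (conj_character G \<psi> c) \<theta>"
      using extends_conj[OF gc CH(2)[OF c] CH(1)[OF c] e] by simp
    from extends_unique[OF gc e this] obtain m where
      "\<forall>n\<in>N. \<forall>i::nat. conj_character G \<psi> c (n \<otimes> g [^] i) = m ^ i * \<psi> (n \<otimes> g [^] i)" by blast
    thus ?thesis using ng by (intro exI[of _ m]) (simp add: conj_character_def)
  qed
  then obtain lam where lam_pow: "\<And>c n i. c \<in> cen g \<Longrightarrow> n \<in> N \<Longrightarrow>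
      \<psi> (c \<otimes> (n \<otimes> g [^] (i::nat)) \<otimes> inv c) = lam c ^ i * \<psi> (n \<otimes> g [^] i)" by metis
  have lam_one: "\<psi> (c \<otimes> (n \<otimes> g) \<otimes> inv c) = lam c * \<psi> (n \<otimes> g)" if "c \<in> cen g" "n \<in> N" for c n
    using lam_pow[OF that, of 1] gc by simp
  \<comment> \<open>A centralising element keeps \<open>v \<otimes> g\<close> in N g, where the same
    scalars apply again. This gives the multiplicativity of \<open>lam\<close> and the rule for
    \<open>\<mu>\<close> on products.\<close>
  have shift: "\<exists>n\<in>N. c \<otimes> (v \<otimes> g) \<otimes> inv c = n \<otimes> g" if c: "c \<in> cen g" for c
  proof -
    have "N #> (c \<otimes> (v \<otimes> g) \<otimes> inv c) = N #> (c \<otimes> g \<otimes> inv c)"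
      by (rule coset_conj[OF coset_eqI[OF v(1) gc] vg gc CH(2)[OF c]])
    also have "\<dots> = N #> g" using c by (simp add: cen_def)
    finally show ?thesis using coset_eqE[of "c \<otimes> (v \<otimes> g) \<otimes> inv c" g] CH(2)[OF c] vg gc by (metis inv_closed m_closed)
  qed
  have assoc: "(d \<otimes> c) \<otimes> (v \<otimes> g) \<otimes> inv (d \<otimes> c) = d \<otimes> (c \<otimes> (v \<otimes> g) \<otimes> inv c) \<otimes> inv d"
    if "c \<in> carrier G" "d \<in> carrier G" for c d
    using that vg by (simp add: m_assoc inv_mult_group)
  have lam_mult: "lam (d \<otimes> c) = lam d * lam c" if c: "c \<in> cen g" and d: "d \<in> cen g" for c d
  proof -
    have dc: "d \<otimes> c \<in> cen g" by (rule subgroup.m_closed[OF cen_subgroup[OF gc] d c])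
    obtain n where n: "n \<in> N" "c \<otimes> (v \<otimes> g) \<otimes> inv c = n \<otimes> g" using shift[OF c] by blast
    have "lam (d \<otimes> c) * \<psi> (v \<otimes> g) = \<psi> (d \<otimes> (n \<otimes> g) \<otimes> inv d)"
      using lam_one[OF dc v(1)] assoc[OF CH(2)[OF c] CH(2)[OF d]] n(2) by simp
    also have "\<dots> = lam d * (lam c * \<psi> (v \<otimes> g))" using lam_one[OF d n(1)] lam_one[OF c v(1)] n(2) by simp
    finally show ?thesis using v(2) by simp
  qed
  have \<mu>_mult: "\<mu> (e' \<otimes> c) = \<mu> e' * lam c" if c: "c \<in> cen g" and e': "e' \<in> invt g" for c e'
  proof -
    have ec: "e' \<otimes> c \<in> invt g" using invt_bij[OF gc e'] c by (auto simp: bij_betw_def)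
    have e'c: "e' \<in> carrier G" using e' by (simp add: invt_def)
    obtain n where n: "n \<in> N" "c \<otimes> (v \<otimes> g) \<otimes> inv c = n \<otimes> g" using shift[OF c] by blast
    have "cnj (\<mu> (e' \<otimes> c)) * cnj (\<psi> (v \<otimes> g)) = \<psi> (e' \<otimes> (n \<otimes> g) \<otimes> inv e')"
      using \<mu>1[OF ec v(1)] assoc[OF CH(2)[OF c] e'c] n(2) by simp
    also have "\<dots> = cnj (\<mu> e') * cnj (lam c * \<psi> (v \<otimes> g))" using \<mu>1[OF e' n(1)] lam_one[OF c v(1)] n(2) by simp
    finally have "cnj (\<mu> (e' \<otimes> c)) = cnj (\<mu> e' * lam c)" using v(2) by simp
    thus ?thesis by (metis complex_cnj_cancel_iff)
  qed
  \<comment> \<open>Both characters vanish outside \<open>cyc g\<close>, so it is enough to compare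
    them at the elements n g^i.\<close>
  have conj_eqI: "conj_character G \<psi> c = \<phi>"
    if c: "c \<in> carrier G" "c \<otimes> g \<otimes> inv c \<in> ?H" and out: "\<And>h. h \<notin> ?H \<Longrightarrow> \<phi> h = 0"
      and eq: "\<And>n i. n \<in> N \<Longrightarrow> \<psi> (c \<otimes> (n \<otimes> g [^] (i::nat)) \<otimes> inv c) = \<phi> (n \<otimes> g [^] i)" for c \<phi>
  proof
    fix h
    show "conj_character G \<psi> c h = \<phi> h"
    proof (cases "h \<in> ?H")
      case True
      then obtain n i where "n \<in> N" "h = n \<otimes> g [^] (i::nat)" using mem_cyc[OF gc] by auto
      thus ?thesis using eq ng by (simp add: conj_character_def)
    next
      case False
      hence "c \<otimes> h \<otimes> inv c \<notin> ?H" if "h \<in> carrier G"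
        using cyc_conj(2)[OF gc c, of "c \<otimes> h \<otimes> inv c"] conj_cancel(1)[OF c(1) that] by auto
      thus ?thesis using False out H.rep_char_outside[OF H.Irr_rep_char, of \<psi>] e
        by (simp add: conj_character_def extends_def)
    qed
  qed
  have \<psi>_out: "\<psi> h = 0" if "h \<notin> ?H" for h
    using that H.rep_char_outside[OF H.Irr_rep_char, of \<psi>] e by (simp add: extends_def)
  have good: "good G N \<theta> g \<longleftrightarrow> (\<forall>c\<in>cen g. lam c = 1)"
    unfolding good_iff[OF gc] \<psi>_def[symmetric]
  proof (intro ball_cong refl)
    fix c assume c: "c \<in> cen g"
    show "conj_character G \<psi> c = \<psi> \<longleftrightarrow> lam c = 1"
    proof
      assume "conj_character G \<psi> c = \<psi>"
      hence "\<psi> (c \<otimes> (v \<otimes> g) \<otimes> inv c) = \<psi> (v \<otimes> g)" using vg by (metis conj_character_def)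
      thus "lam c = 1" using lam_one[OF c v(1)] v(2) by simp
    next
      assume "lam c = 1"
      thus "conj_character G \<psi> c = \<psi>" using CH[OF c] lam_pow[OF c] \<psi>_out by (intro conj_eqI) auto
    qed
  qed
  have "(\<Sum>c\<in>?A. \<Sum>u\<in>N. \<psi> (c \<otimes> (u \<otimes> g) \<otimes> inv c) * \<psi> (u \<otimes> g))
      = (\<Sum>e'\<in>invt g. \<Sum>u\<in>N. \<psi> (e' \<otimes> (u \<otimes> g) \<otimes> inv e') * \<psi> (u \<otimes> g))"
  proof (rule sum.mono_neutral_right)
    show "finite ?A" using finite_carrier by simp
    show "invt g \<subseteq> ?A" by (auto simp: invt_def)
    show "\<forall>c\<in>?A - invt g. (\<Sum>u\<in>N. \<psi> (c \<otimes> (u \<otimes> g) \<otimes> inv c) * \<psi> (u \<otimes> g)) = 0" using zero by blast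
  qed
  also have "\<dots> = (\<Sum>e'\<in>invt g. of_nat (card N) * cnj (\<mu> e'))"
  proof (rule sum.cong[OF refl])
    fix e' assume e': "e' \<in> invt g"
    have "(\<Sum>u\<in>N. \<psi> (e' \<otimes> (u \<otimes> g) \<otimes> inv e') * \<psi> (u \<otimes> g))
        = (\<Sum>u\<in>N. cnj (\<mu> e') * (\<psi> (u \<otimes> g) * cnj (\<psi> (u \<otimes> g))))"
      by (intro sum.cong refl) (simp add: \<mu>1[OF e'])
    also have "\<dots> = cnj (\<mu> e') * of_nat (card N)" by (simp only: sum_distrib_left[symmetric] coset_norm)
    finally show "(\<Sum>u\<in>N. \<psi> (e' \<otimes> (u \<otimes> g) \<otimes> inv e') * \<psi> (u \<otimes> g)) = of_nat (card N) * cnj (\<mu> e')" by simp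
  qed
  \<comment> \<open>The conjugation disappears at the end because the sum turns out to be an
    integer.\<close>
  also have "\<dots> = of_nat (card N) * cnj (\<Sum>e'\<in>invt g. \<mu> e')" by (simp add: sum_distrib_left)
  also have "(\<Sum>e'\<in>invt g. \<mu> e') = of_nat (card (cen g)) * of_int (weight g)"
  proof (cases "\<exists>e'. inverts G N \<theta> g e'")
    case False
    hence "invt g = {}" using inverts_iff[OF gc] by blast
    moreover have "weight g = 0" using False by (simp add: weight_def sigma_def)
    ultimately show ?thesis by simp
  next
    case True
    define e0 where "e0 = (SOME e'. inverts G N \<theta> g e')"
    have "inverts G N \<theta> g e0" unfolding e0_def by (rule someI_ex[OF True])
    hence e0: "e0 \<in> invt g" using inverts_iff[OF gc] by simp
    hence e0c: "e0 \<in> carrier G" "e0 \<in> ?A" by (auto simp: invt_def)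
    have sigma: "sigma G N \<theta> g = (if conj_character G \<psi> e0 = dual_character \<psi> then 1 else - 1)"
      using True by (simp add: sigma_def e0_def \<psi>_def Let_def)
    have sum: "(\<Sum>e'\<in>invt g. \<mu> e') = \<mu> e0 * (\<Sum>c\<in>cen g. lam c)"
      using sum.reindex_bij_betw[OF invt_bij[OF gc e0], of \<mu>] e0
      by (simp add: \<mu>_mult sum_distrib_left)
    show ?thesis
    proof (cases "good G N \<theta> g")
      case False
      then obtain d where d: "d \<in> cen g" "lam d \<noteq> 1" using good by blast
      have dc: "d \<in> carrier G" using CH(2)[OF d(1)] .
      note cm = subgroup.m_closed[OF cen_subgroup[OF gc]] subgroup.m_inv_closed[OF cen_subgroup[OF gc]]
      \<comment> \<open>Translation by \<open>d\<close> multiplies the sum of \<open>lam\<close> by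
        \<open>lam d\<close>, which is not 1, so the sum is zero.\<close>
      have "bij_betw (\<lambda>c. d \<otimes> c) (cen g) (cen g)"
        using d(1) dc cm CH(2) by (intro bij_betwI[where g = "\<lambda>c. inv d \<otimes> c"]) auto
      from sum.reindex_bij_betw[OF this, of lam] have "(\<Sum>c\<in>cen g. lam c) = lam d * (\<Sum>c\<in>cen g. lam c)"
        using d(1) by (simp add: lam_mult sum_distrib_left)
      hence "(\<Sum>c\<in>cen g. lam c) = 0" using d(2) by simp
      thus ?thesis using False sum by (simp add: weight_def)
    next
      case True
      hence "(\<Sum>c\<in>cen g. lam c) = of_nat (card (cen g))" using good by simp
      moreover have "\<mu> e0 = of_int (sigma G N \<theta> g)"
      proof -
        \<comment> \<open>The square of an inverting element centralises N g and fixes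
          \<open>\<theta>\<close>. For good \<open>g\<close> it therefore fixes
          \<open>\<psi>\<close>, as \<open>sign_square\<close> demands.\<close>
        have sq: "e0 \<otimes> e0 \<in> cen g"
        proof -
          have e0\<theta>: "conj_character G \<theta> e0 = dual_character \<theta>" and e0g: "N #> (e0 \<otimes> g \<otimes> inv e0) = N #> inv g"
            using e0 by (auto simp: invt_def)
          have "conj_character G \<theta> (e0 \<otimes> e0) = \<theta>"
            using e0c e0\<theta> by (simp add: conj_character_mult conj_dual dual_dual)
          moreover have "N #> (e0 \<otimes> inv g \<otimes> inv e0) = N #> g"
            using coset_conj_of_inv[OF e0g e0c(1) gc inv_closed[OF gc]] gc by simp
          hence "N #> ((e0 \<otimes> e0) \<otimes> g \<otimes> inv (e0 \<otimes> e0)) = N #> g"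
            by (rule coset_conj_mult[OF e0g _ e0c(1) e0c(1) gc inv_closed[OF gc]])
          ultimately show ?thesis using e0c(1) by (simp add: cen_def inertia_def)
        qed
        have fixed: "\<psi> (e0 \<otimes> e0 \<otimes> (v \<otimes> g) \<otimes> inv (e0 \<otimes> e0)) = \<psi> (v \<otimes> g)"
          using lam_one[OF sq v(1)] sq True good by simp
        have one: "\<psi> \<one> = \<theta> \<one>" using e subgroup.one_closed[OF N_subgroup] by (simp add: extends_def)
        have pm: "\<mu> e0 = 1 \<or> \<mu> e0 = - 1"
          by (rule sign_square[of g e0 v \<psi> "\<mu> e0", OF gc e0 v \<mu>[OF e0] fixed])
            (use one theta_one S.Irr_one_cnj[OF theta] in auto)
        have "conj_character G \<psi> e0 = dual_character \<psi> \<longleftrightarrow> \<mu> e0 = 1"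
        proof
          assume "conj_character G \<psi> e0 = dual_character \<psi>"
          hence "\<psi> (e0 \<otimes> (v \<otimes> g) \<otimes> inv e0) = cnj (\<psi> (v \<otimes> g))"
            using vg by (metis conj_character_def dual_character_def)
          hence "cnj (\<mu> e0) = 1" using \<mu>1[OF e0 v(1)] v(2) by simp
          thus "\<mu> e0 = 1" by (metis complex_cnj_cancel_iff complex_cnj_one)
        next
          assume 1: "\<mu> e0 = 1"
          show "conj_character G \<psi> e0 = dual_character \<psi>"
          proof (rule conj_eqI[OF e0c(1) AH[OF e0c(2)]])
            fix n and i :: nat assume "n \<in> N"
            from arg_cong[OF \<mu>[OF e0 this, of i], of cnj] 1
            show "\<psi> (e0 \<otimes> (n \<otimes> g [^] i) \<otimes> inv e0) = dual_character \<psi> (n \<otimes> g [^] i)"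
              by (simp add: dual_character_def)
          qed (simp add: dual_character_def \<psi>_out)
        qed
        thus ?thesis using pm sigma by auto
      qed
      ultimately show ?thesis using True sum by (simp add: weight_def)
    qed
  qed
  finally show ?thesis by simp
qed

section \<open>Sums of values of theta, evaluated coset by coset\<close>

definition csum :: "'a \<Rightarrow> complex" where
  "csum g = (\<Sum>c\<in>carrier G. \<theta> (c \<otimes> g \<otimes> inv c \<otimes> g))"

text \<open>For each n in \<open>N\<close> the product n c runs over \<open>G\<close> as c does. The
  extra sum over \<open>N\<close> is what Schur's lemma for \<open>\<theta>\<close> acts on.\<close>

lemma csum_average:
  "csum g = (\<Sum>c\<in>carrier G. \<Sum>n\<in>N. \<theta> (n \<otimes> (c \<otimes> g \<otimes> inv c) \<otimes> inv n \<otimes> g)) / of_nat (card N)"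
  if g: "g \<in> carrier G"
proof -
  have "(\<Sum>c\<in>carrier G. \<Sum>n\<in>N. \<theta> (n \<otimes> (c \<otimes> g \<otimes> inv c) \<otimes> inv n \<otimes> g))
      = (\<Sum>n\<in>N. \<Sum>c\<in>carrier G. \<theta> ((n \<otimes> c) \<otimes> g \<otimes> inv (n \<otimes> c) \<otimes> g))"
    using g N_carrier by (subst sum.swap, intro sum.cong refl) (simp add: m_assoc inv_mult_group)
  also have "\<dots> = (\<Sum>n\<in>N. csum g)"
  proof (rule sum.cong[OF refl])
    fix n assume "n \<in> N"
    from sum.reindex_bij_betw[OF bij_left_mult[OF N_carrier[OF this]], of "\<lambda>c. \<theta> (c \<otimes> g \<otimes> inv c \<otimes> g)"]
    show "(\<Sum>c\<in>carrier G. \<theta> ((n \<otimes> c) \<otimes> g \<otimes> inv (n \<otimes> c) \<otimes> g)) = csum g" by (simp add: csum_def)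
  qed
  finally show ?thesis using card_N_pos by simp
qed

text \<open>The factors n and n^-1 disappear modulo \<open>N\<close>, so an average over n has
  either all or none of its arguments in \<open>N\<close>.\<close>

lemma conj_term_mem_iff:
  assumes g: "g \<in> carrier G" and w: "w \<in> carrier G" and n: "n \<in> N"
  shows "n \<otimes> w \<otimes> inv n \<otimes> g \<in> N \<longleftrightarrow> w \<otimes> g \<in> N"
proof -
  have nc: "n \<in> carrier G" and ni: "inv n \<in> N" using n N_carrier subgroup.m_inv_closed[OF N_subgroup] by auto
  have eq: "n \<otimes> w \<otimes> inv n \<otimes> g = n \<otimes> (w \<otimes> g) \<otimes> (inv g \<otimes> inv n \<otimes> g)"
    using g w nc by (simp add: m_assoc)
  have k: "inv g \<otimes> inv n \<otimes> g \<in> N" by (rule N_conj(2)[OF g ni])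
  note cl = subgroup.m_closed[OF N_subgroup] subgroup.m_inv_closed[OF N_subgroup]
  show ?thesis
  proof
    assume "w \<otimes> g \<in> N"
    thus "n \<otimes> w \<otimes> inv n \<otimes> g \<in> N" unfolding eq using cl n k by simp
  next
    assume "n \<otimes> w \<otimes> inv n \<otimes> g \<in> N"
    hence "inv n \<otimes> (n \<otimes> (w \<otimes> g) \<otimes> (inv g \<otimes> inv n \<otimes> g)) \<otimes> inv (inv g \<otimes> inv n \<otimes> g) \<in> N"
      unfolding eq using cl ni k by simp
    moreover have "inv n \<otimes> (n \<otimes> (w \<otimes> g) \<otimes> (inv g \<otimes> inv n \<otimes> g)) \<otimes> inv (inv g \<otimes> inv n \<otimes> g) = w \<otimes> g"
      using g w nc by (simp add: m_assoc inv_mult_group)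
    ultimately show "w \<otimes> g \<in> N" by simp
  qed
qed

text \<open>Writing n w n^-1 g as n (w g) (g^-1 n^-1 g) exhibits the sum as an average between a
  representation affording \<open>\<theta>\<close> and its conjugate by g^-1. Outside the inertia
  group these are inequivalent.\<close>

lemma sum_conj_zero:
  assumes g: "g \<in> carrier G" "g \<notin> inertia G \<theta>" and w: "w \<in> carrier G" and wg: "w \<otimes> g \<in> N"
  shows "(\<Sum>n\<in>N. \<theta> (n \<otimes> w \<otimes> inv n \<otimes> g)) = 0"
proof -
  obtain d \<rho> where i: "irreducible_representation (G\<lparr>carrier := N\<rparr>) d \<rho>"
    and \<theta>: "\<theta> = afforded_character (G\<lparr>carrier := N\<rparr>) d \<rho>"
    using S.IrrE[OF theta] by metis
  note r = S.irr_rep[OF i] and c = S.rep_carrier[OF S.irr_rep[OF i]] and m = S.rep_mult[OF S.irr_rep[OF i]]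
  let ?g = "inv g" and ?\<sigma> = "\<lambda>h. \<rho> (inv g \<otimes> h \<otimes> inv (inv g))"
  have gi: "?g \<in> carrier G" using g by simp
  have r': "representation (G\<lparr>carrier := N\<rparr>) d ?\<sigma>"
    by (rule rep_conj[OF gi N_subgroup N_conj(1)[OF gi] r])
  have \<theta>': "afforded_character (G\<lparr>carrier := N\<rparr>) d ?\<sigma> = conj_character G \<theta> ?g"
  proof
    fix y
    show "afforded_character (G\<lparr>carrier := N\<rparr>) d ?\<sigma> y = conj_character G \<theta> ?g y"
    proof (cases "y \<in> N")
      case True
      have "afforded_character (G\<lparr>carrier := N\<rparr>) d ?\<sigma> y = mtrace (\<rho> (?g \<otimes> y \<otimes> inv ?g))"
        by (rule S.afforded_eq_mtrace[OF r' True])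
      also have "\<dots> = \<theta> (?g \<otimes> y \<otimes> inv ?g)"
        using S.afforded_eq_mtrace[OF r N_conj(1)[OF gi True]] \<theta> by metis
      finally show ?thesis using N_carrier[OF True] by (simp add: conj_character_def)
    next
      case False
      thus ?thesis using N_conj_iff[OF gi, of y] by (auto simp: conj_character_def afforded_character_def theta_outside)
    qed
  qed
  have i': "irreducible_representation (G\<lparr>carrier := N\<rparr>) d ?\<sigma>"
    using conj_theta_Irr[OF gi] \<theta>' by (intro S.afforded_Irr_irreducible[OF r']) simp
  have ne: "afforded_character (G\<lparr>carrier := N\<rparr>) d ?\<sigma> \<noteq> afforded_character (G\<lparr>carrier := N\<rparr>) d \<rho>"
  proof
    assume "afforded_character (G\<lparr>carrier := N\<rparr>) d ?\<sigma> = afforded_character (G\<lparr>carrier := N\<rparr>) d \<rho>"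
    hence "conj_character G \<theta> ?g = \<theta>" by (simp only: \<theta>' \<theta>[symmetric])
    hence "?g \<in> inertia G \<theta>" using gi by (simp add: inertia_def)
    hence "inv ?g \<in> inertia G \<theta>" by (rule subgroup.m_inv_closed[OF inertia_subgroup])
    thus False using g by simp
  qed
  have "(\<Sum>n\<in>N. \<theta> (n \<otimes> w \<otimes> inv n \<otimes> g))
      = (\<Sum>n\<in>N. mtrace (\<rho> n * \<rho> (w \<otimes> g) * ?\<sigma> (inv\<^bsub>G\<lparr>carrier := N\<rparr>\<^esub> n) * 1\<^sub>m d))"
  proof (rule sum.cong[OF refl])
    fix n assume n: "n \<in> N"
    have ni: "inv n \<in> N" by (rule subgroup.m_inv_closed[OF N_subgroup n])
    have k: "?g \<otimes> inv n \<otimes> inv ?g \<in> N" by (rule N_conj(1)[OF gi ni])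
    have nw: "n \<otimes> (w \<otimes> g) \<in> N" by (rule subgroup.m_closed[OF N_subgroup n wg])
    have eq: "n \<otimes> w \<otimes> inv n \<otimes> g = n \<otimes> (w \<otimes> g) \<otimes> (?g \<otimes> inv n \<otimes> inv ?g)"
      using g w N_carrier[OF n] by (simp add: m_assoc)
    have "\<theta> (n \<otimes> w \<otimes> inv n \<otimes> g) = mtrace (\<rho> (n \<otimes> (w \<otimes> g) \<otimes> (?g \<otimes> inv n \<otimes> inv ?g)))"
      unfolding eq using S.afforded_eq_mtrace[OF r subgroup.m_closed[OF N_subgroup nw k]] \<theta> by metis
    also have "\<rho> (n \<otimes> (w \<otimes> g) \<otimes> (?g \<otimes> inv n \<otimes> inv ?g)) = \<rho> n * \<rho> (w \<otimes> g) * ?\<sigma> (inv n)"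
      by (simp only: m[OF nw k] m[OF n wg])
    also have "\<dots> = \<rho> n * \<rho> (w \<otimes> g) * ?\<sigma> (inv n) * 1\<^sub>m d"
      by (rule right_mult_one_mat[symmetric, OF mult_carrier_mat[OF mult_carrier_mat[OF c[OF n] c[OF wg]] c[OF k]]])
    finally show "\<theta> (n \<otimes> w \<otimes> inv n \<otimes> g)
        = mtrace (\<rho> n * \<rho> (w \<otimes> g) * ?\<sigma> (inv\<^bsub>G\<lparr>carrier := N\<rparr>\<^esub> n) * 1\<^sub>m d)"
      by (simp only: sub_inv[OF N_subgroup n])
  qed
  also have "\<dots> = 0" by (rule S.sum_mtrace_conj_mult_zero[OF i' i c[OF wg] one_carrier_mat ne])
  finally show ?thesis .
qed

lemma csum_zero:
  assumes g: "g \<in> carrier G" "g \<notin> inertia G \<theta>"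
  shows "csum g = 0"
proof -
  have "(\<Sum>n\<in>N. \<theta> (n \<otimes> (c \<otimes> g \<otimes> inv c) \<otimes> inv n \<otimes> g)) = 0" if c: "c \<in> carrier G" for c
  proof (cases "c \<otimes> g \<otimes> inv c \<otimes> g \<in> N")
    case True
    thus ?thesis using sum_conj_zero[OF g, of "c \<otimes> g \<otimes> inv c"] g c by simp
  next
    case False
    thus ?thesis using conj_term_mem_iff[OF g(1), of "c \<otimes> g \<otimes> inv c"] g c
      by (intro sum.neutral) (auto intro!: theta_outside)
  qed
  thus ?thesis by (simp add: csum_average[OF g(1)])
qed

text \<open>The arguments at which \<open>\<theta>\<close> is nonzero lie in \<open>N\<close>, where
  \<open>\<psi>\<close> agrees with it. Unlike \<open>\<theta>\<close>, \<open>\<psi>\<close> has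
  meaningful values at the separate factors c h c^-1 and h, so the average over \<open>N\<close>
  splits into a product and \<open>twisted_sum\<close> finishes the computation.\<close>

lemma csum_coset:
  assumes g: "g \<in> inertia G \<theta>"
  shows "(\<Sum>u\<in>N. csum (u \<otimes> g)) = of_nat (card N) / \<theta> \<one> * of_nat (card (cen g)) * of_int (weight g)"
proof -
  have gc: "g \<in> carrier G" using g by (rule inertia_carrier)
  define \<psi> where "\<psi> = chosen_extension G N \<theta> g"
  let ?A = "{c. c \<in> carrier G \<and> N #> (c \<otimes> g \<otimes> inv c) = N #> inv g}"
  have H: "subgroup (cyc g) G" "N \<subseteq> cyc g" using cyc_subgroup[OF gc] N_cyc[OF gc] by auto
  have e: "extends (cyc g) \<psi> \<theta>" unfolding \<psi>_def by (rule chosen_extends[OF g])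
  have "csum (u \<otimes> g) = (\<Sum>c\<in>?A. \<psi> (c \<otimes> (u \<otimes> g) \<otimes> inv c) * \<psi> (u \<otimes> g)) / \<theta> \<one>" if u: "u \<in> N" for u
  proof -
    let ?h = "u \<otimes> g"
    have h: "?h \<in> carrier G" "?h \<in> cyc g"
      using u gc N_carrier subgroup.m_closed[OF H(1)] H(2) x_cyc[OF gc] by auto
    have mem: "c \<otimes> ?h \<otimes> inv c \<otimes> ?h \<in> N \<longleftrightarrow> c \<in> ?A" if c: "c \<in> carrier G" for c
    proof -
      have hg: "N #> ?h = N #> g" by (rule coset_eqI[OF u gc])
      have "c \<otimes> ?h \<otimes> inv c \<otimes> ?h \<in> N \<longleftrightarrow> N #> (c \<otimes> ?h \<otimes> inv c) = N #> inv ?h"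
        using coset_eq_iff[of "c \<otimes> ?h \<otimes> inv c" "inv ?h"] c h(1) by simp
      also have "N #> (c \<otimes> ?h \<otimes> inv c) = N #> (c \<otimes> g \<otimes> inv c)" by (rule coset_conj[OF hg h(1) gc c])
      also have "N #> inv ?h = N #> inv g"
        using hg normal.rcos_inv[OF normal h(1)] normal.rcos_inv[OF normal gc] by simp
      finally show ?thesis using c by simp
    qed
    have "(\<Sum>c\<in>carrier G. \<Sum>n\<in>N. \<theta> (n \<otimes> (c \<otimes> ?h \<otimes> inv c) \<otimes> inv n \<otimes> ?h))
        = (\<Sum>c\<in>?A. \<Sum>n\<in>N. \<theta> (n \<otimes> (c \<otimes> ?h \<otimes> inv c) \<otimes> inv n \<otimes> ?h))"
    proof (rule sum.mono_neutral_right[OF finite_carrier])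
      show "\<forall>c\<in>carrier G - ?A. (\<Sum>n\<in>N. \<theta> (n \<otimes> (c \<otimes> ?h \<otimes> inv c) \<otimes> inv n \<otimes> ?h)) = 0"
      proof (intro ballI sum.neutral)
        fix c n assume c: "c \<in> carrier G - ?A" and n: "n \<in> N"
        hence "c \<otimes> ?h \<otimes> inv c \<otimes> ?h \<notin> N" using mem by blast
        thus "\<theta> (n \<otimes> (c \<otimes> ?h \<otimes> inv c) \<otimes> inv n \<otimes> ?h) = 0"
          using conj_term_mem_iff[OF h(1) _ n, of "c \<otimes> ?h \<otimes> inv c"] c h(1) by (intro theta_outside) simp
      qed
    qed auto
    also have "\<dots> = (\<Sum>c\<in>?A. of_nat (card N) / \<theta> \<one> * \<psi> (c \<otimes> ?h \<otimes> inv c) * \<psi> ?h)"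
    proof (rule sum.cong[OF refl])
      fix c assume c: "c \<in> ?A"
      let ?w = "c \<otimes> ?h \<otimes> inv c"
      have w: "?w \<in> carrier G" "?w \<otimes> ?h \<in> N" using c h(1) mem[of c] by auto
      have "?w = (?w \<otimes> ?h) \<otimes> inv ?h" using w(1) h(1) by (simp add: m_assoc)
      hence wH: "?w \<in> cyc g"
        using w(2) H(2) subgroup.m_closed[OF H(1)] subgroup.m_inv_closed[OF H(1) h(2)] by (metis subsetD)
      have "(\<Sum>n\<in>N. \<theta> (n \<otimes> ?w \<otimes> inv n \<otimes> ?h)) = (\<Sum>n\<in>N. \<psi> (n \<otimes> ?w \<otimes> inv n \<otimes> ?h))"
        using e conj_term_mem_iff[OF h(1) w(1)] w(2) by (intro sum.cong refl) (simp add: extends_def)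
      also have "\<dots> = of_nat (card N) / \<theta> \<one> * \<psi> ?w * \<psi> ?h" by (rule extends_conj_sum[OF H e wH h(2)])
      finally show "(\<Sum>n\<in>N. \<theta> (n \<otimes> ?w \<otimes> inv n \<otimes> ?h)) = of_nat (card N) / \<theta> \<one> * \<psi> ?w * \<psi> ?h" .
    qed
    also have "\<dots> = of_nat (card N) / \<theta> \<one> * (\<Sum>c\<in>?A. \<psi> (c \<otimes> ?h \<otimes> inv c) * \<psi> ?h)"
      by (simp only: sum_distrib_left mult.assoc)
    finally show ?thesis unfolding csum_average[OF h(1)] using card_N_pos by simp
  qed
  hence "(\<Sum>u\<in>N. csum (u \<otimes> g)) = (\<Sum>u\<in>N. \<Sum>c\<in>?A. \<psi> (c \<otimes> (u \<otimes> g) \<otimes> inv c) * \<psi> (u \<otimes> g)) / \<theta> \<one>"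
    by (simp add: sum_divide_distrib)
  also have "\<dots> = (\<Sum>c\<in>?A. \<Sum>u\<in>N. \<psi> (c \<otimes> (u \<otimes> g) \<otimes> inv c) * \<psi> (u \<otimes> g)) / \<theta> \<one>"
    by (subst sum.swap) (rule refl)
  also have "\<dots> = of_nat (card N) * of_nat (card (cen g)) * of_int (weight g) / \<theta> \<one>"
    unfolding \<psi>_def twisted_sum[OF g] ..
  finally show ?thesis by simp
qed

lemma csum_conj:
  assumes t: "t \<in> inertia G \<theta>" and g: "g \<in> carrier G"
  shows "csum (t \<otimes> g \<otimes> inv t) = csum g"
proof -
  have tc: "t \<in> carrier G" using t by (rule inertia_carrier)
  let ?k = "\<lambda>y. t \<otimes> y \<otimes> inv t"
  have "csum (?k g) = (\<Sum>c\<in>carrier G. \<theta> (?k c \<otimes> ?k g \<otimes> inv (?k c) \<otimes> ?k g))"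
    unfolding csum_def using tc by (intro sum.reindex_bij_betw[OF bij_conj, symmetric]) auto
  also have "\<dots> = (\<Sum>c\<in>carrier G. \<theta> (?k (c \<otimes> g \<otimes> inv c \<otimes> g)))"
    using tc g by (intro sum.cong refl arg_cong[where f = \<theta>]) (simp add: m_assoc inv_mult_group)
  also have "\<dots> = csum g" unfolding csum_def using g by (intro sum.cong refl theta_inertia[OF t]) auto
  finally show ?thesis .
qed

text \<open>Changing the representative of a coset only shifts u, and conjugation by
  \<open>t\<close> permutes \<open>N\<close> while preserving \<open>csum\<close>.\<close>

lemma csum_coset_conj:
  assumes t: "t \<in> inertia G \<theta>" and g: "g \<in> carrier G" and x: "x \<in> carrier G"
    and eq: "N #> (t \<otimes> g \<otimes> inv t) = N #> x"
  shows "(\<Sum>u\<in>N. csum (u \<otimes> x)) = (\<Sum>u\<in>N. csum (u \<otimes> g))"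
proof -
  have tc: "t \<in> carrier G" using t by (rule inertia_carrier)
  let ?y = "t \<otimes> g \<otimes> inv t"
  have y: "?y \<in> carrier G" using tc g by simp
  obtain v where v: "v \<in> N" "x = v \<otimes> ?y" using coset_eqE[OF eq[symmetric] x y] by metis
  have "(\<Sum>u\<in>N. csum (u \<otimes> x)) = (\<Sum>u\<in>N. csum ((u \<otimes> v) \<otimes> ?y))"
    unfolding v(2) using v(1) N_carrier y by (intro sum.cong refl) (simp add: m_assoc)
  also have "\<dots> = (\<Sum>u\<in>N. csum (u \<otimes> ?y))"
    by (rule sum.reindex_bij_betw[OF S.bij_right_mult[OF v(1)]])
  also have "\<dots> = (\<Sum>u\<in>N. csum ((t \<otimes> u \<otimes> inv t) \<otimes> ?y))"
    using subgroup.subset[OF N_subgroup]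
    by (intro sum.reindex_bij_betw[OF bij_conj[OF tc], symmetric] N_conj[OF tc])
  also have "\<dots> = (\<Sum>u\<in>N. csum (t \<otimes> (u \<otimes> g) \<otimes> inv t))"
    using tc g N_carrier by (intro sum.cong refl arg_cong[where f = csum]) (simp add: m_assoc)
  also have "\<dots> = (\<Sum>u\<in>N. csum (u \<otimes> g))"
    using g N_carrier by (intro sum.cong refl csum_conj[OF t]) auto
  finally show ?thesis .
qed

text \<open>The transporter from N g to N x is a left coset of \<open>cen g\<close> and a right
  coset of \<open>cen x\<close>.\<close>

lemma card_cen_transporter:
  assumes g: "g \<in> carrier G" and x: "x \<in> carrier G" and t: "t \<in> inertia G \<theta>"
    and eq: "N #> (t \<otimes> g \<otimes> inv t) = N #> x"
  shows "card {s \<in> inertia G \<theta>. N #> (s \<otimes> g \<otimes> inv s) = N #> x} = card (cen g)"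
    and "card {s \<in> inertia G \<theta>. N #> (s \<otimes> g \<otimes> inv s) = N #> x} = card (cen x)"
proof -
  let ?P = "{s \<in> inertia G \<theta>. N #> (s \<otimes> g \<otimes> inv s) = N #> x}"
  have tc: "t \<in> carrier G" using t by (rule inertia_carrier)
  have eq': "N #> (inv t \<otimes> x \<otimes> inv (inv t)) = N #> g" by (rule coset_conj_inv[OF eq tc g x])
  note cl = subgroup.m_closed[OF inertia_subgroup] subgroup.m_inv_closed[OF inertia_subgroup]
  have "bij_betw (\<lambda>c. t \<otimes> c) (cen g) ?P"
  proof (rule bij_betwI[where g = "\<lambda>s. inv t \<otimes> s"])
    show "(\<lambda>c. t \<otimes> c) \<in> cen g \<rightarrow> ?P"
      using coset_conj_mult[OF _ eq _ tc g g] cl(1)[OF t] by (auto simp: cen_def inertia_carrier)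
    show "(\<lambda>s. inv t \<otimes> s) \<in> ?P \<rightarrow> cen g"
      using coset_conj_mult[OF _ eq' _ inv_closed[OF tc] g x] cl(1)[OF cl(2)[OF t]]
      by (auto simp: cen_def inertia_carrier)
  qed (use tc in \<open>auto simp: cen_def inertia_carrier\<close>)
  thus "card ?P = card (cen g)" by (rule bij_betw_same_card[symmetric])
  have "bij_betw (\<lambda>c. c \<otimes> t) (cen x) ?P"
  proof (rule bij_betwI[where g = "\<lambda>s. s \<otimes> inv t"])
    show "(\<lambda>c. c \<otimes> t) \<in> cen x \<rightarrow> ?P"
      using coset_conj_mult[OF eq _ tc _ g x] cl(1)[OF _ t] by (auto simp: cen_def inertia_carrier)
    show "(\<lambda>s. s \<otimes> inv t) \<in> ?P \<rightarrow> cen x"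
      using coset_conj_mult[OF eq' _ inv_closed[OF tc] _ x g] cl(1)[OF _ cl(2)[OF t]]
      by (auto simp: cen_def inertia_carrier)
  qed (use tc in \<open>auto simp: cen_def inertia_carrier m_assoc\<close>)
  thus "card ?P = card (cen x)" by (rule bij_betw_same_card[symmetric])
qed

text \<open>Solving \<open>csum_coset\<close> for the weight leaves only quantities that are the
  same for conjugate cosets.\<close>

lemma weight_conj:
  assumes g: "g \<in> inertia G \<theta>" and x: "x \<in> inertia G \<theta>" and t: "t \<in> inertia G \<theta>"
    and eq: "N #> (t \<otimes> g \<otimes> inv t) = N #> x"
  shows "weight g = weight x"
proof -
  note gc = inertia_carrier[OF g] and xc = inertia_carrier[OF x]
  have card: "card (cen g) = card (cen x)"
    using card_cen_transporter[OF gc xc t eq] by simp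
  have "of_nat (card N) / \<theta> \<one> * of_nat (card (cen x)) * of_int (weight g)
      = of_nat (card N) / \<theta> \<one> * of_nat (card (cen x)) * (of_int (weight x) :: complex)"
    using csum_coset[OF g] csum_coset[OF x] csum_coset_conj[OF t gc xc eq] unfolding card by simp
  moreover have "of_nat (card N) / \<theta> \<one> * of_nat (card (cen x)) \<noteq> (0 :: complex)"
    using card_N_pos card_subgroup_pos[OF cen_subgroup[OF xc]] theta_one by simp
  ultimately have "(of_int (weight g) :: complex) = of_int (weight x)" using mult_left_cancel by blast
  thus ?thesis by (simp only: of_int_eq_iff)
qed

section \<open>Counting over conjugacy classes\<close>

definition cls :: "'a \<Rightarrow> 'a set" where
  "cls x = {g \<in> inertia G \<theta>. \<exists>t\<in>inertia G \<theta>. N #> (t \<otimes> g \<otimes> inv t) = N #> x}"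

text \<open>A double count of the pairs (g, t) with t g t^-1 in N x: each g has as many partners as
  \<open>cen g\<close> has elements, and each t has |N|.\<close>

lemma sum_card_cen:
  assumes x: "x \<in> inertia G \<theta>"
  shows "(\<Sum>g\<in>cls x. card (cen g)) = card (inertia G \<theta>) * card N"
proof -
  let ?T = "inertia G \<theta>" and ?R = "\<lambda>g t. N #> (t \<otimes> g \<otimes> inv t) = N #> x"
  note xc = inertia_carrier[OF x]
  have finT: "finite ?T" by (rule finite_subgroup[OF inertia_subgroup])
  have finc: "finite (cls x)" using finT by (simp add: cls_def)
  have "(\<Sum>g\<in>cls x. card (cen g)) = (\<Sum>g\<in>cls x. card {t \<in> ?T. ?R g t})"
    using card_cen_transporter(1)[OF _ xc] by (intro sum.cong refl) (auto simp: cls_def inertia_carrier)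
  also have "\<dots> = (\<Sum>g\<in>cls x. \<Sum>t\<in>?T. if ?R g t then 1 else 0)"
    using finT by (simp add: sum.If_cases Int_def conj_commute)
  also have "\<dots> = (\<Sum>t\<in>?T. \<Sum>g\<in>cls x. if ?R g t then 1 else 0)" by (rule sum.swap)
  also have "\<dots> = (\<Sum>t\<in>?T. card N)"
  proof (rule sum.cong[OF refl])
    fix t assume t: "t \<in> ?T"
    note tc = inertia_carrier[OF t]
    note cl = subgroup.m_closed[OF inertia_subgroup] subgroup.m_inv_closed[OF inertia_subgroup]
    have "bij_betw (\<lambda>u. inv t \<otimes> (u \<otimes> x) \<otimes> t) N {g \<in> cls x. ?R g t}"
    proof (rule bij_betwI[where g = "\<lambda>g. t \<otimes> g \<otimes> inv t \<otimes> inv x"])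
      show "(\<lambda>u. inv t \<otimes> (u \<otimes> x) \<otimes> t) \<in> N \<rightarrow> {g \<in> cls x. ?R g t}"
      proof
        fix u assume u: "u \<in> N"
        let ?g = "inv t \<otimes> (u \<otimes> x) \<otimes> t"
        have "?g \<in> ?T" using cl t x N_inertia[OF u] by simp
        moreover have "t \<otimes> ?g \<otimes> inv t = u \<otimes> x" using tc xc N_carrier[OF u] by (simp add: m_assoc)
        hence "?R ?g t" using coset_eqI[OF u xc] by simp
        ultimately show "?g \<in> {g \<in> cls x. ?R g t}" using t by (auto simp: cls_def)
      qed
      show "(\<lambda>g. t \<otimes> g \<otimes> inv t \<otimes> inv x) \<in> {g \<in> cls x. ?R g t} \<rightarrow> N"
        using coset_eq_iff[OF _ xc] tc by (auto simp: cls_def inertia_carrier)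
    qed (use tc xc N_carrier in \<open>auto simp: cls_def inertia_carrier m_assoc\<close>)
    hence "card {g \<in> cls x. ?R g t} = card N" by (rule bij_betw_same_card[symmetric])
    thus "(\<Sum>g\<in>cls x. if ?R g t then 1 else 0) = card N"
      using finc by (simp add: sum.If_cases Int_def conj_commute)
  qed
  finally show ?thesis by simp
qed

lemma conj_classes_eq:
  "conj_classes (inertia_quotient G N \<theta>) = (\<lambda>x. {N #> (inv t \<otimes> x \<otimes> t) | t. t \<in> inertia G \<theta>}) ` inertia G \<theta>"
proof -
  let ?T = "inertia G \<theta>" and ?Q = "inertia_quotient G N \<theta>"
  interpret T: group "G\<lparr>carrier := ?T\<rparr>" by (rule subgroup_imp_group[OF inertia_subgroup])
  have nT: "N \<lhd> G\<lparr>carrier := ?T\<rparr>"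
    by (rule normal_restrict_supergroup[OF inertia_subgroup normal]) (auto simp: N_inertia)
  have rc: "N #>\<^bsub>G\<lparr>carrier := ?T\<rparr>\<^esub> a = N #> a" for a by (simp add: r_coset_def)
  have carr: "carrier ?Q = (\<lambda>x. N #> x) ` ?T" by (auto simp: FactGroup_def RCOSETS_def rc)
  have el: "conj_elem ?Q (N #> x) (N #> t) = N #> (inv t \<otimes> x \<otimes> t)" if "x \<in> ?T" "t \<in> ?T" for x t
    using T.conj_elem_FactGroup[OF nT, of x t] that m_inv_consistent[OF inertia_subgroup that(2)] by (simp add: rc)
  have "{conj_elem ?Q (N #> x) Y | Y. Y \<in> carrier ?Q} = {N #> (inv t \<otimes> x \<otimes> t) | t. t \<in> ?T}" if "x \<in> ?T" for x
  proof -
    have "{conj_elem ?Q (N #> x) Y | Y. Y \<in> carrier ?Q} = (\<lambda>t. conj_elem ?Q (N #> x) (N #> t)) ` ?T"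
      unfolding carr by blast
    also have "\<dots> = (\<lambda>t. N #> (inv t \<otimes> x \<otimes> t)) ` ?T" by (rule image_cong[OF refl el[OF that]])
    finally show ?thesis by blast
  qed
  note el' = this
  have "conj_classes ?Q = (\<lambda>x. {conj_elem ?Q (N #> x) Y | Y. Y \<in> carrier ?Q}) ` ?T"
    unfolding conj_classes_def by (subst (2) carr) blast
  also have "\<dots> = (\<lambda>x. {N #> (inv t \<otimes> x \<otimes> t) | t. t \<in> ?T}) ` ?T"
    by (rule image_cong[OF refl el'])
  finally show ?thesis .
qed

lemma Union_class:
  assumes x: "x \<in> inertia G \<theta>"
  shows "\<Union>{N #> (inv t \<otimes> x \<otimes> t) | t. t \<in> inertia G \<theta>} = cls x"
proof
  let ?T = "inertia G \<theta>"
  note xc = inertia_carrier[OF x] and cl = subgroup.m_closed[OF inertia_subgroup] subgroup.m_inv_closed[OF inertia_subgroup]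
  show "\<Union>{N #> (inv t \<otimes> x \<otimes> t) | t. t \<in> ?T} \<subseteq> cls x"
  proof
    fix g assume "g \<in> \<Union>{N #> (inv t \<otimes> x \<otimes> t) | t. t \<in> ?T}"
    then obtain t where t: "t \<in> ?T" and g: "g \<in> N #> (inv t \<otimes> x \<otimes> t)" by auto
    note tc = inertia_carrier[OF t]
    from g obtain u where u: "u \<in> N" "g = u \<otimes> (inv t \<otimes> x \<otimes> t)" by (auto simp: r_coset_def)
    have gT: "g \<in> ?T" unfolding u(2) using cl t x N_inertia[OF u(1)] by simp
    have "N #> g = N #> (inv t \<otimes> x \<otimes> t)" unfolding u(2) using tc xc by (intro coset_eqI[OF u(1)]) simp
    hence "N #> x = N #> (t \<otimes> g \<otimes> inv t)"
      using coset_conj_iff[OF xc inertia_carrier[OF gT] tc] by simp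
    thus "g \<in> cls x" using gT t by (auto simp: cls_def)
  qed
  show "cls x \<subseteq> \<Union>{N #> (inv t \<otimes> x \<otimes> t) | t. t \<in> ?T}"
  proof
    fix g assume "g \<in> cls x"
    then obtain t where g: "g \<in> ?T" and t: "t \<in> ?T" "N #> (t \<otimes> g \<otimes> inv t) = N #> x" by (auto simp: cls_def)
    have "N #> (inv t \<otimes> x \<otimes> t) = N #> g"
      using coset_conj_iff[OF xc inertia_carrier[OF g] inertia_carrier[OF t(1)]] t(2) by simp
    moreover have "g \<in> N #> g" by (rule rcos_self[OF inertia_carrier[OF g] N_subgroup])
    ultimately show "g \<in> \<Union>{N #> (inv t \<otimes> x \<otimes> t) | t. t \<in> ?T}" using t(1) by blast
  qed
qed

lemma sum_weight:
  "(\<Sum>g\<in>inertia G \<theta>. int (card (cen g)) * weight g) = int (card (inertia G \<theta>) * card N) *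
     (int (card (good_classes_of_type G N \<theta> 1)) - int (card (good_classes_of_type G N \<theta> (- 1))))"
proof -
  let ?T = "inertia G \<theta>"
  define K where "K x = {N #> (inv t \<otimes> x \<otimes> t) | t. t \<in> ?T}" for x
  have classes: "conj_classes (inertia_quotient G N \<theta>) = K ` ?T" unfolding conj_classes_eq K_def ..
  have U: "\<Union>(K x) = cls x" if "x \<in> ?T" for x unfolding K_def by (rule Union_class[OF that])
  have finT: "finite ?T" by (rule finite_subgroup[OF inertia_subgroup])
  note cl = subgroup.m_closed[OF inertia_subgroup] subgroup.m_inv_closed[OF inertia_subgroup]
  have self: "x \<in> cls x" if "x \<in> ?T" for x
    using that inertia_carrier[OF that] subgroup.one_closed[OF inertia_subgroup]
    by (auto simp: cls_def intro!: bexI[of _ \<one>])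
  have w: "weight g = weight x" if "x \<in> ?T" "g \<in> cls x" for x g
    using that weight_conj[of g x] by (auto simp: cls_def)
  have K_eq: "K x = K g" if x: "x \<in> ?T" and g: "g \<in> cls x" for x g
  proof -
    have sub: "K b \<subseteq> K a" if ab: "a \<in> ?T" "b \<in> ?T" "t \<in> ?T" "N #> (t \<otimes> a \<otimes> inv t) = N #> b" for a b t
    proof
      fix Y assume "Y \<in> K b"
      then obtain s where s: "s \<in> ?T" "Y = N #> (inv s \<otimes> b \<otimes> s)" by (auto simp: K_def)
      note c = inertia_carrier[OF ab(1)] inertia_carrier[OF ab(2)] inertia_carrier[OF ab(3)] inertia_carrier[OF s(1)]
      have "N #> (inv s \<otimes> (t \<otimes> a \<otimes> inv t) \<otimes> inv (inv s)) = N #> (inv s \<otimes> b \<otimes> inv (inv s))"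
        using c by (intro coset_conj[OF ab(4)]) auto
      moreover have "inv s \<otimes> (t \<otimes> a \<otimes> inv t) \<otimes> inv (inv s) = inv (inv t \<otimes> s) \<otimes> a \<otimes> (inv t \<otimes> s)"
        using c by (simp add: m_assoc inv_mult_group)
      ultimately have "Y = N #> (inv (inv t \<otimes> s) \<otimes> a \<otimes> (inv t \<otimes> s))" using s(2) c by simp
      moreover have "inv t \<otimes> s \<in> ?T" using cl ab(3) s(1) by simp
      ultimately show "Y \<in> K a" unfolding K_def by blast
    qed
    from g obtain t where gT: "g \<in> ?T" and t: "t \<in> ?T" "N #> (t \<otimes> g \<otimes> inv t) = N #> x" by (auto simp: cls_def)
    show ?thesis
      using sub[OF gT x t] sub[OF x gT cl(2)[OF t(1)]
          coset_conj_inv[OF t(2) inertia_carrier[OF t(1)] inertia_carrier[OF gT] inertia_carrier[OF x]]] by blast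
  qed
  have cls_T: "cls x \<subseteq> ?T" for x by (auto simp: cls_def)
  have UT: "?T = (\<Union>C\<in>K ` ?T. \<Union>C)" using U self subsetD[OF cls_T] by auto
  \<comment> \<open>Any member of the union may be taken, as the weight is constant on it.\<close>
  define wt where "wt C = weight (SOME g. g \<in> \<Union>C)" for C
  have wt: "weight g = wt C" if C: "C \<in> K ` ?T" and g: "g \<in> \<Union>C" for C g
  proof -
    obtain x where x: "x \<in> ?T" "C = K x" using C by blast
    have "(SOME g. g \<in> \<Union>C) \<in> \<Union>C" by (rule someI[of "\<lambda>g. g \<in> \<Union>C", OF g])
    thus ?thesis using w[OF x(1)] g U[OF x(1)] by (simp add: wt_def x(2))
  qed
  have ne: "\<exists>g. g \<in> \<Union>C" if "C \<in> K ` ?T" for C using that U self by blast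
  have "(\<Sum>g\<in>?T. int (card (cen g)) * weight g) = (\<Sum>g\<in>(\<Union>C\<in>K ` ?T. \<Union>C). int (card (cen g)) * weight g)"
    using UT by simp
  also have "\<dots> = (\<Sum>C\<in>K ` ?T. \<Sum>g\<in>\<Union>C. int (card (cen g)) * weight g)"
  proof (rule sum.UNION_disjoint)
    show "finite (K ` ?T)" using finT by simp
    show "\<forall>C\<in>K ` ?T. finite (\<Union>C)" using U finite_subset[OF cls_T finT] by auto
    show "\<forall>C\<in>K ` ?T. \<forall>D\<in>K ` ?T. C \<noteq> D \<longrightarrow> \<Union>C \<inter> \<Union>D = {}"
    proof (intro ballI impI)
      fix C D assume C: "C \<in> K ` ?T" and D: "D \<in> K ` ?T" and "C \<noteq> D"
      obtain x y where x: "x \<in> ?T" "C = K x" and y: "y \<in> ?T" "D = K y" using C D by blast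
      have False if "g \<in> cls x" "g \<in> cls y" for g
        using K_eq[OF x(1) that(1)] K_eq[OF y(1) that(2)] x(2) y(2) \<open>C \<noteq> D\<close> by simp
      thus "\<Union>C \<inter> \<Union>D = {}" using U[OF x(1)] U[OF y(1)] x(2) y(2) by auto
    qed
  qed
  also have "\<dots> = (\<Sum>C\<in>K ` ?T. int (card ?T * card N) * wt C)"
  proof (rule sum.cong[OF refl])
    fix C assume C: "C \<in> K ` ?T"
    then obtain x where x: "x \<in> ?T" "C = K x" by blast
    have "(\<Sum>g\<in>\<Union>C. int (card (cen g)) * weight g) = (\<Sum>g\<in>\<Union>C. int (card (cen g))) * wt C"
      by (simp only: sum_distrib_right wt[OF C] cong: sum.cong)
    also have "(\<Sum>g\<in>\<Union>C. int (card (cen g))) = int (card ?T * card N)"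
      using sum_card_cen[OF x(1)] U[OF x(1)] x(2) by (simp only: of_nat_sum[symmetric])
    finally show "(\<Sum>g\<in>\<Union>C. int (card (cen g)) * weight g) = int (card ?T * card N) * wt C" .
  qed
  also have "\<dots> = int (card ?T * card N) * (\<Sum>C\<in>K ` ?T. wt C)" by (simp only: sum_distrib_left)
  \<comment> \<open>The weight takes only the values 1, -1 and 0, so it is a difference of two
    indicators.\<close>
  also have "(\<Sum>C\<in>K ` ?T. wt C) = (\<Sum>C\<in>K ` ?T. (if wt C = 1 then 1 else 0) - (if wt C = - 1 then 1 else 0))"
    by (intro sum.cong refl) (auto simp: wt_def weight_def sigma_def Let_def)
  also have "\<dots> = int (card {C \<in> K ` ?T. wt C = 1}) - int (card {C \<in> K ` ?T. wt C = - 1})"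
    using finT by (simp add: sum_subtractf sum.If_cases Int_def conj_commute)
  finally have total: "(\<Sum>g\<in>?T. int (card (cen g)) * weight g) = int (card ?T * card N) *
      (int (card {C \<in> K ` ?T. wt C = 1}) - int (card {C \<in> K ` ?T. wt C = - 1}))" .
  \<comment> \<open>Weight 0 also covers the classes that are not good, so only nonzero weights
    correspond to types.\<close>
  have types: "{C \<in> K ` ?T. wt C = s} = good_classes_of_type G N \<theta> s" if "s \<noteq> 0" for s
  proof -
    have "wt C = s \<longleftrightarrow> (\<forall>x\<in>\<Union>C. good G N \<theta> x \<and> sigma G N \<theta> x = s)" if C: "C \<in> K ` ?T" for C
    proof
      assume s: "wt C = s"
      show "\<forall>x\<in>\<Union>C. good G N \<theta> x \<and> sigma G N \<theta> x = s"
      proof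
        fix x assume "x \<in> \<Union>C"
        hence "weight x = s" using wt[OF C] s by simp
        thus "good G N \<theta> x \<and> sigma G N \<theta> x = s" using \<open>s \<noteq> 0\<close> by (auto simp: weight_def split: if_splits)
      qed
    next
      assume *: "\<forall>x\<in>\<Union>C. good G N \<theta> x \<and> sigma G N \<theta> x = s"
      obtain g where g: "g \<in> \<Union>C" using ne[OF C] by blast
      hence "good G N \<theta> g \<and> sigma G N \<theta> g = s" using * by blast
      thus "wt C = s" using wt[OF C g] by (simp add: weight_def)
    qed
    thus ?thesis unfolding good_classes_of_type_def classes by blast
  qed
  show ?thesis using total types[of 1] types[of "- 1"] by simp
qed

lemma card_real_eq_types:
  "int (card {\<chi> \<in> Irr G. lies_over G N \<theta> \<chi> \<and> (\<forall>g\<in>carrier G. \<chi> g \<in> \<real>)})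
   = int (card (good_classes_of_type G N \<theta> 1)) - int (card (good_classes_of_type G N \<theta> (- 1)))"
  (is "int ?L = ?R")
proof -
  let ?T = "inertia G \<theta>" and ?k = "of_nat (card (inertia G \<theta>)) * of_nat (card N) :: complex"
  have "(\<Sum>g\<in>carrier G. csum g) = (\<Sum>g\<in>?T. csum g)"
    using finite_carrier inertia_carrier csum_zero by (intro sum.mono_neutral_right) auto
  \<comment> \<open>Left multiplication by u permutes the inertia group. Averaging over u replaces
    single values by the coset sums of \<open>csum_coset\<close>.\<close>
  also have "\<dots> = (\<Sum>u\<in>N. \<Sum>g\<in>?T. csum (u \<otimes> g)) / of_nat (card N)"
  proof -
    have "(\<Sum>g\<in>?T. csum (u \<otimes> g)) = (\<Sum>g\<in>?T. csum g)" if u: "u \<in> N" for u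
    proof (rule sum.reindex_bij_betw)
      show "bij_betw (\<lambda>g. u \<otimes> g) ?T ?T"
        using N_inertia[OF u] N_carrier[OF u] inertia_carrier
          subgroup.m_closed[OF inertia_subgroup] subgroup.m_inv_closed[OF inertia_subgroup]
        by (intro bij_betwI[where g = "\<lambda>g. inv u \<otimes> g"]) auto
    qed
    thus ?thesis using card_N_pos by simp
  qed
  also have "\<dots> = (\<Sum>g\<in>?T. \<Sum>u\<in>N. csum (u \<otimes> g)) / of_nat (card N)"
    by (subst sum.swap) (rule refl)
  also have "\<dots> = (\<Sum>g\<in>?T. of_nat (card N) / \<theta> \<one> * of_int (int (card (cen g)) * weight g)) / of_nat (card N)"
    by (simp add: csum_coset mult.assoc)
  also have "\<dots> = of_int (\<Sum>g\<in>?T. int (card (cen g)) * weight g) / \<theta> \<one>"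
    unfolding sum_distrib_left[symmetric] of_int_sum using card_N_pos by simp
  also have "\<dots> = ?k * of_int ?R / \<theta> \<one>" unfolding sum_weight by simp
  finally have s: "(\<Sum>g\<in>carrier G. csum g) = ?k * of_int ?R / \<theta> \<one>" .
  have "of_nat ?L = \<theta> \<one> / ?k * (\<Sum>g\<in>carrier G. csum g)"
    unfolding csum_def by (rule card_real_eq_sum)
  also have "\<dots> = of_int ?R"
    unfolding s using theta_one card_N_pos card_subgroup_pos[OF inertia_subgroup] by simp
  finally have "(of_int (int ?L) :: complex) = of_int ?R" by simp
  thus ?thesis by (simp only: of_int_eq_iff)
qed

end

theorem theorem1:
  fixes G :: "('a, 'b) monoid_scheme" and N :: "'a set" and \<theta> :: "'a \<Rightarrow> complex"
  assumes "group G" and "finite (carrier G)"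
    and "N \<lhd> G"
    and "\<theta> \<in> Irr (G\<lparr>carrier := N\<rparr>)"
    and "\<exists>g\<in>carrier G. conj_character G \<theta> g = dual_character \<theta>"
  shows "int (card {\<chi> \<in> Irr G. lies_over G N \<theta> \<chi> \<and> (\<forall>g\<in>carrier G. \<chi> g \<in> \<real>)})
       = int (card (good_classes_of_type G N \<theta> 1))
         - int (card (good_classes_of_type G N \<theta> (- 1)))"
proof -
  interpret irr_over_normal G N \<theta>
    using assms(1-4) by (simp add: irr_over_normal_def irr_over_normal_axioms_def fin_group_def fin_group_axioms_def)
  show ?thesis by (rule card_real_eq_types)
qed

end
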